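(* Let $\mathcal{G}$ be the (infinite) Ginibre ensemble on $\mathbb{C}$. Suppose that $a_R$ satisfies $1\ll a_R\ll R$ as $R\to+\infty$. Then for every bounded measurable and compactly supported function $f:\mathbb{R}\to\mathbb{R}$, $$\sqrt{\frac{a_R}{R}}\sum_{z\in\mathcal{G}}f\big(a_R(|z|-R)\big)-2\sqrt{\frac{R}{a_R}}\int_{\mathbb{R}}f(x)\,\mathrm{d}x\ \xrightarrow[R\to+\infty]{\mathrm{law}}\ \mathcal{N}\Big(0,2\int_{\mathbb{R}}f^2(x)\,\mathrm{d}x\Big).$$
   Context: Determinantal point processes: let $X$ be a locally compact Polish space with a Radon measure $\mu$, and $K:X\times X\to\mathbb{C}$ measurable. A simple point process $\mathscr{X}$ on $X$ (a random locally finite configuration with no multiple points, identified with a random discrete subset; $\mathscr{X}(\Delta)$ is the number of points in $\Delta$) is determinantal with kernel $K$ with respect to the reference measure $\mu$ if for every $k\ge 1$ and all mutually disjoint pre-compact Borel sets $\Delta_1,\dots,\Delta_k\subset X$, $$\mathbb{E}\Big[\prod_{i=1}^k\mathscr{X}(\Delta_i)\Big]=\int_{\Delta_1\times\cdots\times\Delta_k}\det[K(x_i,x_j)]_{1\le i,j\le k}\,\mathrm{d}\mu(x_1)\cdots\mathrm{d}\mu(x_k).$$ Ginibre ensemble: $\mathcal{G}$ is the determinantal point process on $\mathbb{C}$ with respect to Lebesgue measure $m$ with kernel $K_{\mathcal{G}}(z,w)=\frac{1}{\pi}e^{z\overline{w}-\frac{|z|^2}{2}-\frac{|w|^2}{2}}$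 (equivalently, with reference measure $\frac1\pi e^{-|z|^2}\mathrm{d}m(z)$ and the kernel $e^{z\overline w}$ of the orthogonal projection onto the holomorphic functions). Notation: $a_R$ is a positive function of $R$, and $1\ll a_R\ll R$ means $a_R\to+\infty$ and $a_R/R\to0$ as $R\to+\infty$. $\mathcal{N}(0,V)$ is the centered real Gaussian law with variance $V$ (the Dirac mass at $0$ if $V=0$). *)

theory Defs
  imports "HOL-Probability.Probability" "Jordan_Normal_Form.Determinant"
begin

section \<open>Determinantal point processes\<close>

text \<open>On a locally compact Polish space every locally finite Borel measure is regular, so that
  finiteness on compact sets is all that has to be required of a Radon measure.\<close>

definition radon_measure :: "'a::polish_space measure \<Rightarrow> bool" where
  "radon_measure \<mu> \<longleftrightarrow>
     sets \<mu> = sets borel \<and> (\<forall>C. compact C \<longrightarrow> emeasure \<mu> C < \<infinity>)"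

definition precompact_borel :: "'a::polish_space set \<Rightarrow> bool" where
  "precompact_borel D \<longleftrightarrow> D \<in> sets borel \<and> compact (closure D)"

text \<open>A configuration without multiple points is identified with the set of its points.\<close>

definition simple_point_process :: "'w measure \<Rightarrow> ('w \<Rightarrow> 'a::polish_space set) \<Rightarrow> bool" where
  "simple_point_process M X \<longleftrightarrow>
     prob_space M \<and>
     (\<forall>\<omega>\<in>space M. \<forall>C. compact C \<longrightarrow> finite (X \<omega> \<inter> C)) \<and>
     (\<forall>D. precompact_borel D \<longrightarrow> (\<lambda>\<omega>. card (X \<omega> \<inter> D)) \<in> measurable M (count_space UNIV))"

text \<open>Since the Bochner integral of a non-integrable function is \<open>0\<close>, integrability of both sides
  is part of the identity that defines the correlation functions.\<close>

definition determinantal_process ::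
    "'w measure \<Rightarrow> ('w \<Rightarrow> 'a::polish_space set) \<Rightarrow> 'a measure \<Rightarrow> ('a \<Rightarrow> 'a \<Rightarrow> complex) \<Rightarrow> bool" where
  "determinantal_process M X \<mu> K \<longleftrightarrow>
     locally compact (UNIV :: 'a set) \<and> radon_measure \<mu> \<and>
     (\<lambda>(x, y). K x y) \<in> borel_measurable (\<mu> \<Otimes>\<^sub>M \<mu>) \<and>
     simple_point_process M X \<and>
     (\<forall>k\<ge>1. \<forall>D :: nat \<Rightarrow> 'a set.
        (\<forall>i<k. precompact_borel (D i)) \<and> disjoint_family_on D {..<k} \<longrightarrow>
        integrable M (\<lambda>\<omega>. \<Prod>i<k. real (card (X \<omega> \<inter> D i))) \<and>
        set_integrable (PiM {..<k} (\<lambda>_. \<mu>)) (PiE {..<k} D)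
          (\<lambda>x. Determinant.det (Matrix.mat k k (\<lambda>(i, j). K (x i) (x j)))) \<and>
        complex_of_real (\<integral>\<omega>. (\<Prod>i<k. real (card (X \<omega> \<inter> D i))) \<partial>M) =
          set_lebesgue_integral (PiM {..<k} (\<lambda>_. \<mu>)) (PiE {..<k} D)
            (\<lambda>x. Determinant.det (Matrix.mat k k (\<lambda>(i, j). K (x i) (x j)))))"


section \<open>The Ginibre ensemble\<close>

definition ginibre_kernel :: "complex \<Rightarrow> complex \<Rightarrow> complex" where
  "ginibre_kernel z w =
     (1 / complex_of_real pi) *
     exp (z * cnj w - complex_of_real ((cmod z)\<^sup>2 / 2) - complex_of_real ((cmod w)\<^sup>2 / 2))"

definition ginibre_ensemble :: "'w measure \<Rightarrow> ('w \<Rightarrow> complex set) \<Rightarrow> bool" where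
  "ginibre_ensemble M G \<longleftrightarrow> determinantal_process M G lborel ginibre_kernel"


section \<open>Convergence in law\<close>

definition gaussian_law :: "real \<Rightarrow> real measure" where
  "gaussian_law V =
     (if V = 0 then return borel 0
      else density lborel (\<lambda>x. ennreal (normal_density 0 (sqrt V) x)))"

text \<open>The library's \<^const>\<open>weak_conv_m\<close> is for sequences; here the parameter runs along an
  arbitrary filter.  Measurability is required because \<^const>\<open>distr\<close> is meaningless without it.\<close>

definition converges_in_law ::
    "'w measure \<Rightarrow> ('i \<Rightarrow> 'w \<Rightarrow> real) \<Rightarrow> real measure \<Rightarrow> 'i filter \<Rightarrow> bool" where
  "converges_in_law M Y \<nu> F \<longleftrightarrow>
     (\<forall>\<^sub>F i in F. Y i \<in> borel_measurable M) \<and>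
     (\<forall>x. isCont (cdf \<nu>) x \<longrightarrow> ((\<lambda>i. cdf (distr M borel (Y i)) x) \<longlongrightarrow> cdf \<nu> x) F)"

end

theory Submission
  imports Defs
begin

text \<open>Since the annuli are rotation invariant, expanding the determinant of the truncated kernel
  \<open>\<Sum>n<N. \<phi>\<^sub>n(z) cnj \<phi>\<^sub>n(w)\<close> and integrating out the angles leaves only the terms with pairwise distinct
  indices. Hence the counts of \<open>|z|\<^sup>2\<close> in disjoint sets have the same product moments as those of
  independent variables \<open>s\<^sub>n\<close> with Gamma law of density \<open>s ^ n * exp (- s) / n!\<close>. Product moments over
  disjoint sets determine the law of a point process without multiple points and with an exponential
  moment, so the radial statistic is distributed as the sum of the independent \<open>h s\<^sub>n\<close>.

  The sum of the Gamma densities is \<open>1\<close>, so the means of \<open>h s\<^sub>n\<close> add up to \<open>\<integral> h\<close> and the second moments to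
  \<open>\<integral> h\<^sup>2\<close>. Each density is at most \<open>1 / sqrt s\<close>, so on an annulus of width of order \<open>1 / a\<^sub>R\<close> around the circle
  of radius \<open>R\<close> every single mean of \<open>f\<close> is of order \<open>1 / a\<^sub>R\<close>, and the squared means are negligible. The
  rescaled summands tend to \<open>0\<close> uniformly, and a second order expansion of their characteristic
  functions gives the Gaussian limit.\<close>

section \<open>Lebesgue measure on the complex plane\<close>

text \<open>The defining identity offers products of counts over disjoint sets only, so neither
  powers of one count nor a Laplace functional can be read off it. Fine grids get around this: once
  the points lie in different cells, the functional is a product that is affine in each cell count.
  For the radii this calls for a proof that distinct points almost surely have distinct moduli,
  since simplicity concerns points of the plane. The squared modulus carries planar Lebesgue measure
  to pi times Lebesgue measure on the half-line, which avoids polar coordinates. The 2 in the limit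
  is the Jacobian of s = (R + x / a_R)^2, which is 2 R / a_R to leading order: the prefactor
  sqrt(a_R / R) turns it into 2 sqrt(R / a_R) in the mean and into 2 in the variance. The two halves
  of the growth condition act separately: a_R / R -> 0 makes the rescaled summands uniformly small,
  and a_R -> infinity removes the sum of the squared means, which is of order 1 / a_R after
  rescaling.\<close>

lemma measurable_Complex [measurable (raw)]:
  assumes [measurable]: "f \<in> borel_measurable M" "g \<in> borel_measurable M"
  shows "(\<lambda>x. Complex (f x) (g x)) \<in> borel_measurable M"
  by (subst borel_measurable_complex_iff) simp

text \<open>Lebesgue measure is determined by its values on open boxes. The identification opens the
  way to Fubini in the real and imaginary parts, on which the shears below rest.\<close>

lemma lborel_complex_eq_distr_prod:
  "(lborel :: complex measure) = distr (lborel :: (real \<times> real) measure) borel (\<lambda>(x, y). Complex x y)"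
proof (rule lborel_eqI)
  have meas: "(\<lambda>(x, y). Complex x y) \<in> borel_measurable (lborel :: (real \<times> real) measure)"
    by (simp add: borel_prod[symmetric])
  fix l u :: complex
  assume le: "\<And>b. b \<in> Basis \<Longrightarrow> inner l b \<le> inner u b"
  have le': "Re l \<le> Re u" "Im l \<le> Im u"
    using le[of 1] le[of \<i>] by (auto simp: Basis_complex_def inner_complex_def)
  have eq: "(\<lambda>(x, y). Complex x y) -` box l u = box (Re l, Im l) (Re u, Im u)"
    by (auto simp: box_def Basis_complex_def Basis_prod_def inner_complex_def)
  have bu: "(Basis :: (real \<times> real) set) = {(1, 0), (0, 1)}"
    by (auto simp: Basis_prod_def)
  have "emeasure (distr (lborel :: (real \<times> real) measure) borel (\<lambda>(x, y). Complex x y)) (box l u)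
      = emeasure lborel (box (Re l, Im l) (Re u, Im u))"
    using meas by (subst emeasure_distr) (auto simp: eq)
  also have "\<dots> = ennreal ((Re u - Re l) * (Im u - Im l))"
    using le' by (subst emeasure_lborel_box_eq) (auto simp: bu)
  also have "(Re u - Re l) * (Im u - Im l) = prod (inner (u - l)) Basis"
    by (simp add: Basis_complex_def inner_complex_def)
  finally show "emeasure (distr (lborel :: (real \<times> real) measure) borel (\<lambda>(x, y). Complex x y)) (box l u)
      = ennreal (prod (inner (u - l)) Basis)" .
qed simp

lemma nn_integral_lborel_complex:
  fixes F :: "complex \<Rightarrow> ennreal"
  assumes [measurable]: "F \<in> borel_measurable borel"
  shows "(\<integral>\<^sup>+z. F z \<partial>lborel) = (\<integral>\<^sup>+x. \<integral>\<^sup>+y. F (Complex x y) \<partial>lborel \<partial>lborel)"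
    and "(\<integral>\<^sup>+z. F z \<partial>lborel) = (\<integral>\<^sup>+y. \<integral>\<^sup>+x. F (Complex x y) \<partial>lborel \<partial>lborel)"
proof -
  have [measurable]: "(\<lambda>(x, y). Complex x y) \<in> borel_measurable (borel :: (real \<times> real) measure)"
    by (simp add: borel_prod[symmetric])
  have [measurable]: "(\<lambda>p::real\<times>real. F (Complex (fst p) (snd p))) \<in> borel_measurable (lborel \<Otimes>\<^sub>M lborel)"
    by measurable
  have 1: "(\<integral>\<^sup>+z. F z \<partial>lborel) = (\<integral>\<^sup>+p. F (Complex (fst p) (snd p)) \<partial>(lborel \<Otimes>\<^sub>M lborel))"
    by (subst lborel_complex_eq_distr_prod, subst nn_integral_distr)
       (auto simp: lborel_prod case_prod_beta)
  show "(\<integral>\<^sup>+z. F z \<partial>lborel) = (\<integral>\<^sup>+x. \<integral>\<^sup>+y. F (Complex x y) \<partial>lborel \<partial>lborel)"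
    unfolding 1 by (subst lborel.nn_integral_fst[symmetric]) auto
  show "(\<integral>\<^sup>+z. F z \<partial>lborel) = (\<integral>\<^sup>+y. \<integral>\<^sup>+x. F (Complex x y) \<partial>lborel \<partial>lborel)"
    unfolding 1 by (subst lborel_pair.nn_integral_snd[symmetric]) auto
qed

lemma nn_integral_lborel_plus:
  fixes F :: "real \<Rightarrow> ennreal"
  assumes [measurable]: "F \<in> borel_measurable borel"
  shows "(\<integral>\<^sup>+x. F (x + c) \<partial>lborel) = (\<integral>\<^sup>+x. F x \<partial>lborel)"
proof -
  have "(\<integral>\<^sup>+x. F x \<partial>lborel) = (\<integral>\<^sup>+x. F x \<partial>distr lborel borel ((+) c))"
    by (simp add: lborel_distr_plus)
  also have "\<dots> = (\<integral>\<^sup>+x. F (c + x) \<partial>lborel)"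
    by (subst nn_integral_distr) auto
  finally show ?thesis by (simp add: add.commute)
qed

text \<open>For a fixed imaginary part the shear is a translation of the real line, so it disappears
  when the real part is integrated first.\<close>

lemma nn_integral_shear_Re:
  fixes F :: "complex \<Rightarrow> ennreal"
  assumes [measurable]: "F \<in> borel_measurable borel"
  shows "(\<integral>\<^sup>+z. F (z + of_real (c * Im z)) \<partial>lborel) = (\<integral>\<^sup>+z. F z \<partial>lborel)"
proof -
  have [measurable]: "(\<lambda>x. F (Complex x y)) \<in> borel_measurable borel" for y
    by measurable
  have "(\<integral>\<^sup>+z. F (z + of_real (c * Im z)) \<partial>lborel) =
      (\<integral>\<^sup>+y. \<integral>\<^sup>+x. F (Complex x y + of_real (c * y)) \<partial>lborel \<partial>lborel)"
    by (subst nn_integral_lborel_complex(2)) (auto simp: borel_measurable_Im)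
  also have "\<dots> = (\<integral>\<^sup>+y. \<integral>\<^sup>+x. F (Complex (x + c * y) y) \<partial>lborel \<partial>lborel)"
    by (intro nn_integral_cong arg_cong[where f = F]) (auto simp: complex_eq_iff)
  also have "\<dots> = (\<integral>\<^sup>+y. \<integral>\<^sup>+x. F (Complex x y) \<partial>lborel \<partial>lborel)"
    by (intro nn_integral_cong nn_integral_lborel_plus[where F = "\<lambda>x. F (Complex x y)" and c = "c * y" for y]) auto
  finally show ?thesis by (simp add: nn_integral_lborel_complex(2))
qed

lemma nn_integral_shear_Im:
  fixes F :: "complex \<Rightarrow> ennreal"
  assumes [measurable]: "F \<in> borel_measurable borel"
  shows "(\<integral>\<^sup>+z. F (z + \<i> * of_real (c * Re z)) \<partial>lborel) = (\<integral>\<^sup>+z. F z \<partial>lborel)"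
proof -
  have [measurable]: "(\<lambda>y. F (Complex x y)) \<in> borel_measurable borel" for x
    by measurable
  have "(\<integral>\<^sup>+z. F (z + \<i> * of_real (c * Re z)) \<partial>lborel) =
      (\<integral>\<^sup>+x. \<integral>\<^sup>+y. F (Complex x y + \<i> * of_real (c * x)) \<partial>lborel \<partial>lborel)"
    by (subst nn_integral_lborel_complex(1)) (auto simp: borel_measurable_Re)
  also have "\<dots> = (\<integral>\<^sup>+x. \<integral>\<^sup>+y. F (Complex x (y + c * x)) \<partial>lborel \<partial>lborel)"
    by (intro nn_integral_cong arg_cong[where f = F]) (auto simp: complex_eq_iff)
  also have "\<dots> = (\<integral>\<^sup>+x. \<integral>\<^sup>+y. F (Complex x y) \<partial>lborel \<partial>lborel)"
    by (intro nn_integral_cong nn_integral_lborel_plus[where F = "\<lambda>y. F (Complex x y)" and c = "c * x" for x]) auto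
  finally show ?thesis by (simp add: nn_integral_lborel_complex(1))
qed

text \<open>A rotation by an angle that is not a multiple of \<open>\<pi>\<close> is a product of three shears.\<close>

lemma lborel_distr_cis:
  assumes s: "sin \<theta> \<noteq> 0"
  shows "distr lborel borel (\<lambda>z. cis \<theta> * z) = (lborel :: complex measure)"
proof (rule measure_eqI)
  fix B :: "complex set" assume "B \<in> sets (distr lborel borel (\<lambda>z. cis \<theta> * z))"
  then have [measurable]: "B \<in> sets borel" by simp
  \<comment> \<open>This is the tangent of \<theta>/2; shears with parameters \<open>- t\<close>,
    \<open>sin \<theta>\<close>, \<open>- t\<close> compose to the rotation by \<theta>.\<close>
  define t where "t = (1 - cos \<theta>) / sin \<theta>"
  have st: "sin \<theta> * t = 1 - cos \<theta>" using s by (simp add: t_def)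
  have tc: "t * (1 + cos \<theta>) = sin \<theta>"
    using s sin_cos_squared_add[of \<theta>] by (simp add: t_def field_simps power2_eq_square)
  define A where "A = (\<lambda>z::complex. z + of_real ((- t) * Im z))"
  define C where "C = (\<lambda>z::complex. z + \<i> * of_real (sin \<theta> * Re z))"
  have [measurable]: "A \<in> borel_measurable borel" "C \<in> borel_measurable borel"
    unfolding A_def C_def by (auto simp: borel_measurable_Re borel_measurable_Im)
  have rot: "A (C (A z)) = cis \<theta> * z" for z
  proof (rule complex_eqI)
    have "Re (A (C (A z))) = (1 - sin \<theta> * t) * Re z - (t + t * (1 - sin \<theta> * t)) * Im z"
      by (simp add: A_def C_def algebra_simps)
    also have "\<dots> = cos \<theta> * Re z - sin \<theta> * Im z"
    proof -
      have 1: "1 - sin \<theta> * t = cos \<theta>" using st by simp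
      show ?thesis unfolding 1 using tc by (simp add: algebra_simps)
    qed
    finally show "Re (A (C (A z))) = Re (cis \<theta> * z)" by simp
    have "Im (A (C (A z))) = sin \<theta> * Re z + (1 - sin \<theta> * t) * Im z"
      by (simp add: A_def C_def algebra_simps)
    also have "1 - sin \<theta> * t = cos \<theta>" using st by simp
    finally show "Im (A (C (A z))) = Im (cis \<theta> * z)" by (simp add: algebra_simps)
  qed
  have "emeasure (distr lborel borel (\<lambda>z. cis \<theta> * z)) B = (\<integral>\<^sup>+z. indicator B z \<partial>distr lborel borel (\<lambda>z. cis \<theta> * z))"
    by simp
  also have "\<dots> = (\<integral>\<^sup>+z. indicator B (A (C (A z))) \<partial>lborel)"
    unfolding rot by (subst nn_integral_distr) auto
  also have "\<dots> = (\<integral>\<^sup>+z. indicator B (A (C z)) \<partial>lborel)"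
    using nn_integral_shear_Re[of "\<lambda>z. indicator B (A (C z))" "- t"]
    by (simp add: A_def)
  also have "\<dots> = (\<integral>\<^sup>+z. indicator B (A z) \<partial>lborel)"
    using nn_integral_shear_Im[of "\<lambda>z. indicator B (A z)" "sin \<theta>"] by (simp add: C_def)
  also have "\<dots> = (\<integral>\<^sup>+z. indicator B z \<partial>lborel)"
    using nn_integral_shear_Re[of "\<lambda>z. indicator B z" "- t"] by (simp add: A_def)
  finally show "emeasure (distr lborel borel (\<lambda>z. cis \<theta> * z)) B = emeasure lborel B" by simp
qed simp

text \<open>Both measures are compared on half-lines, where the left one gives the area pi s of a
  disc of radius sqrt s.\<close>

lemma distr_cmod_power2_lborel:
  "distr lborel borel (\<lambda>z::complex. (cmod z)\<^sup>2) = density lborel (\<lambda>s. ennreal pi * indicator {0..} s)"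
  (is "?M = ?N")
proof (rule measure_eqI_generator_eq[where E = "range atMost" and \<Omega> = UNIV and A = "\<lambda>n. {..real n}"])
  show "Int_stable (range (atMost :: real \<Rightarrow> _))"
    by (auto simp: Int_stable_def)
  show "\<Union> (range (\<lambda>n. {..real n})) = UNIV"
    by (auto intro: real_arch_simple)
  have M: "emeasure ?M {..s} = ennreal (pi * max 0 s)" for s
  proof (cases "s \<ge> 0")
    case True
    have "emeasure ?M {..s} = emeasure lborel ((\<lambda>z::complex. (cmod z)\<^sup>2) -` {..s})"
      by (subst emeasure_distr) auto
    also have "(\<lambda>z::complex. (cmod z)\<^sup>2) -` {..s} = cball 0 (sqrt s)"
      using True by (auto simp: real_le_rsqrt) (metis real_sqrt_le_iff real_sqrt_abs abs_norm_cancel real_sqrt_pow2 power_mono norm_ge_zero)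
    also have "emeasure lborel (cball (0::complex) (sqrt s)) = ennreal (pi * s)"
      using True by (subst emeasure_cball) (auto simp: unit_ball_vol_2)
    finally show ?thesis using True by simp
  next
    case False
    then have "(\<lambda>z::complex. (cmod z)\<^sup>2) -` {..s} = {}"
      by auto (metis order_trans zero_le_power2)
    with False show ?thesis by (subst emeasure_distr) auto
  qed
  have N: "emeasure ?N {..s} = ennreal (pi * max 0 s)" for s
  proof -
    have "emeasure ?N {..s} = (\<integral>\<^sup>+x. ennreal pi * indicator {0..s} x \<partial>lborel)"
      by (subst emeasure_density) (auto intro!: nn_integral_cong simp: indicator_def)
    also have "\<dots> = ennreal pi * ennreal (max 0 s)"
      by (subst nn_integral_cmult) (auto simp: max_def)
    also have "\<dots> = ennreal (pi * max 0 s)"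
      by (simp add: ennreal_mult'')
    finally show ?thesis .
  qed
  show "emeasure ?M X = emeasure ?N X" if "X \<in> range atMost" for X
    using that M N by auto
  show "emeasure ?M {..real n} \<noteq> \<infinity>" for n
    by (simp add: M)
  show "sets ?M = sigma_sets UNIV (range atMost)"
    by (simp add: borel_eq_atMost)
  show "sets ?N = sigma_sets UNIV (range atMost)"
    by (simp add: borel_eq_atMost)
qed auto

section \<open>Angular orthogonality\<close>

text \<open>The normalized monomials of the Bargmann-Fock space, with the square root of the
  Gaussian weight absorbed so that they are orthonormal for plain Lebesgue measure.\<close>

definition ginibre_fun :: "nat \<Rightarrow> complex \<Rightarrow> complex" where
  "ginibre_fun n z = z ^ n * of_real (exp (- (cmod z)\<^sup>2 / 2) / sqrt (pi * fact n))"

text \<open>The index of \<open>erlang_density\<close> is one less than the shape: this is the Gamma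
  law of shape n + 1 and rate 1.\<close>

definition gamma_law :: "nat \<Rightarrow> real measure" where
  "gamma_law n = density lborel (\<lambda>x. ennreal (erlang_density n 1 x))"

lemma sets_gamma_law [simp, measurable_cong]: "sets (gamma_law n) = sets borel"
  by (simp add: gamma_law_def)

lemma space_gamma_law [simp]: "space (gamma_law n) = UNIV"
  by (simp add: gamma_law_def)

lemma prob_space_gamma_law: "prob_space (gamma_law n)"
  unfolding gamma_law_def by (rule prob_space_erlang_density) simp

lemma measurable_cnj [measurable]: "cnj \<in> borel_measurable borel"
  by (intro borel_measurable_continuous_onI continuous_intros)

lemma ginibre_fun_measurable [measurable]: "ginibre_fun n \<in> borel_measurable borel"
  unfolding ginibre_fun_def by measurable

lemma norm_ginibre_fun_power2:
  "(cmod (ginibre_fun n z))\<^sup>2 = ((cmod z)\<^sup>2) ^ n * exp (- (cmod z)\<^sup>2) / (pi * fact n)"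
proof -
  have "cmod (ginibre_fun n z) = cmod z ^ n * (exp (- (cmod z)\<^sup>2 / 2) / sqrt (pi * fact n))"
    by (simp add: ginibre_fun_def norm_mult norm_power norm_divide)
  moreover have "(exp (- (cmod z)\<^sup>2 / 2))\<^sup>2 = exp (- (cmod z)\<^sup>2)"
    by (simp flip: exp_double)
  ultimately show ?thesis
    by (simp add: power_mult_distrib power_divide mult.commute flip: power_mult)
qed

text \<open>The pi in the normalization of \<open>ginibre_fun\<close> cancels the pi by which the
  squared modulus scales Lebesgue measure; what remains is exactly a Gamma density.\<close>

lemma nn_integral_ginibre_fun:
  assumes [measurable]: "D \<in> sets borel"
  shows "(\<integral>\<^sup>+z. ennreal ((cmod (ginibre_fun n z))\<^sup>2) * indicator D ((cmod z)\<^sup>2) \<partial>lborel) = emeasure (gamma_law n) D"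
proof -
  have "(\<integral>\<^sup>+z. ennreal ((cmod (ginibre_fun n z))\<^sup>2) * indicator D ((cmod z)\<^sup>2) \<partial>lborel)
      = (\<integral>\<^sup>+s. ennreal (s ^ n * exp (- s) / (pi * fact n)) * indicator D s
           \<partial>distr lborel borel (\<lambda>z::complex. (cmod z)\<^sup>2))"
    unfolding norm_ginibre_fun_power2 by (subst nn_integral_distr) auto
  also have "\<dots> = (\<integral>\<^sup>+s. ennreal pi * indicator {0..} s * (ennreal (s ^ n * exp (- s) / (pi * fact n)) * indicator D s) \<partial>lborel)"
    unfolding distr_cmod_power2_lborel by (subst nn_integral_density) auto
  also have "\<dots> = (\<integral>\<^sup>+s. ennreal (erlang_density n 1 s) * indicator D s \<partial>lborel)"
    by (intro nn_integral_cong)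
       (auto simp: erlang_density_def indicator_def simp flip: ennreal_mult'')
  also have "\<dots> = emeasure (gamma_law n) D"
    unfolding gamma_law_def by (subst emeasure_density) auto
  finally show ?thesis .
qed

lemma integrable_ginibre_fun:
  assumes [measurable]: "D \<in> sets borel"
  shows "integrable lborel (\<lambda>z. indicator D ((cmod z)\<^sup>2) *\<^sub>R (ginibre_fun p z * cnj (ginibre_fun q z)))"
proof (rule Bochner_Integration.integrable_bound)
  have int: "integrable lborel (\<lambda>z. (cmod (ginibre_fun n z))\<^sup>2)" for n
  proof (rule integrableI_nonneg)
    have "(\<integral>\<^sup>+z. ennreal ((cmod (ginibre_fun n z))\<^sup>2) \<partial>lborel) = emeasure (gamma_law n) UNIV"
      using nn_integral_ginibre_fun[of UNIV n] by simp
    also have "\<dots> < \<infinity>"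
      using prob_space.emeasure_space_1[OF prob_space_gamma_law, of n] by simp
    finally show "(\<integral>\<^sup>+z. ennreal ((cmod (ginibre_fun n z))\<^sup>2) \<partial>lborel) < \<infinity>" .
  qed auto
  show "integrable lborel (\<lambda>z. (cmod (ginibre_fun p z))\<^sup>2 + (cmod (ginibre_fun q z))\<^sup>2)"
    using int by auto
  show "AE z in lborel. norm (indicator D ((cmod z)\<^sup>2) *\<^sub>R (ginibre_fun p z * cnj (ginibre_fun q z)))
      \<le> norm ((cmod (ginibre_fun p z))\<^sup>2 + (cmod (ginibre_fun q z))\<^sup>2)"
  proof (intro AE_I2)
    fix z
    have "x * y \<le> x\<^sup>2 + y\<^sup>2" if "0 \<le> x" "0 \<le> y" for x y :: real
      using sum_squares_ge_zero[of "x - y" 0] mult_nonneg_nonneg[OF that] by (simp add: power2_eq_square algebra_simps)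
    then show "norm (indicator D ((cmod z)\<^sup>2) *\<^sub>R (ginibre_fun p z * cnj (ginibre_fun q z)))
      \<le> norm ((cmod (ginibre_fun p z))\<^sup>2 + (cmod (ginibre_fun q z))\<^sup>2)"
      by (auto simp: indicator_def norm_mult)
  qed
qed measurable

lemma ginibre_fun_cis: "ginibre_fun n (cis \<theta> * z) = cis (n * \<theta>) * ginibre_fun n z"
  by (simp add: ginibre_fun_def power_mult_distrib norm_mult Complex.DeMoivre)

text \<open>Off the diagonal, rotating by a quarter of a period multiplies the integral by \<open>\<plusminus>\<i>\<close>.\<close>

lemma integral_ginibre_fun:
  assumes [measurable]: "D \<in> sets borel"
  shows "(\<integral>z. indicator D ((cmod z)\<^sup>2) *\<^sub>R (ginibre_fun p z * cnj (ginibre_fun q z)) \<partial>lborel)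
    = (if p = q then of_real (measure (gamma_law p) D) else 0)" (is "integral\<^sup>L lborel ?F = _")
proof (cases "p = q")
  case True
  have "?F = (\<lambda>z. of_real ((cmod (ginibre_fun p z))\<^sup>2 * indicator D ((cmod z)\<^sup>2)))"
    using True by (auto simp: fun_eq_iff indicator_def simp flip: complex_norm_square)
  then have "integral\<^sup>L lborel ?F = of_real (\<integral>z. (cmod (ginibre_fun p z))\<^sup>2 * indicator D ((cmod z)\<^sup>2) \<partial>lborel)"
    by (simp del: of_real_mult of_real_power)
  also have "(\<integral>z. (cmod (ginibre_fun p z))\<^sup>2 * indicator D ((cmod z)\<^sup>2) \<partial>lborel)
      = enn2real (\<integral>\<^sup>+z. ennreal ((cmod (ginibre_fun p z))\<^sup>2 * indicator D ((cmod z)\<^sup>2)) \<partial>lborel)"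
    by (rule integral_eq_nn_integral) auto
  also have "(\<integral>\<^sup>+z. ennreal ((cmod (ginibre_fun p z))\<^sup>2 * indicator D ((cmod z)\<^sup>2)) \<partial>lborel) = emeasure (gamma_law p) D"
    by (subst nn_integral_ginibre_fun[symmetric]) (auto intro!: nn_integral_cong simp: ennreal_mult' ennreal_indicator)
  finally show ?thesis using True by (simp add: measure_def)
next
  case False
  define d where "d = real p - real q"
  have d: "d \<noteq> 0" "\<bar>d\<bar> \<ge> 1" using False by (auto simp: d_def)
  define \<theta> where "\<theta> = pi / (2 * d)"
  \<comment> \<open>As p and q are distinct naturals, |d| is at least 1, so the angle is nonzero and
    at most pi / 2 in modulus, and the shear decomposition applies.\<close>
  have "sin \<theta> \<noteq> 0"
  proof -
    have "\<bar>\<theta>\<bar> \<le> pi / 2" using d by (simp add: \<theta>_def abs_mult divide_simps)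
    moreover have "\<theta> \<noteq> 0" using d by (simp add: \<theta>_def)
    ultimately show ?thesis
      using sin_zero_pi_iff[of \<theta>] pi_gt_zero by linarith
  qed
  note rot = lborel_distr_cis[OF this]
  have dth: "d * \<theta> = pi / 2" using d by (simp add: \<theta>_def)
  have "integral\<^sup>L lborel ?F = integral\<^sup>L (distr lborel borel (\<lambda>z. cis \<theta> * z)) ?F"
    by (simp add: rot)
  also have "\<dots> = (\<integral>z. ?F (cis \<theta> * z) \<partial>lborel)"
    by (subst integral_distr) auto
  also have "\<dots> = (\<integral>z. cis (d * \<theta>) * ?F z \<partial>lborel)"
  proof (intro Bochner_Integration.integral_cong refl)
    fix z
    have "cis (real p * \<theta>) * cnj (cis (real q * \<theta>)) = cis (d * \<theta>)"
      by (simp add: d_def cis_cnj cis_mult algebra_simps)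
    then show "?F (cis \<theta> * z) = cis (d * \<theta>) * ?F z"
      unfolding ginibre_fun_cis by (simp add: norm_mult mult_ac indicator_def)
  qed
  also have "\<dots> = cis (d * \<theta>) * integral\<^sup>L lborel ?F"
    by (rule Bochner_Integration.integral_mult_right_zero)
  also have "cis (d * \<theta>) = \<i>"
    by (simp add: dth)
  finally have "(1 - \<i>) * integral\<^sup>L lborel ?F = 0"
    by (simp add: algebra_simps)
  moreover have "1 - \<i> \<noteq> 0" by (simp add: complex_eq_iff)
  ultimately show ?thesis using False by simp
qed

section \<open>Radial correlation functions\<close>

definition ginibre_trunc :: "nat \<Rightarrow> complex \<Rightarrow> complex \<Rightarrow> complex" where
  "ginibre_trunc N z w = (\<Sum>n<N. ginibre_fun n z * cnj (ginibre_fun n w))"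

lemma ginibre_fun_mult_cnj:
  "ginibre_fun n z * cnj (ginibre_fun n w)
     = of_real (exp (- (cmod z)\<^sup>2 / 2 - (cmod w)\<^sup>2 / 2) / pi) * ((z * cnj w) ^ n /\<^sub>R fact n)"
proof -
  have "exp (- (cmod z)\<^sup>2 / 2) / sqrt (pi * fact n) * (exp (- (cmod w)\<^sup>2 / 2) / sqrt (pi * fact n))
      = exp (- (cmod z)\<^sup>2 / 2 - (cmod w)\<^sup>2 / 2) / pi * inverse (fact n)"
  proof -
    have "exp (- (cmod z)\<^sup>2 / 2) * exp (- (cmod w)\<^sup>2 / 2) = exp (- (cmod z)\<^sup>2 / 2 - (cmod w)\<^sup>2 / 2)"
      by (simp flip: exp_add)
    moreover have "sqrt (pi * fact n) * sqrt (pi * fact n) = pi * fact n"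
      by simp
    ultimately show ?thesis
      by (simp only: times_divide_times_eq) (simp add: divide_simps)
  qed
  then have "complex_of_real (exp (- (cmod z)\<^sup>2 / 2) / sqrt (pi * fact n)) * of_real (exp (- (cmod w)\<^sup>2 / 2) / sqrt (pi * fact n))
      = of_real (exp (- (cmod z)\<^sup>2 / 2 - (cmod w)\<^sup>2 / 2) / pi) * of_real (inverse (fact n))"
    by (metis of_real_mult)
  then show ?thesis
    unfolding ginibre_fun_def scaleR_conv_of_real
    by (simp add: power_mult_distrib mult_ac del: of_real_divide of_real_mult of_real_inverse)
qed

lemma ginibre_trunc_tendsto: "(\<lambda>N. ginibre_trunc N z w) \<longlonglongrightarrow> ginibre_kernel z w"
proof -
  have "(\<lambda>N. of_real (exp (- (cmod z)\<^sup>2 / 2 - (cmod w)\<^sup>2 / 2) / pi) * (\<Sum>n<N. (z * cnj w) ^ n /\<^sub>R fact n))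
     \<longlonglongrightarrow> of_real (exp (- (cmod z)\<^sup>2 / 2 - (cmod w)\<^sup>2 / 2) / pi) * exp (z * cnj w)"
    using exp_converges[of "z * cnj w"] by (intro tendsto_intros) (simp add: sums_def)
  also have "of_real (exp (- (cmod z)\<^sup>2 / 2 - (cmod w)\<^sup>2 / 2) / pi) * exp (z * cnj w) = ginibre_kernel z w"
  proof -
    have "of_real (exp (- (cmod z)\<^sup>2 / 2 - (cmod w)\<^sup>2 / 2)) * exp (z * cnj w)
        = exp (of_real (- (cmod z)\<^sup>2 / 2 - (cmod w)\<^sup>2 / 2) + z * cnj w)"
      by (simp only: exp_add exp_of_real)
    also have "of_real (- (cmod z)\<^sup>2 / 2 - (cmod w)\<^sup>2 / 2) + z * cnj w
        = z * cnj w - complex_of_real ((cmod z)\<^sup>2 / 2) - complex_of_real ((cmod w)\<^sup>2 / 2)"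
      by simp
    finally show ?thesis
      by (simp only: ginibre_kernel_def of_real_divide[of "exp _"] times_divide_eq_left mult_1_left)
  qed
  finally show ?thesis
    by (simp add: ginibre_trunc_def ginibre_fun_mult_cnj sum_distrib_left)
qed

text \<open>Absolute values turn the partial sum into one of exp(|z| |w|), and the exponent
  completes to -(|z| - |w|)^2 / 2. The bound is uniform in N, z and w. Relaxing 1 / pi to 1 keeps
  products over permutations at most 1.\<close>

lemma norm_ginibre_trunc_le: "cmod (ginibre_trunc N z w) \<le> 1"
proof -
  have "cmod (ginibre_trunc N z w)
      \<le> (\<Sum>n<N. exp (- (cmod z)\<^sup>2 / 2 - (cmod w)\<^sup>2 / 2) / pi * ((cmod z * cmod w) ^ n /\<^sub>R fact n))"
    unfolding ginibre_trunc_def ginibre_fun_mult_cnj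
    by (intro order_trans[OF norm_sum] sum_mono) (simp add: norm_mult norm_power norm_divide mult_ac)
  also have "\<dots> = exp (- (cmod z)\<^sup>2 / 2 - (cmod w)\<^sup>2 / 2) / pi * (\<Sum>n<N. (cmod z * cmod w) ^ n /\<^sub>R fact n)"
    by (simp add: sum_distrib_left)
  also have "\<dots> \<le> exp (- (cmod z)\<^sup>2 / 2 - (cmod w)\<^sup>2 / 2) / pi * exp (cmod z * cmod w)"
  proof (intro mult_left_mono)
    show "(\<Sum>n<N. (cmod z * cmod w) ^ n /\<^sub>R fact n) \<le> exp (cmod z * cmod w)"
      unfolding exp_def by (intro sum_le_suminf summable_exp_generic) auto
  qed auto
  also have "\<dots> = exp (- (cmod z - cmod w)\<^sup>2 / 2) / pi"
    by (simp add: power2_eq_square algebra_simps diff_divide_distrib add_divide_distrib flip: exp_add)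
  also have "\<dots> \<le> 1"
    using pi_ge_two by (simp add: divide_simps) (smt (verit) exp_le_one_iff zero_le_power2 divide_nonneg_nonneg)
  finally show ?thesis .
qed

lemma norm_ginibre_kernel_le: "cmod (ginibre_kernel z w) \<le> 1"
  by (rule LIMSEQ_le_const2[OF tendsto_norm[OF ginibre_trunc_tendsto]]) (use norm_ginibre_trunc_le in auto)

section \<open>Determinant expansions and the integral of the truncated determinant\<close>

lemma det_mat_eq:
  "Determinant.det (Matrix.mat k k (\<lambda>(i, j). A i j)) = (\<Sum>p | p permutes {..<k}. of_int (sign p) * (\<Prod>i<k. A i (p i)))"
  unfolding det_def'[OF mat_carrier] atLeast0LessThan
proof (intro sum.cong refl arg_cong2[where f = "(*)"] prod.cong)
  fix p i assume "p \<in> {p. p permutes {..<k}}" "i \<in> {..<k}"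
  then have "i < k" "p i < k" using permutes_in_image[of p "{..<k}" i] by auto
  then show "Matrix.mat k k (\<lambda>(i, j). A i j) $$ (i, p i) = A i (p i)" by simp
qed

lemma norm_det_mat_le:
  fixes A :: "nat \<Rightarrow> nat \<Rightarrow> complex"
  assumes "\<And>i j. cmod (A i j) \<le> 1"
  shows "cmod (Determinant.det (Matrix.mat k k (\<lambda>(i, j). A i j))) \<le> fact k"
proof -
  have "cmod (Determinant.det (Matrix.mat k k (\<lambda>(i, j). A i j)))
      \<le> (\<Sum>p | p permutes {..<k}. cmod (of_int (sign p) * (\<Prod>i<k. A i (p i))))"
    unfolding det_mat_eq by (rule norm_sum)
  also have "\<dots> \<le> (\<Sum>p | p permutes {..<k}. 1)"
  proof (intro sum_mono)
    fix p :: "nat \<Rightarrow> nat"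
    have "norm (of_int (sign p) :: complex) = 1"
      by (simp add: sign_def)
    moreover have "norm (\<Prod>i<k. A i (p i)) \<le> 1"
      unfolding prod_norm[symmetric] using assms by (intro prod_le_1) auto
    ultimately show "cmod (of_int (sign p) * (\<Prod>i<k. A i (p i))) \<le> 1"
      by (simp add: norm_mult)
  qed
  also have "\<dots> = fact k"
    by (simp add: card_permutations)
  finally show ?thesis .
qed

text \<open>A repeated index produces two equal rows. This is how tuples with repetitions are
  discarded on the determinantal side.\<close>

lemma det_kronecker:
  "Determinant.det (Matrix.mat k k (\<lambda>(i, j). if n i = n j then 1 else 0 :: complex))
     = (if inj_on n {..<k} then 1 else 0)"
proof (cases "inj_on n {..<k}")
  case True
  then have "Matrix.mat k k (\<lambda>(i, j). if n i = n j then 1 else 0 :: complex) = 1\<^sub>m k"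
    by (intro eq_matI) (auto simp: inj_on_def)
  with True show ?thesis by simp
next
  case False
  then obtain i j where ij: "i < k" "j < k" "i \<noteq> j" "n i = n j"
    by (auto simp: inj_on_def)
  have "Determinant.det (Matrix.mat k k (\<lambda>(i, j). if n i = n j then 1 else 0 :: complex)) = 0"
    by (rule det_identical_rows[OF mat_carrier, of i j]) (use ij in auto)
  with False show ?thesis by simp
qed

text \<open>Expanding the determinant and each kernel gives a sum over permutations p and index
  tuples n of products that split over the points. Orthogonality of \<open>ginibre_fun\<close> on
  rotation invariant sets replaces each one-point integral by a Kronecker delta times a Gamma
  probability, and the signed sum over p of the deltas is again a determinant.\<close>

lemma set_integral_det_trunc:
  fixes D :: "nat \<Rightarrow> real set"
  assumes D [measurable]: "\<And>i. i < k \<Longrightarrow> D i \<in> sets borel"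
  shows "(LINT x:(\<Pi>\<^sub>E i\<in>{..<k}. {z. (cmod z)\<^sup>2 \<in> D i})|PiM {..<k} (\<lambda>_. lborel).
            Determinant.det (Matrix.mat k k (\<lambda>(i, j). ginibre_trunc N (x i) (x j))))
       = (\<Sum>n | n \<in> {..<k} \<rightarrow>\<^sub>E {..<N} \<and> inj_on n {..<k}. \<Prod>i<k. of_real (measure (gamma_law (n i)) (D i)))"
proof -
  interpret product_sigma_finite "\<lambda>_::nat. lborel :: complex measure" ..
  let ?\<phi> = ginibre_fun
  \<comment> \<open>The point x j occurs unconjugated in row j, with index n j, and conjugated in
    the row that p sends to j, with index n (p^{-1} j). \<open>F\<close> collects everything that
    depends on x j.\<close>
  define F where "F = (\<lambda>n p j z. indicator (D j) ((cmod z)\<^sup>2) *\<^sub>R (?\<phi> (n j) z * cnj (?\<phi> (n (inv_into UNIV p j)) z)))"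
  define g where "g = (\<lambda>n j. complex_of_real (measure (gamma_law (n j)) (D j)))"
  let ?P = "{p. p permutes {..<k}}" and ?E = "{..<k} \<rightarrow>\<^sub>E {..<N}"
  have Fint: "integrable lborel (F n p j)" if "j < k" for n p j
    unfolding F_def using that by (intro integrable_ginibre_fun D)
  have Pint: "integrable (PiM {..<k} (\<lambda>_. lborel)) (\<lambda>x. \<Prod>j<k. F n p j (x j))" for n p
    by (intro product_integrable_prod) (auto simp: Fint)
  have expand: "indicator (\<Pi>\<^sub>E i\<in>{..<k}. {z. (cmod z)\<^sup>2 \<in> D i}) x *\<^sub>R
      Determinant.det (Matrix.mat k k (\<lambda>(i, j). ginibre_trunc N (x i) (x j)))
      = (\<Sum>n\<in>?E. \<Sum>p\<in>?P. of_int (sign p) * (\<Prod>j<k. F n p j (x j)))"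
    if x: "x \<in> space (PiM {..<k} (\<lambda>_. lborel :: complex measure))" for x
  proof -
    have ind: "indicator (\<Pi>\<^sub>E i\<in>{..<k}. {z. (cmod z)\<^sup>2 \<in> D i}) x = (\<Prod>i<k. indicator (D i) ((cmod (x i))\<^sup>2) :: real)"
    proof (cases "x \<in> (\<Pi>\<^sub>E i\<in>{..<k}. {z. (cmod z)\<^sup>2 \<in> D i})")
      case False
      then obtain i where "i < k" "(cmod (x i))\<^sup>2 \<notin> D i"
        using x by (auto simp: space_PiM PiE_def)
      then have "(\<Prod>i<k. indicator (D i) ((cmod (x i))\<^sup>2) :: real) = 0"
        by (intro prod_zero bexI[of _ i]) auto
      with False show ?thesis by simp
    next
      case True
      then have "(\<Prod>i<k. indicator (D i) ((cmod (x i))\<^sup>2) :: real) = 1"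
        by (intro prod.neutral) (auto simp: PiE_def Pi_def)
      with True show ?thesis by simp
    qed
    have perm_term: "of_real (\<Prod>i<k. indicator (D i) ((cmod (x i))\<^sup>2)) * (\<Prod>i<k. ginibre_trunc N (x i) (x (p i)))
        = (\<Sum>n\<in>?E. \<Prod>j<k. F n p j (x j))" if p: "p permutes {..<k}" for p
    proof -
      have "(\<Prod>i<k. ginibre_trunc N (x i) (x (p i))) = (\<Sum>n\<in>?E. \<Prod>i<k. ?\<phi> (n i) (x i) * cnj (?\<phi> (n i) (x (p i))))"
        unfolding ginibre_trunc_def by (subst prod_sum_PiE) auto
      also have "\<dots> = (\<Sum>n\<in>?E. (\<Prod>i<k. ?\<phi> (n i) (x i)) * (\<Prod>i<k. cnj (?\<phi> (n (inv_into UNIV p i)) (x i))))"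
      proof (intro sum.cong refl)
        fix n
        have "(\<Prod>i<k. cnj (?\<phi> (n i) (x (p i)))) = (\<Prod>i<k. cnj (?\<phi> (n (inv_into UNIV p (p i))) (x (p i))))"
          using permutes_inverses(2)[OF p] by simp
        also have "\<dots> = (\<Prod>i<k. cnj (?\<phi> (n (inv_into UNIV p i)) (x i)))"
          using prod.permute[OF p, of "\<lambda>i. cnj (?\<phi> (n (inv_into UNIV p i)) (x i))"] by (simp add: o_def)
        finally show "(\<Prod>i<k. ?\<phi> (n i) (x i) * cnj (?\<phi> (n i) (x (p i)))) =
            (\<Prod>i<k. ?\<phi> (n i) (x i)) * (\<Prod>i<k. cnj (?\<phi> (n (inv_into UNIV p i)) (x i)))"
          by (simp add: prod.distrib)
      qed
      finally show ?thesis
        by (simp add: F_def sum_distrib_left scaleR_conv_of_real prod.distrib mult_ac)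
    qed
    have "Determinant.det (Matrix.mat k k (\<lambda>(i, j). ginibre_trunc N (x i) (x j)))
        = (\<Sum>p\<in>?P. of_int (sign p) * (\<Prod>i<k. ginibre_trunc N (x i) (x (p i))))"
      by (rule det_mat_eq)
    then have "indicator (\<Pi>\<^sub>E i\<in>{..<k}. {z. (cmod z)\<^sup>2 \<in> D i}) x *\<^sub>R
        Determinant.det (Matrix.mat k k (\<lambda>(i, j). ginibre_trunc N (x i) (x j)))
      = (\<Sum>p\<in>?P. of_int (sign p) * (of_real (\<Prod>i<k. indicator (D i) ((cmod (x i))\<^sup>2)) * (\<Prod>i<k. ginibre_trunc N (x i) (x (p i)))))"
      unfolding ind by (simp add: scaleR_conv_of_real sum_distrib_left mult_ac)
    also have "\<dots> = (\<Sum>p\<in>?P. of_int (sign p) * (\<Sum>n\<in>?E. \<Prod>j<k. F n p j (x j)))"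
      by (intro sum.cong refl) (simp add: perm_term del: of_real_prod)
    also have "\<dots> = (\<Sum>n\<in>?E. \<Sum>p\<in>?P. of_int (sign p) * (\<Prod>j<k. F n p j (x j)))"
      by (simp only: sum_distrib_left, rule sum.swap)
    finally show ?thesis .
  qed
  have "(LINT x:(\<Pi>\<^sub>E i\<in>{..<k}. {z. (cmod z)\<^sup>2 \<in> D i})|PiM {..<k} (\<lambda>_. lborel).
            Determinant.det (Matrix.mat k k (\<lambda>(i, j). ginibre_trunc N (x i) (x j))))
      = (LINT x|PiM {..<k} (\<lambda>_. lborel). (\<Sum>n\<in>?E. \<Sum>p\<in>?P. of_int (sign p) * (\<Prod>j<k. F n p j (x j))))"
    unfolding set_lebesgue_integral_def
    by (intro Bochner_Integration.integral_cong refl expand)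
  also have "\<dots> = (\<Sum>n\<in>?E. \<Sum>p\<in>?P. of_int (sign p) * (\<Prod>j<k. integral\<^sup>L lborel (F n p j)))"
    using Pint Fint
    by (simp add: Bochner_Integration.integral_sum)
       (intro sum.cong refl arg_cong2[where f = "(*)"] product_integral_prod; simp)
  also have "\<dots> = (\<Sum>n\<in>?E. (if inj_on n {..<k} then 1 else 0) * (\<Prod>j<k. g n j))"
  proof (intro sum.cong refl)
    fix n
    have "(\<Prod>j<k. integral\<^sup>L lborel (F n p j)) = (\<Prod>i<k. if n i = n (p i) then 1 else 0) * (\<Prod>j<k. g n j)"
      if p: "p \<in> ?P" for p
    proof -
      from p have p: "p permutes {..<k}" by simp
      have "(\<Prod>j<k. integral\<^sup>L lborel (F n p j)) = (\<Prod>j<k. (if n j = n (inv_into UNIV p j) then 1 else 0) * g n j)"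
        unfolding F_def g_def by (intro prod.cong refl) (subst integral_ginibre_fun, auto)
      also have "\<dots> = (\<Prod>i<k. (if n (p i) = n i then 1 else 0)) * (\<Prod>j<k. g n j)"
        using prod.permute[OF p, of "\<lambda>j. if n j = n (inv_into UNIV p j) then 1 else 0 :: complex"] permutes_inverses(2)[OF p]
        by (simp add: prod.distrib o_def)
      finally show ?thesis by (simp add: eq_commute)
    qed
    then have "(\<Sum>p\<in>?P. of_int (sign p) * (\<Prod>j<k. integral\<^sup>L lborel (F n p j)))
        = (\<Sum>p\<in>?P. of_int (sign p) * (\<Prod>i<k. if n i = n (p i) then 1 else 0)) * (\<Prod>j<k. g n j)"
      unfolding sum_distrib_right by (intro sum.cong refl) (simp add: mult_ac)
    \<comment> \<open>The Leibniz formula read backwards, now for the Kronecker matrix of the tuple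
      n.\<close>
    also have "(\<Sum>p\<in>?P. of_int (sign p) * (\<Prod>i<k. if n i = n (p i) then 1 else 0)) =
        Determinant.det (Matrix.mat k k (\<lambda>(i, j). if n i = n j then 1 else 0 :: complex))"
      by (rule det_mat_eq[symmetric])
    finally show "(\<Sum>p\<in>?P. of_int (sign p) * (\<Prod>j<k. integral\<^sup>L lborel (F n p j)))
        = (if inj_on n {..<k} then 1 else 0) * (\<Prod>j<k. g n j)"
      by (simp add: det_kronecker)
  qed
  also have "\<dots> = (\<Sum>n | n \<in> ?E \<and> inj_on n {..<k}. \<Prod>j<k. g n j)"
    by (intro sum.mono_neutral_cong_right finite_PiE) auto
  finally show ?thesis unfolding g_def .
qed

section \<open>From the truncated kernel to the Ginibre kernel\<close>

lemma ginibre_kernel_measurable [measurable]: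
  "(\<lambda>x. ginibre_kernel (f x) (g x)) \<in> borel_measurable M"
  if [measurable]: "f \<in> borel_measurable M" "g \<in> borel_measurable M"
  unfolding ginibre_kernel_def by measurable

lemma ginibre_trunc_measurable [measurable]:
  "(\<lambda>x. ginibre_trunc N (f x) (g x)) \<in> borel_measurable M"
  if [measurable]: "f \<in> borel_measurable M" "g \<in> borel_measurable M"
  unfolding ginibre_trunc_def by measurable

lemma precompact_radial:
  assumes [measurable]: "D \<in> sets borel" and D: "D \<subseteq> {..b}"
  shows "precompact_borel {z::complex. (cmod z)\<^sup>2 \<in> D}"
proof -
  have "{z::complex. (cmod z)\<^sup>2 \<in> D} \<subseteq> cball 0 (sqrt b)"
    using D by (auto intro!: real_le_rsqrt)
  then have "bounded {z::complex. (cmod z)\<^sup>2 \<in> D}"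
    by (rule bounded_subset[OF bounded_cball])
  moreover have "{z::complex. (cmod z)\<^sup>2 \<in> D} \<in> sets borel"
    by measurable
  ultimately show ?thesis
    by (simp add: precompact_borel_def)
qed

lemma precompact_borel_emeasure_lborel:
  fixes A :: "'a::euclidean_space set"
  assumes "precompact_borel A"
  shows "A \<in> sets borel" "emeasure lborel A < \<infinity>"
proof -
  show A: "A \<in> sets borel" using assms by (simp add: precompact_borel_def)
  have "bounded A"
    using assms by (auto simp: precompact_borel_def intro: compact_imp_bounded bounded_subset[OF _ closure_subset])
  then show "emeasure lborel A < \<infinity>" by (rule emeasure_bounded_finite)
qed

text \<open>Kernels bounded by 1 have k by k determinants bounded by k!, and a product of precompact
  sets has finite measure, so a constant on it serves as majorant for all N.\<close>

lemma set_integral_det_tendsto: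
  assumes A: "\<And>i. i < k \<Longrightarrow> precompact_borel (A i)"
  shows "(\<lambda>N. LINT x:(\<Pi>\<^sub>E i\<in>{..<k}. A i)|PiM {..<k} (\<lambda>_. lborel).
            Determinant.det (Matrix.mat k k (\<lambda>(i, j). ginibre_trunc N (x i) (x j))))
    \<longlonglongrightarrow> (LINT x:(\<Pi>\<^sub>E i\<in>{..<k}. A i)|PiM {..<k} (\<lambda>_. lborel).
            Determinant.det (Matrix.mat k k (\<lambda>(i, j). ginibre_kernel (x i) (x j))))"
proof -
  interpret product_sigma_finite "\<lambda>_::nat. lborel :: complex measure" ..
  let ?P = "PiM {..<k} (\<lambda>_. lborel :: complex measure)"
  note [measurable] = precompact_borel_emeasure_lborel(1)[OF A]
  have [measurable]: "(\<Pi>\<^sub>E i\<in>{..<k}. A i) \<in> sets ?P"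
    by (intro sets_PiM_I_finite) auto
  have comp [measurable]: "(\<lambda>x. x i) \<in> borel_measurable ?P" if "i < k" for i
    using measurable_component_singleton[of i "{..<k}" "\<lambda>_. lborel :: complex measure"] that by simp
  have meas: "(\<lambda>x. Determinant.det (Matrix.mat k k (\<lambda>(i, j). K (x i) (x j)))) \<in> borel_measurable ?P"
    if K: "\<And>f g. f \<in> borel_measurable ?P \<Longrightarrow> g \<in> borel_measurable ?P \<Longrightarrow> (\<lambda>x. K (f x) (g x)) \<in> borel_measurable ?P"
    for K :: "complex \<Rightarrow> complex \<Rightarrow> complex"
    unfolding det_mat_eq
  proof (intro borel_measurable_sum borel_measurable_times borel_measurable_const borel_measurable_prod K comp)
    fix p i assume "p \<in> {p. p permutes {..<k}}" "i \<in> {..<k}"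
    then show "i < k" "p i < k" using permutes_in_image[of p "{..<k}" i] by auto
  qed
  have fin: "emeasure ?P (\<Pi>\<^sub>E i\<in>{..<k}. A i) < \<infinity>"
    by (subst emeasure_PiM)
       (auto simp: less_top[symmetric] ennreal_prod_eq_top dest: precompact_borel_emeasure_lborel(2)[OF A])
  show ?thesis
    unfolding set_lebesgue_integral_def
  proof (rule integral_dominated_convergence[where w = "\<lambda>x. indicator (\<Pi>\<^sub>E i\<in>{..<k}. A i) x * fact k"])
    show "integrable ?P (\<lambda>x. indicator (\<Pi>\<^sub>E i\<in>{..<k}. A i) x * fact k :: real)"
      using fin by (intro integrable_mult_left integrable_real_indicator) auto
    show "AE x in ?P. (\<lambda>N. indicat_real (\<Pi>\<^sub>E i\<in>{..<k}. A i) x *\<^sub>R Determinant.det (Matrix.mat k k (\<lambda>(i, j). ginibre_trunc N (x i) (x j))))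
        \<longlonglongrightarrow> indicat_real (\<Pi>\<^sub>E i\<in>{..<k}. A i) x *\<^sub>R Determinant.det (Matrix.mat k k (\<lambda>(i, j). ginibre_kernel (x i) (x j)))"
      unfolding det_mat_eq by (intro AE_I2 tendsto_intros ginibre_trunc_tendsto)
    show "AE x in ?P. norm (indicat_real (\<Pi>\<^sub>E i\<in>{..<k}. A i) x *\<^sub>R Determinant.det (Matrix.mat k k (\<lambda>(i, j). ginibre_trunc N (x i) (x j))))
        \<le> indicat_real (\<Pi>\<^sub>E i\<in>{..<k}. A i) x * fact k" for N
      by (intro AE_I2) (auto simp: indicator_def norm_det_mat_le norm_ginibre_trunc_le)
    show "(\<lambda>x. indicat_real (\<Pi>\<^sub>E i\<in>{..<k}. A i) x *\<^sub>R Determinant.det (Matrix.mat k k (\<lambda>(i, j). ginibre_kernel (x i) (x j)))) \<in> borel_measurable ?P"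
      by (intro borel_measurable_scaleR borel_measurable_indicator meas ginibre_kernel_measurable) auto
    show "(\<lambda>x. indicat_real (\<Pi>\<^sub>E i\<in>{..<k}. A i) x *\<^sub>R Determinant.det (Matrix.mat k k (\<lambda>(i, j). ginibre_trunc N (x i) (x j)))) \<in> borel_measurable ?P" for N
      by (intro borel_measurable_scaleR borel_measurable_indicator meas ginibre_trunc_measurable) auto
  qed
qed

text \<open>The moment is left as a limit of finite sums: independent Gamma points lead to the very
  same sums, so the two sides are later matched by uniqueness of limits, without evaluating any
  infinite sum.\<close>

lemma ginibre_radial_moments:
  fixes D :: "nat \<Rightarrow> real set"
  assumes G: "ginibre_ensemble M G" and k: "k \<ge> 1"
    and D: "\<And>i. i < k \<Longrightarrow> D i \<in> sets borel" "\<And>i. i < k \<Longrightarrow> D i \<subseteq> {..b}"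
    and disj: "disjoint_family_on D {..<k}"
  shows "integrable M (\<lambda>\<omega>. \<Prod>i<k. real (card (G \<omega> \<inter> {z. (cmod z)\<^sup>2 \<in> D i})))"
    and "(\<lambda>N. \<Sum>n | n \<in> {..<k} \<rightarrow>\<^sub>E {..<N} \<and> inj_on n {..<k}. \<Prod>i<k. measure (gamma_law (n i)) (D i))
       \<longlonglongrightarrow> (\<integral>\<omega>. (\<Prod>i<k. real (card (G \<omega> \<inter> {z. (cmod z)\<^sup>2 \<in> D i}))) \<partial>M)"
proof -
  define A where "A = (\<lambda>i. {z::complex. (cmod z)\<^sup>2 \<in> D i})"
  have A: "precompact_borel (A i)" if "i < k" for i
    unfolding A_def using D that by (intro precompact_radial)
  have dA: "disjoint_family_on A {..<k}"
    using disj by (auto simp: disjoint_family_on_def A_def)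
  have *: "integrable M (\<lambda>\<omega>. \<Prod>i<k. real (card (G \<omega> \<inter> A i)))"
    "complex_of_real (\<integral>\<omega>. (\<Prod>i<k. real (card (G \<omega> \<inter> A i))) \<partial>M) =
          set_lebesgue_integral (PiM {..<k} (\<lambda>_. lborel)) (PiE {..<k} A)
            (\<lambda>x. Determinant.det (Matrix.mat k k (\<lambda>(i, j). ginibre_kernel (x i) (x j))))"
    using G k A dA unfolding ginibre_ensemble_def determinantal_process_def by blast+
  show "integrable M (\<lambda>\<omega>. \<Prod>i<k. real (card (G \<omega> \<inter> {z. (cmod z)\<^sup>2 \<in> D i})))"
    using *(1) by (simp add: A_def)
  have "(\<lambda>N. (\<Sum>n | n \<in> {..<k} \<rightarrow>\<^sub>E {..<N} \<and> inj_on n {..<k}. \<Prod>i<k. of_real (measure (gamma_law (n i)) (D i))))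
    \<longlonglongrightarrow> complex_of_real (\<integral>\<omega>. (\<Prod>i<k. real (card (G \<omega> \<inter> A i))) \<partial>M)"
    unfolding *(2) using set_integral_det_tendsto[OF A, of k]
    by (simp add: set_integral_det_trunc[OF D(1), symmetric] A_def)
  then have "(\<lambda>N. complex_of_real (\<Sum>n | n \<in> {..<k} \<rightarrow>\<^sub>E {..<N} \<and> inj_on n {..<k}. \<Prod>i<k. measure (gamma_law (n i)) (D i)))
    \<longlonglongrightarrow> complex_of_real (\<integral>\<omega>. (\<Prod>i<k. real (card (G \<omega> \<inter> A i))) \<partial>M)"
    by simp
  then show "(\<lambda>N. \<Sum>n | n \<in> {..<k} \<rightarrow>\<^sub>E {..<N} \<and> inj_on n {..<k}. \<Prod>i<k. measure (gamma_law (n i)) (D i))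
       \<longlonglongrightarrow> (\<integral>\<omega>. (\<Prod>i<k. real (card (G \<omega> \<inter> {z. (cmod z)\<^sup>2 \<in> D i}))) \<partial>M)"
    unfolding tendsto_of_real_iff A_def .
qed

text \<open>Two points on a common circle can be separated by disjoint planar sets, so that the
  two-point function controls their expected number.\<close>

lemma ginibre_two_point_le:
  assumes G: "ginibre_ensemble M G"
    and AB: "precompact_borel A" "precompact_borel B" "A \<inter> B = {}"
  shows "integrable M (\<lambda>\<omega>. real (card (G \<omega> \<inter> A)) * real (card (G \<omega> \<inter> B)))"
    and "(\<integral>\<omega>. real (card (G \<omega> \<inter> A)) * real (card (G \<omega> \<inter> B)) \<partial>M) \<le> 2 * (measure lborel A * measure lborel B)"
proof -
  interpret product_sigma_finite "\<lambda>_::nat. lborel :: complex measure" ..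
  define D where "D = (\<lambda>i::nat. if i = 0 then A else B)"
  let ?P = "PiM {..<2::nat} (\<lambda>_. lborel :: complex measure)"
  let ?K = "\<lambda>x. Determinant.det (Matrix.mat 2 2 (\<lambda>(i, j). ginibre_kernel (x i) (x j)))"
  have two: "{..<2::nat} = {0, 1}" by auto
  have D: "\<forall>i<2. precompact_borel (D i)" "disjoint_family_on D {..<2}"
    using AB by (auto simp: D_def disjoint_family_on_def two)
  have *: "integrable M (\<lambda>\<omega>. \<Prod>i<2. real (card (G \<omega> \<inter> D i)))"
    "set_integrable ?P (PiE {..<2} D) ?K"
    "complex_of_real (\<integral>\<omega>. (\<Prod>i<2. real (card (G \<omega> \<inter> D i))) \<partial>M) = set_lebesgue_integral ?P (PiE {..<2} D) ?K"
    using G D unfolding ginibre_ensemble_def determinantal_process_def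
    by (meson one_le_numeral)+
  show "integrable M (\<lambda>\<omega>. real (card (G \<omega> \<inter> A)) * real (card (G \<omega> \<inter> B)))"
    using *(1) by (simp add: two D_def)
  note AB' = precompact_borel_emeasure_lborel[OF AB(1)] precompact_borel_emeasure_lborel[OF AB(2)]
  have em: "emeasure ?P (PiE {..<2} D) = emeasure lborel A * emeasure lborel B"
    using AB' by (subst emeasure_PiM) (auto simp: two D_def)
  then have fin: "emeasure ?P (PiE {..<2} D) < \<infinity>"
    using AB' by (simp add: ennreal_mult_less_top)
  have [measurable]: "PiE {..<2} D \<in> sets ?P"
    using AB' by (intro sets_PiM_I_finite) (auto simp: D_def)
  have "(\<integral>\<omega>. real (card (G \<omega> \<inter> A)) * real (card (G \<omega> \<inter> B)) \<partial>M) \<le> norm (set_lebesgue_integral ?P (PiE {..<2} D) ?K)"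
    unfolding *(3)[symmetric] by (simp add: two D_def)
  also have "\<dots> \<le> (\<integral>x. norm (indicat_real (PiE {..<2} D) x *\<^sub>R ?K x) \<partial>?P)"
    unfolding set_lebesgue_integral_def by (rule integral_norm_bound)
  also have "\<dots> \<le> (\<integral>x. indicat_real (PiE {..<2} D) x * 2 \<partial>?P)"
  proof (intro integral_mono)
    show "integrable ?P (\<lambda>x. norm (indicat_real (PiE {..<2} D) x *\<^sub>R ?K x))"
      using *(2) unfolding set_integrable_def by (rule integrable_norm)
    show "integrable ?P (\<lambda>x. indicat_real (PiE {..<2} D) x * 2)"
      using fin by (intro integrable_mult_left integrable_real_indicator) auto
    fix x :: "nat \<Rightarrow> complex"
    have "norm (?K x) \<le> fact 2"
      by (rule norm_det_mat_le) (rule norm_ginibre_kernel_le)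
    then show "norm (indicat_real (PiE {..<2} D) x *\<^sub>R ?K x) \<le> indicat_real (PiE {..<2} D) x * 2"
      by (auto simp: indicator_def)
  qed
  also have "\<dots> = 2 * (measure lborel A * measure lborel B)"
    using em by (simp add: measure_def enn2real_mult)
  finally show "(\<integral>\<omega>. real (card (G \<omega> \<inter> A)) * real (card (G \<omega> \<inter> B)) \<partial>M) \<le> 2 * (measure lborel A * measure lborel B)" .
qed

section \<open>Processes determined by moments over disjoint sets\<close>

text \<open>Once a partition separates the points, each cell contains at most one of them, and a product
  that is affine in every cell count is a product over the points.\<close>

lemma prod_cells:
  fixes \<gamma> :: "'j \<Rightarrow> 'b::comm_semiring_1"
  assumes "finite J" "c ` X \<subseteq> J" "inj_on c X"
  shows "(\<Prod>j\<in>J. 1 + \<gamma> j * of_nat (card (X \<inter> {x. c x = j}))) = (\<Prod>x\<in>X. 1 + \<gamma> (c x))"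
proof -
  have 0: "X \<inter> {x. c x = j} = {}" if "j \<notin> c ` X" for j using that by auto
  have 1: "X \<inter> {y. c y = c x} = {x}" if "x \<in> X" for x
    using that assms(3) by (auto simp: inj_on_def)
  have "(\<Prod>j\<in>J. 1 + \<gamma> j * of_nat (card (X \<inter> {x. c x = j}))) =
      (\<Prod>j\<in>c ` X. 1 + \<gamma> j * of_nat (card (X \<inter> {x. c x = j})))"
    using assms 0 by (intro prod.mono_neutral_right) auto
  also have "\<dots> = (\<Prod>x\<in>X. 1 + \<gamma> (c x))"
    using assms by (subst prod.reindex) (auto intro!: prod.cong simp: 1)
  finally show ?thesis .
qed

text \<open>The base 3 is 1 + 2, where 2 bounds |exp(i x) - 1|, the modulus of the coefficients that
  appear in the products for characteristic functions.\<close>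

lemma bernoulli_3: "1 + 2 * real n \<le> 3 ^ n"
  using Bernoulli_inequality[of 2 n] by (simp add: mult.commute)

text \<open>Valid whether or not the cells separate the points, so one function dominates the
  products for all grids at once.\<close>

lemma prod_cells_le:
  assumes "finite J" "finite X" "c ` X \<subseteq> J"
  shows "(\<Prod>j\<in>J. 1 + 2 * real (card (X \<inter> {x. c x = j}))) \<le> 3 ^ card X"
proof -
  have "(\<Prod>j\<in>J. 1 + 2 * real (card (X \<inter> {x. c x = j}))) \<le> (\<Prod>j\<in>J. 3 ^ card (X \<inter> {x. c x = j}))"
    by (intro prod_mono) (auto intro: bernoulli_3)
  also have "\<dots> = 3 ^ (\<Sum>j\<in>J. card (X \<inter> {x. c x = j}))"
    by (simp add: power_sum)
  also have "(\<Sum>j\<in>J. card (X \<inter> {x. c x = j})) = card (\<Union>j\<in>J. X \<inter> {x. c x = j})"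
    using assms by (intro card_UN_disjoint[symmetric]) auto
  also have "(\<Union>j\<in>J. X \<inter> {x. c x = j}) = X" using assms by auto
  finally show ?thesis .
qed

text \<open>Recording the value of \<open>f\<close> along with the position lets one partition both separate the points
  and approximate \<open>f\<close> by a function that is constant on cells.\<close>

definition grid_cell :: "(real \<Rightarrow> real) \<Rightarrow> nat \<Rightarrow> real \<Rightarrow> int \<times> int" where
  "grid_cell f m x = (\<lfloor>real (Suc m) * x\<rfloor>, \<lfloor>real (Suc m) * f x\<rfloor>)"

definition grid_index :: "real \<Rightarrow> real \<Rightarrow> nat \<Rightarrow> (int \<times> int) set" where
  "grid_index b B m = {0..\<lfloor>real (Suc m) * b\<rfloor>} \<times> {\<lfloor>real (Suc m) * - B\<rfloor>..\<lfloor>real (Suc m) * B\<rfloor>}"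

lemma finite_grid_index [simp]: "finite (grid_index b B m)"
  by (simp add: grid_index_def)

lemma grid_cell_in_index:
  assumes "0 \<le> x" "x \<le> b" "\<bar>f x\<bar> \<le> B"
  shows "grid_cell f m x \<in> grid_index b B m"
  unfolding grid_cell_def grid_index_def mem_Times_iff fst_conv snd_conv atLeastAtMost_iff
  using assms by (intro conjI floor_mono mult_left_mono) auto

lemma grid_cell_sets [measurable]:
  assumes [measurable]: "f \<in> borel_measurable borel"
  shows "{x. grid_cell f m x = j} \<in> sets borel"
  unfolding grid_cell_def prod_eq_iff by measurable

text \<open>The position coordinate alone separates two points once the mesh is below their
  distance, and a finite set has finitely many pairs.\<close>

lemma eventually_inj_on_grid_cell:
  assumes "finite X"
  shows "eventually (\<lambda>m. inj_on (grid_cell f m) X) sequentially"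
proof -
  have "eventually (\<lambda>m. x \<noteq> y \<longrightarrow> grid_cell f m x \<noteq> grid_cell f m y) sequentially" for x y
  proof (cases "x = y")
    case False
    obtain n :: nat where n: "1 / \<bar>x - y\<bar> < real n" using reals_Archimedean2 by blast
    show ?thesis
    proof (rule eventually_sequentiallyI[of n], intro impI notI)
      fix m assume "n \<le> m" "grid_cell f m x = grid_cell f m y"
      then have "\<lfloor>real (Suc m) * x\<rfloor> = \<lfloor>real (Suc m) * y\<rfloor>" by (simp add: grid_cell_def)
      then have "\<bar>real (Suc m) * x - real (Suc m) * y\<bar> < 1" by linarith
      then have "real (Suc m) * \<bar>x - y\<bar> < 1"
        by (simp add: right_diff_distrib[symmetric] abs_mult del: of_nat_Suc)
      moreover have "1 < real n * \<bar>x - y\<bar>" using n False by (simp add: field_simps)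
      moreover have "real n * \<bar>x - y\<bar> \<le> real (Suc m) * \<bar>x - y\<bar>"
        using \<open>n \<le> m\<close> by (intro mult_right_mono) auto
      ultimately show False by linarith
    qed
  qed simp
  then have "eventually (\<lambda>m. \<forall>x\<in>X. \<forall>y\<in>X. x \<noteq> y \<longrightarrow> grid_cell f m x \<noteq> grid_cell f m y) sequentially"
    using assms by (intro eventually_ball_finite ballI) auto
  then show ?thesis by eventually_elim (auto simp: inj_on_def)
qed

lemma floor_grid_tendsto: "(\<lambda>m. real_of_int \<lfloor>real (Suc m) * y\<rfloor> / real (Suc m)) \<longlonglongrightarrow> y"
proof -
  have "(\<lambda>m. real_of_int \<lfloor>real (Suc m) * y\<rfloor> / real (Suc m) - y) \<longlonglongrightarrow> 0"
  proof (rule Lim_null_comparison)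
    show "eventually (\<lambda>m. norm (real_of_int \<lfloor>real (Suc m) * y\<rfloor> / real (Suc m) - y) \<le> 1 / real (Suc m)) sequentially"
    proof (intro always_eventually allI)
      fix m
      have "real_of_int \<lfloor>real (Suc m) * y\<rfloor> / real (Suc m) - y = (real_of_int \<lfloor>real (Suc m) * y\<rfloor> - real (Suc m) * y) / real (Suc m)"
        by (simp add: field_simps)
      moreover have "\<bar>real_of_int \<lfloor>real (Suc m) * y\<rfloor> - real (Suc m) * y\<bar> \<le> 1" by linarith
      ultimately show "norm (real_of_int \<lfloor>real (Suc m) * y\<rfloor> / real (Suc m) - y) \<le> 1 / real (Suc m)"
        by (simp add: divide_right_mono del: of_nat_Suc)
    qed
    show "(\<lambda>m. 1 / real (Suc m)) \<longlonglongrightarrow> 0" by (rule LIMSEQ_Suc[OF lim_1_over_n])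
  qed
  then show ?thesis by (simp add: LIM_zero_iff)
qed

section \<open>Characteristic functions from moments over disjoint cells\<close>

lemma disjoint_family_on_bij_betw:
  assumes h: "bij_betw h A F" and D: "disjoint_family_on D F"
  shows "disjoint_family_on (D \<circ> h) A"
  unfolding disjoint_family_on_def o_def
proof (intro ballI impI)
  fix m n assume "m \<in> A" "n \<in> A" "m \<noteq> n"
  then have "h m \<in> F" "h n \<in> F" "h m \<noteq> h n"
    using h by (auto simp: bij_betw_def inj_on_def)
  with D show "D (h m) \<inter> D (h n) = {}" by (auto simp: disjoint_family_on_def)
qed

text \<open>The counts \<open>N\<close> are kept apart from the point set \<open>X\<close>:
  measurability and integrability concern the counts only, and the two agree merely almost surely,
  because coinciding radii or infinitely many points are excluded only up to a null set. The
  exceptional null set is common to all Borel sets \<open>D\<close>.\<close>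

locale counted_points = prob_space M for M :: "'w measure" +
  fixes N :: "real set \<Rightarrow> 'w \<Rightarrow> nat" and X :: "'w \<Rightarrow> real set" and b :: real
  assumes N_measurable [measurable]: "D \<in> sets borel \<Longrightarrow> N D \<in> measurable M (count_space UNIV)"
    and AE_N: "AE \<omega> in M. finite (X \<omega>) \<and> X \<omega> \<subseteq> {0..b} \<and> (\<forall>D\<in>sets borel. N D \<omega> = card (X \<omega> \<inter> D))"
    and N_integrable: "\<And>k (D :: nat \<Rightarrow> real set). k \<ge> 1 \<Longrightarrow> (\<And>i. i < k \<Longrightarrow> D i \<in> sets borel) \<Longrightarrow> disjoint_family_on D {..<k} \<Longrightarrow>
        integrable M (\<lambda>\<omega>. \<Prod>i<k. real (N (D i) \<omega>))"
begin

lemma integrable_prod_N: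
  fixes D :: "'j \<Rightarrow> real set"
  assumes "finite F" "\<And>j. j \<in> F \<Longrightarrow> D j \<in> sets borel" "disjoint_family_on D F"
  shows "integrable M (\<lambda>\<omega>. \<Prod>j\<in>F. real (N (D j) \<omega>))"
proof (cases "F = {}")
  case False
  obtain h where h: "bij_betw h {..<card F} F"
    using ex_bij_betw_nat_finite[OF assms(1)] by (auto simp: atLeast0LessThan)
  have "integrable M (\<lambda>\<omega>. \<Prod>i<card F. real (N ((D \<circ> h) i) \<omega>))"
    using assms False bij_betwE[OF h]
    by (intro N_integrable disjoint_family_on_bij_betw[OF h]) (auto simp: Suc_le_eq card_gt_0_iff)
  also have "(\<lambda>\<omega>. \<Prod>i<card F. real (N ((D \<circ> h) i) \<omega>)) = (\<lambda>\<omega>. \<Prod>j\<in>F. real (N (D j) \<omega>))"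
    by (rule ext) (use prod.reindex_bij_betw[OF h] in simp)
  finally show ?thesis .
qed simp

text \<open>Each factor is affine in one count, so multiplying out yields only products of counts
  over distinct cells. These are the moments that disjoint-set correlations determine; no power of a
  single count arises.\<close>

lemma integral_prod_cells:
  fixes D :: "'j \<Rightarrow> real set" and \<gamma> :: "'j \<Rightarrow> 'b::{real_normed_field, banach, second_countable_topology}"
  assumes J: "finite J" "\<And>j. j \<in> J \<Longrightarrow> D j \<in> sets borel" "disjoint_family_on D J"
  shows "integrable M (\<lambda>\<omega>. \<Prod>j\<in>J. 1 + \<gamma> j * of_nat (N (D j) \<omega>))"
    and "(\<integral>\<omega>. (\<Prod>j\<in>J. 1 + \<gamma> j * of_nat (N (D j) \<omega>)) \<partial>M)
      = (\<Sum>F\<in>Pow J. (\<Prod>j\<in>F. \<gamma> j) * of_real (\<integral>\<omega>. (\<Prod>j\<in>F. real (N (D j) \<omega>)) \<partial>M))"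
proof -
  have eq: "(\<Prod>j\<in>J. 1 + \<gamma> j * of_nat (N (D j) \<omega>))
      = (\<Sum>F\<in>Pow J. (\<Prod>j\<in>F. \<gamma> j) * of_real (\<Prod>j\<in>F. real (N (D j) \<omega>)))" for \<omega>
    using prod_add[OF J(1), of "\<lambda>j. \<gamma> j * of_nat (N (D j) \<omega>)" "\<lambda>_. 1"]
    by (simp add: add.commute prod.distrib)
  have int: "integrable M (\<lambda>\<omega>. \<Prod>j\<in>F. real (N (D j) \<omega>))" if "F \<in> Pow J" for F
    using that J by (intro integrable_prod_N) (auto intro: finite_subset disjoint_family_on_mono)
  have int': "integrable M (\<lambda>\<omega>. (\<Prod>j\<in>F. \<gamma> j) * of_real (\<Prod>j\<in>F. real (N (D j) \<omega>)))" if "F \<in> Pow J" for F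
    by (intro integrable_mult_right integrable_of_real int that)
  show "integrable M (\<lambda>\<omega>. \<Prod>j\<in>J. 1 + \<gamma> j * of_nat (N (D j) \<omega>))"
    unfolding eq by (intro Bochner_Integration.integrable_sum int')
  show "(\<integral>\<omega>. (\<Prod>j\<in>J. 1 + \<gamma> j * of_nat (N (D j) \<omega>)) \<partial>M)
      = (\<Sum>F\<in>Pow J. (\<Prod>j\<in>F. \<gamma> j) * of_real (\<integral>\<omega>. (\<Prod>j\<in>F. real (N (D j) \<omega>)) \<partial>M))"
    unfolding eq
    by (subst Bochner_Integration.integral_sum[OF int'], assumption)
       (intro sum.cong refl, simp only: Bochner_Integration.integral_mult_right_zero
          integral_bounded_linear[OF bounded_linear_of_real int])
qed

abbreviation grid_prod :: "(real \<Rightarrow> real) \<Rightarrow> real \<Rightarrow> nat \<Rightarrow> (int \<times> int \<Rightarrow> 'b::real_normed_field) \<Rightarrow> 'w \<Rightarrow> 'b" where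
  "grid_prod f B m \<gamma> \<omega> \<equiv> (\<Prod>j\<in>grid_index b B m. 1 + \<gamma> j * of_nat (N {x. grid_cell f m x = j} \<omega>))"

lemma AE_grid_le:
  assumes [measurable]: "f \<in> borel_measurable borel" and B: "\<And>x. \<bar>f x\<bar> \<le> B"
  shows "AE \<omega> in M. \<forall>m. grid_prod f B m (\<lambda>_. 2) \<omega> \<le> (3::real) ^ N UNIV \<omega>"
  using AE_N
proof eventually_elim
  case (elim \<omega>)
  have "grid_cell f m ` X \<omega> \<subseteq> grid_index b B m" for m
    using elim B by (intro image_subsetI grid_cell_in_index) auto
  then have "(\<Prod>j\<in>grid_index b B m. 1 + 2 * real (card (X \<omega> \<inter> {x. grid_cell f m x = j}))) \<le> 3 ^ card (X \<omega>)" for m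
    using elim by (intro prod_cells_le) auto
  moreover have "N UNIV \<omega> = card (X \<omega>)" "\<And>m j. N {x. grid_cell f m x = j} \<omega> = card (X \<omega> \<inter> {x. grid_cell f m x = j})"
    using elim by auto
  ultimately show ?case by simp
qed

text \<open>The quantifier over \<open>\<gamma>\<close> stands inside \<open>eventually\<close>, so
  that the coefficients may change with the grid.\<close>

lemma AE_grid_eventually:
  assumes [measurable]: "f \<in> borel_measurable borel" and B: "\<And>x. \<bar>f x\<bar> \<le> B"
  shows "AE \<omega> in M. eventually (\<lambda>m. \<forall>\<gamma>::int \<times> int \<Rightarrow> 'b::real_normed_field.
      grid_prod f B m \<gamma> \<omega> = (\<Prod>x\<in>X \<omega>. 1 + \<gamma> (grid_cell f m x))) sequentially"
  using AE_N
proof eventually_elim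
  case (elim \<omega>)
  then have "finite (X \<omega>)" by simp
  from eventually_inj_on_grid_cell[OF this, of f]
  show ?case
  proof eventually_elim
    case (elim m)
    have "grid_cell f m ` X \<omega> \<subseteq> grid_index b B m"
      using \<open>finite (X \<omega>) \<and> _\<close> B by (intro image_subsetI grid_cell_in_index) auto
    moreover have "N {x. grid_cell f m x = j} \<omega> = card (X \<omega> \<inter> {x. grid_cell f m x = j})" for j
      using \<open>finite (X \<omega>) \<and> _\<close> by auto
    ultimately show ?case
      using elim by (simp add: prod_cells)
  qed
qed

text \<open>With coefficient exp(i t y) - 1 an occupied cell contributes exp(i t y), where y is the
  value of f rounded down to mesh 1 / (m + 1), as recorded by the second cell coordinate. Hence the
  grid products tend to exp(i t S), and 3 to the number of points dominates them.\<close>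

lemma char_tendsto_grid:
  assumes [measurable]: "f \<in> borel_measurable borel" and B: "\<And>x. \<bar>f x\<bar> \<le> B"
    and [measurable]: "S \<in> borel_measurable M" and S: "AE \<omega> in M. S \<omega> = (\<Sum>x\<in>X \<omega>. f x)"
    and int: "integrable M (\<lambda>\<omega>. 3 ^ N UNIV \<omega> :: real)"
  shows "(\<lambda>m. \<integral>\<omega>. grid_prod f B m (\<lambda>j. iexp (t * (real_of_int (snd j) / real (Suc m))) - 1) \<omega> \<partial>M)
     \<longlonglongrightarrow> char (distr M borel S) t"
proof -
  let ?\<gamma> = "\<lambda>m j. iexp (t * (real_of_int (snd j) / real (Suc m))) - 1"
  have "(\<lambda>m. \<integral>\<omega>. grid_prod f B m (?\<gamma> m) \<omega> \<partial>M) \<longlonglongrightarrow> (\<integral>\<omega>. iexp (t * S \<omega>) \<partial>M)"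
  proof (rule integral_dominated_convergence[OF _ _ int])
    show "AE \<omega> in M. (\<lambda>m. grid_prod f B m (?\<gamma> m) \<omega>) \<longlonglongrightarrow> iexp (t * S \<omega>)"
      using AE_grid_eventually[OF assms(1) B, where 'b = complex] S AE_N
    proof eventually_elim
      case (elim \<omega>)
      have "iexp (t * S \<omega>) = (\<Prod>x\<in>X \<omega>. iexp (t * f x))"
        using elim by (simp add: exp_sum[symmetric] sum_distrib_left)
      also have "(\<lambda>m. \<Prod>x\<in>X \<omega>. iexp (t * (real_of_int \<lfloor>real (Suc m) * f x\<rfloor> / real (Suc m)))) \<longlonglongrightarrow> (\<Prod>x\<in>X \<omega>. iexp (t * f x))"
        by (intro tendsto_intros floor_grid_tendsto)
      ultimately have "(\<lambda>m. \<Prod>x\<in>X \<omega>. iexp (t * (real_of_int \<lfloor>real (Suc m) * f x\<rfloor> / real (Suc m)))) \<longlonglongrightarrow> iexp (t * S \<omega>)"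
        by simp
      then show ?case
      proof (rule Lim_transform_eventually)
        show "eventually (\<lambda>m. (\<Prod>x\<in>X \<omega>. iexp (t * (real_of_int \<lfloor>real (Suc m) * f x\<rfloor> / real (Suc m)))) = grid_prod f B m (?\<gamma> m) \<omega>) sequentially"
          using elim(1) by eventually_elim (simp add: grid_cell_def del: of_nat_Suc)
      qed
    qed
    show "AE \<omega> in M. norm (grid_prod f B m (?\<gamma> m) \<omega>) \<le> 3 ^ N UNIV \<omega>" for m
      using AE_grid_le[OF assms(1) B]
    proof eventually_elim
      case (elim \<omega>)
      have "norm (grid_prod f B m (?\<gamma> m) \<omega>) \<le> grid_prod f B m (\<lambda>_. 2) \<omega>"
        unfolding prod_norm[symmetric]
      proof (intro prod_mono conjI norm_ge_zero)
        fix j :: "int \<times> int"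
        have "norm (?\<gamma> m j) \<le> norm (iexp (t * (real_of_int (snd j) / real (Suc m)))) + norm (1::complex)"
          by (rule norm_triangle_ineq4)
        then have "norm (?\<gamma> m j) \<le> 2" by simp
        then have "norm (?\<gamma> m j * of_nat (N {x. grid_cell f m x = j} \<omega>)) \<le> 2 * real (N {x. grid_cell f m x = j} \<omega>)"
          unfolding norm_mult by (simp add: mult_right_mono del: of_nat_Suc)
        then show "norm (1 + ?\<gamma> m j * of_nat (N {x. grid_cell f m x = j} \<omega>)) \<le> 1 + 2 * of_nat (N {x. grid_cell f m x = j} \<omega>)"
          by (intro order_trans[OF norm_triangle_ineq]) simp
      qed
      then show ?case using elim order_trans by blast
    qed
  qed measurable
  then show ?thesis
    by (simp add: char_def integral_distr)
qed

end

text \<open>Only the second process needs an exponential moment: the grid products have the same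
  expectations for both processes, so that Fatou's lemma transfers the bound to the first.\<close>

theorem counted_points_char_eq:
  fixes M :: "'w measure" and M' :: "'v measure"
  assumes "counted_points M N X b" and "counted_points M' N' X' b"
    and eq: "\<And>k (D :: nat \<Rightarrow> real set). k \<ge> 1 \<Longrightarrow> (\<And>i. i < k \<Longrightarrow> D i \<in> sets borel) \<Longrightarrow> disjoint_family_on D {..<k} \<Longrightarrow>
        (\<integral>\<omega>. (\<Prod>i<k. real (N (D i) \<omega>)) \<partial>M) = (\<integral>\<omega>. (\<Prod>i<k. real (N' (D i) \<omega>)) \<partial>M')"
    and int': "integrable M' (\<lambda>\<omega>. 3 ^ N' UNIV \<omega> :: real)"
    and f [measurable]: "f \<in> borel_measurable borel" and B: "\<And>x. \<bar>f x\<bar> \<le> B"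
    and S: "S \<in> borel_measurable M" "AE \<omega> in M. S \<omega> = (\<Sum>x\<in>X \<omega>. f x)"
    and S': "S' \<in> borel_measurable M'" "AE \<omega> in M'. S' \<omega> = (\<Sum>x\<in>X' \<omega>. f x)"
  shows "char (distr M borel S) t = char (distr M' borel S') t"
proof -
  interpret P: counted_points M N X b by fact
  interpret P': counted_points M' N' X' b by fact
  have eq': "(\<integral>\<omega>. (\<Prod>j\<in>F. real (N (D j) \<omega>)) \<partial>M) = (\<integral>\<omega>. (\<Prod>j\<in>F. real (N' (D j) \<omega>)) \<partial>M')"
    if F: "finite F" "\<And>j. j \<in> F \<Longrightarrow> D j \<in> sets borel" "disjoint_family_on D F" for F and D :: "int \<times> int \<Rightarrow> real set"
  proof (cases "F = {}")
    case False
    obtain h where h: "bij_betw h {..<card F} F"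
      using ex_bij_betw_nat_finite[OF F(1)] by (auto simp: atLeast0LessThan)
    have "(\<integral>\<omega>. (\<Prod>i<card F. real (N ((D \<circ> h) i) \<omega>)) \<partial>M) = (\<integral>\<omega>. (\<Prod>i<card F. real (N' ((D \<circ> h) i) \<omega>)) \<partial>M')"
      using F False bij_betwE[OF h]
      by (intro eq disjoint_family_on_bij_betw[OF h]) (auto simp: Suc_le_eq card_gt_0_iff)
    moreover have "(\<Prod>i<card F. real (N (D (h i)) \<omega>)) = (\<Prod>j\<in>F. real (N (D j) \<omega>))" for \<omega>
      by (rule prod.reindex_bij_betw[OF h])
    moreover have "(\<Prod>i<card F. real (N' (D (h i)) \<omega>)) = (\<Prod>j\<in>F. real (N' (D j) \<omega>))" for \<omega>
      by (rule prod.reindex_bij_betw[OF h])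
    ultimately show ?thesis by simp
  qed (simp add: P.prob_space P'.prob_space)
  have disj: "disjoint_family_on (\<lambda>j. {x. grid_cell f m x = j}) J" for m J
    by (auto simp: disjoint_family_on_def)
  \<comment> \<open>Polymorphic in the coefficients: real ones transfer the exponential moment,
    complex ones give the characteristic function.\<close>
  have grid_eq: "(\<integral>\<omega>. P.grid_prod f B m \<gamma> \<omega> \<partial>M) = (\<integral>\<omega>. P'.grid_prod f B m \<gamma> \<omega> \<partial>M')"
    for m and \<gamma> :: "int \<times> int \<Rightarrow> 'b::{real_normed_field, banach, second_countable_topology}"
    unfolding P.integral_prod_cells(2)[OF finite_grid_index grid_cell_sets[OF f] disj]
      P'.integral_prod_cells(2)[OF finite_grid_index grid_cell_sets[OF f] disj]
    by (intro sum.cong refl arg_cong2[where f = "(*)"] arg_cong[where f = of_real] eq' disj grid_cell_sets[OF f])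
       (auto intro: finite_subset)
  have int: "integrable M (\<lambda>\<omega>. 3 ^ N UNIV \<omega> :: real)"
  proof (rule integrableI_nonneg)
    have "(\<integral>\<^sup>+\<omega>. ennreal (3 ^ N UNIV \<omega>) \<partial>M) = (\<integral>\<^sup>+\<omega>. liminf (\<lambda>m. ennreal (P.grid_prod f B m (\<lambda>_. 2) \<omega>)) \<partial>M)"
    proof (rule nn_integral_cong_AE)
      show "AE \<omega> in M. ennreal (3 ^ N UNIV \<omega>) = liminf (\<lambda>m. ennreal (P.grid_prod f B m (\<lambda>_. 2) \<omega>))"
        using P.AE_grid_eventually[OF f B, where 'b = real] P.AE_N
      proof eventually_elim
        case (elim \<omega>)
        have "N UNIV \<omega> = card (X \<omega>)" using elim by auto
        then have "(\<lambda>m. ennreal (P.grid_prod f B m (\<lambda>_. 2) \<omega>)) \<longlonglongrightarrow> ennreal (3 ^ N UNIV \<omega>)"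
          by (intro tendsto_ennrealI tendsto_eventually eventually_mono[OF elim(1)]) simp
        then show ?case by (simp add: lim_imp_Liminf)
      qed
    qed
    also have "\<dots> \<le> liminf (\<lambda>m. \<integral>\<^sup>+\<omega>. ennreal (P.grid_prod f B m (\<lambda>_. 2) \<omega>) \<partial>M)"
      by (rule nn_integral_liminf) measurable
    also have "\<dots> \<le> liminf (\<lambda>m. ennreal (\<integral>\<omega>. 3 ^ N' UNIV \<omega> \<partial>M'))"
    proof (intro Liminf_mono always_eventually allI)
      fix m
      have "(\<integral>\<^sup>+\<omega>. ennreal (P.grid_prod f B m (\<lambda>_. 2) \<omega>) \<partial>M) = ennreal (\<integral>\<omega>. P.grid_prod f B m (\<lambda>_. 2) \<omega> \<partial>M)"
        using disj by (intro nn_integral_eq_integral P.integral_prod_cells(1)) (auto intro!: prod_nonneg grid_cell_sets)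
      also have "\<dots> = ennreal (\<integral>\<omega>. P'.grid_prod f B m (\<lambda>_. 2) \<omega> \<partial>M')"
        by (simp only: grid_eq)
      also have "\<dots> \<le> ennreal (\<integral>\<omega>. 3 ^ N' UNIV \<omega> \<partial>M')"
        using disj P'.AE_grid_le[OF f B]
        by (intro ennreal_leI integral_mono_AE int' P'.integral_prod_cells(1)) (auto intro!: grid_cell_sets)
      finally show "(\<integral>\<^sup>+\<omega>. ennreal (P.grid_prod f B m (\<lambda>_. 2) \<omega>) \<partial>M) \<le> ennreal (\<integral>\<omega>. 3 ^ N' UNIV \<omega> \<partial>M')" .
    qed
    also have "\<dots> < \<infinity>" by (simp add: Liminf_const)
    finally show "(\<integral>\<^sup>+\<omega>. ennreal (3 ^ N UNIV \<omega>) \<partial>M) < \<infinity>" .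
  qed auto
  have "(\<lambda>m. \<integral>\<omega>. P'.grid_prod f B m (\<lambda>j. iexp (t * (real_of_int (snd j) / real (Suc m))) - 1) \<omega> \<partial>M')
     \<longlonglongrightarrow> char (distr M borel S) t"
    using P.char_tendsto_grid[OF f B S int, of t] by (simp only: grid_eq)
  moreover have "(\<lambda>m. \<integral>\<omega>. P'.grid_prod f B m (\<lambda>j. iexp (t * (real_of_int (snd j) / real (Suc m))) - 1) \<omega> \<partial>M')
     \<longlonglongrightarrow> char (distr M' borel S') t"
    by (rule P'.char_tendsto_grid[OF f B S' int'])
  ultimately show ?thesis by (rule LIMSEQ_unique)
qed

section \<open>Distinct moduli\<close>

lemma emeasure_radial:
  assumes [measurable]: "D \<in> sets borel"
  shows "emeasure lborel {z::complex. (cmod z)\<^sup>2 \<in> D} = ennreal pi * emeasure lborel (D \<inter> {0..})"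
proof -
  have "emeasure lborel {z::complex. (cmod z)\<^sup>2 \<in> D} = emeasure (distr lborel borel (\<lambda>z::complex. (cmod z)\<^sup>2)) D"
    by (subst emeasure_distr) (auto simp: vimage_def)
  also have "\<dots> = (\<integral>\<^sup>+s. ennreal pi * indicator (D \<inter> {0..}) s \<partial>lborel)"
    unfolding distr_cmod_power2_lborel
    by (subst emeasure_density) (auto intro!: nn_integral_cong simp: indicator_def)
  also have "\<dots> = ennreal pi * emeasure lborel (D \<inter> {0..})"
    by (subst nn_integral_cmult) auto
  finally show ?thesis .
qed

text \<open>Cut the disc into about (m + 1) b rings of area at most pi / (m + 1). Two points on one
  circle, one in A and one outside, fall into the same ring. The two-point bound makes the expected
  number of such pairs O(1 / m^2) in each ring, hence O(1 / m) altogether.\<close>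

lemma ginibre_no_equal_modulus:
  fixes A :: "complex set"
  assumes G: "ginibre_ensemble M G" and [measurable]: "A \<in> sets borel" and b: "b \<ge> 0"
  shows "AE \<omega> in M. \<not> (\<exists>z\<in>G \<omega>. \<exists>w\<in>G \<omega>. z \<in> A \<and> w \<notin> A \<and> (cmod z)\<^sup>2 = (cmod w)\<^sup>2 \<and> (cmod z)\<^sup>2 \<le> b)"
proof -
  have spp: "simple_point_process M G"
    using G by (simp add: ginibre_ensemble_def determinantal_process_def)
  interpret prob_space M
    using spp by (simp add: simple_point_process_def)
  define Q where "Q = (\<lambda>m j. {s::real. s \<le> b \<and> \<lfloor>real (Suc m) * s\<rfloor> = j})"
  define A1 where "A1 = (\<lambda>m j. {z. (cmod z)\<^sup>2 \<in> Q m j} \<inter> A)"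
  define A2 where "A2 = (\<lambda>m j. {z. (cmod z)\<^sup>2 \<in> Q m j} - A)"
  define J where "J = (\<lambda>m. {0..\<lfloor>real (Suc m) * b\<rfloor>})"
  define Y where "Y = (\<lambda>m \<omega>. \<Sum>j\<in>J m. real (card (G \<omega> \<inter> A1 m j)) * real (card (G \<omega> \<inter> A2 m j)))"
  have Q [measurable]: "Q m j \<in> sets borel" for m j
    unfolding Q_def by measurable
  have Qpc: "precompact_borel {z::complex. (cmod z)\<^sup>2 \<in> Q m j}" for m j
    by (rule precompact_radial[OF Q, of _ _ b]) (auto simp: Q_def)
  have pc: "precompact_borel B" if "B \<subseteq> {z::complex. (cmod z)\<^sup>2 \<in> Q m j}" "B \<in> sets borel" for B m j
    using Qpc[of m j] that unfolding precompact_borel_def compact_closure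
    by (blast intro: bounded_subset)
  have pc1: "precompact_borel (A1 m j)" and pc2: "precompact_borel (A2 m j)" for m j
    by (rule pc[of _ m j]; auto simp: A1_def A2_def)+
  have Qm: "measure lborel {z::complex. (cmod z)\<^sup>2 \<in> Q m j} \<le> pi / real (Suc m)" for m j
  proof -
    have "Q m j \<inter> {0..} \<subseteq> {of_int j / real (Suc m)..(of_int j + 1) / real (Suc m)}"
    proof
      fix s assume "s \<in> Q m j \<inter> {0..}"
      then have "of_int j \<le> real (Suc m) * s" "real (Suc m) * s \<le> of_int j + 1"
        unfolding Q_def by (auto simp del: of_nat_Suc)
      then show "s \<in> {of_int j / real (Suc m)..(of_int j + 1) / real (Suc m)}"
        by (simp add: field_simps del: of_nat_Suc)
    qed
    then have "emeasure lborel (Q m j \<inter> {0..}) \<le> emeasure lborel {of_int j / real (Suc m)..(of_int j + 1) / real (Suc m)}"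
      by (intro emeasure_mono) auto
    also have "\<dots> = ennreal (1 / real (Suc m))"
      by (subst emeasure_lborel_Icc) (auto simp: divide_right_mono diff_divide_distrib[symmetric] simp del: of_nat_Suc)
    finally have "emeasure lborel {z::complex. (cmod z)\<^sup>2 \<in> Q m j} \<le> ennreal pi * ennreal (1 / real (Suc m))"
      unfolding emeasure_radial[OF Q] by (intro mult_left_mono) auto
    also have "\<dots> = ennreal (pi / real (Suc m))"
      by (subst ennreal_mult[symmetric]) auto
    finally show ?thesis
      unfolding measure_def by (intro enn2real_leI) auto
  qed
  have m12: "measure lborel (A1 m j) \<le> pi / real (Suc m)" "measure lborel (A2 m j) \<le> pi / real (Suc m)" for m j
  proof -
    have fm: "{z::complex. (cmod z)\<^sup>2 \<in> Q m j} \<in> fmeasurable lborel"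
      using precompact_borel_emeasure_lborel[OF Qpc[of m j]] by (auto simp: fmeasurable_def)
    show "measure lborel (A1 m j) \<le> pi / real (Suc m)"
      by (rule order_trans[OF measure_mono_fmeasurable[OF _ _ fm] Qm]) (auto simp: A1_def)
    show "measure lborel (A2 m j) \<le> pi / real (Suc m)"
      by (rule order_trans[OF measure_mono_fmeasurable[OF _ _ fm] Qm]) (auto simp: A2_def)
  qed
  have int: "integrable M (\<lambda>\<omega>. real (card (G \<omega> \<inter> A1 m j)) * real (card (G \<omega> \<inter> A2 m j)))" for m j
    by (rule ginibre_two_point_le(1)[OF G pc1 pc2]) (auto simp: A1_def A2_def)
  have Yint: "integrable M (Y m)" for m
    unfolding Y_def by (intro Bochner_Integration.integrable_sum int)
  have EY: "expectation (Y m) \<le> 2 * pi\<^sup>2 * (b + 1) / real (Suc m)" for m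
  proof -
    have "expectation (Y m) = (\<Sum>j\<in>J m. expectation (\<lambda>\<omega>. real (card (G \<omega> \<inter> A1 m j)) * real (card (G \<omega> \<inter> A2 m j))))"
      unfolding Y_def by (intro Bochner_Integration.integral_sum int)
    also have "\<dots> \<le> (\<Sum>j\<in>J m. 2 * (pi / real (Suc m) * (pi / real (Suc m))))"
    proof (intro sum_mono)
      fix j
      have "expectation (\<lambda>\<omega>. real (card (G \<omega> \<inter> A1 m j)) * real (card (G \<omega> \<inter> A2 m j)))
          \<le> 2 * (measure lborel (A1 m j) * measure lborel (A2 m j))"
        by (rule ginibre_two_point_le(2)[OF G pc1 pc2]) (auto simp: A1_def A2_def)
      also have "\<dots> \<le> 2 * (pi / real (Suc m) * (pi / real (Suc m)))"
        by (intro mult_left_mono mult_mono m12) auto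
      finally show "expectation (\<lambda>\<omega>. real (card (G \<omega> \<inter> A1 m j)) * real (card (G \<omega> \<inter> A2 m j)))
          \<le> 2 * (pi / real (Suc m) * (pi / real (Suc m)))" .
    qed
    also have "\<dots> = real (card (J m)) * (2 * pi\<^sup>2 / (real (Suc m))\<^sup>2)"
      by (simp add: power2_eq_square)
    also have "\<dots> \<le> (real (Suc m) * (b + 1)) * (2 * pi\<^sup>2 / (real (Suc m))\<^sup>2)"
    proof (intro mult_right_mono)
      have "0 \<le> real (Suc m) * b" using b by simp
      then have "real (card (J m)) \<le> real (Suc m) * b + 1"
        unfolding J_def by (simp del: of_nat_Suc)
      then show "real (card (J m)) \<le> real (Suc m) * (b + 1)"
        by (simp add: algebra_simps)
    qed auto
    also have "\<dots> = 2 * pi\<^sup>2 * (b + 1) / real (Suc m)"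
      by (simp add: power2_eq_square field_simps del: of_nat_Suc)
    finally show ?thesis .
  qed
  have [measurable]: "Y m \<in> borel_measurable M" for m
    using Yint[of m] by auto
  \<comment> \<open>A measurable event containing every bad configuration in the sample space, so
    that measurability of the bad set itself is never at issue. A bad pair contributes at least 1 to
    \<open>Y m\<close> for every m.\<close>
  define Z where "Z = {\<omega>\<in>space M. \<forall>m. 1 \<le> Y m \<omega>}"
  have [measurable]: "Z \<in> events"
    unfolding Z_def by measurable
  have "prob Z \<le> 2 * pi\<^sup>2 * (b + 1) / real (Suc m)" for m
  proof -
    have "prob Z = expectation (indicator Z)" by simp
    also have "\<dots> \<le> expectation (Y m)"
    proof (intro integral_mono Yint)
      show "integrable M (indicat_real Z)"
        by (intro integrable_real_indicator) (auto simp: less_top[symmetric])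
      fix \<omega> assume "\<omega> \<in> space M"
      have "0 \<le> Y m \<omega>" unfolding Y_def by (intro sum_nonneg) auto
      then show "indicator Z \<omega> \<le> Y m \<omega>" by (auto simp: indicator_def Z_def)
    qed
    finally show ?thesis using EY[of m] by simp
  qed
  moreover have "(\<lambda>m. 2 * pi\<^sup>2 * (b + 1) / real (Suc m)) \<longlonglongrightarrow> 0"
    by (intro LIMSEQ_Suc real_tendsto_divide_at_top[OF tendsto_const filterlim_real_sequentially])
  ultimately have "prob Z \<le> 0"
    by (intro LIMSEQ_le_const) auto
  then have "prob Z = 0" by (simp add: measure_le_0_iff)
  then have "AE \<omega> in M. \<omega> \<notin> Z"
    by (simp add: prob_eq_0)
  then show ?thesis
    using AE_space
  proof eventually_elim
    case (elim \<omega>)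
    show ?case
    proof
      assume "\<exists>z\<in>G \<omega>. \<exists>w\<in>G \<omega>. z \<in> A \<and> w \<notin> A \<and> (cmod z)\<^sup>2 = (cmod w)\<^sup>2 \<and> (cmod z)\<^sup>2 \<le> b"
      then obtain z w where zw: "z \<in> G \<omega>" "w \<in> G \<omega>" "z \<in> A" "w \<notin> A" "(cmod z)\<^sup>2 = (cmod w)\<^sup>2" "(cmod z)\<^sup>2 \<le> b"
        by blast
      have "1 \<le> Y m \<omega>" for m
      proof -
        define j where "j = \<lfloor>real (Suc m) * (cmod z)\<^sup>2\<rfloor>"
        have j: "j \<in> J m"
          unfolding J_def j_def atLeastAtMost_iff using zw
          by (auto intro!: floor_mono mult_left_mono simp del: of_nat_Suc)
        have in1: "z \<in> G \<omega> \<inter> A1 m j" using zw by (auto simp: A1_def Q_def j_def)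
        have in2: "w \<in> G \<omega> \<inter> A2 m j" using zw by (auto simp: A2_def Q_def j_def)
        have fin: "finite (G \<omega> \<inter> B)" if "precompact_borel B" for B
          using spp that elim(2) unfolding simple_point_process_def precompact_borel_def
          by (meson closure_subset finite_subset Int_mono order_refl)
        have "1 \<le> card (G \<omega> \<inter> A1 m j)" "1 \<le> card (G \<omega> \<inter> A2 m j)"
          using in1 in2 fin[OF pc1] fin[OF pc2] by (auto simp: Suc_le_eq card_gt_0_iff)
        then have "1 \<le> card (G \<omega> \<inter> A1 m j) * card (G \<omega> \<inter> A2 m j)"
          by (simp add: Suc_le_eq)
        then have "1 \<le> real (card (G \<omega> \<inter> A1 m j)) * real (card (G \<omega> \<inter> A2 m j))"
          by (metis of_nat_1 of_nat_le_iff of_nat_mult)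
        also have "\<dots> \<le> Y m \<omega>"
          unfolding Y_def by (rule member_le_sum[OF j]) (auto simp: J_def)
        finally show ?thesis .
      qed
      with elim show False by (simp add: Z_def)
    qed
  qed
qed

text \<open>Countably many half-planes, Re z < q and Im z < q with q rational, separate any two
  distinct points.\<close>

lemma ginibre_AE_inj_on_modulus:
  assumes G: "ginibre_ensemble M G" and b: "b \<ge> 0"
  shows "AE \<omega> in M. inj_on (\<lambda>z. (cmod z)\<^sup>2) {z\<in>G \<omega>. (cmod z)\<^sup>2 \<le> b}"
proof -
  have "AE \<omega> in M. \<forall>q::rat. \<forall>\<rho>\<in>{Re, Im}.
      \<not> (\<exists>z\<in>G \<omega>. \<exists>w\<in>G \<omega>. z \<in> {z. \<rho> z < of_rat q} \<and> w \<notin> {z. \<rho> z < of_rat q} \<and> (cmod z)\<^sup>2 = (cmod w)\<^sup>2 \<and> (cmod z)\<^sup>2 \<le> b)"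
    unfolding AE_all_countable
  proof (intro allI AE_ball_countable[THEN iffD2] ballI)
    fix q :: rat and \<rho> assume "\<rho> \<in> {Re, Im}"
    then have [measurable]: "\<rho> \<in> borel_measurable borel" by (auto simp: borel_measurable_Re borel_measurable_Im)
    show "AE \<omega> in M. \<not> (\<exists>z\<in>G \<omega>. \<exists>w\<in>G \<omega>. z \<in> {z. \<rho> z < of_rat q} \<and> w \<notin> {z. \<rho> z < of_rat q} \<and> (cmod z)\<^sup>2 = (cmod w)\<^sup>2 \<and> (cmod z)\<^sup>2 \<le> b)"
      by (rule ginibre_no_equal_modulus[OF G _ b]) measurable
  qed auto
  then show ?thesis
  proof eventually_elim
    case (elim \<omega>)
    have sep: "\<rho> z = \<rho> w" if "z \<in> G \<omega>" "w \<in> G \<omega>" "(cmod z)\<^sup>2 = (cmod w)\<^sup>2" "(cmod z)\<^sup>2 \<le> b" "\<rho> \<in> {Re, Im}" for z w \<rho>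
    proof (rule ccontr)
      assume "\<rho> z \<noteq> \<rho> w"
      then consider "\<rho> z < \<rho> w" | "\<rho> w < \<rho> z" by linarith
      then show False
      proof cases
        case 1
        then obtain q where "\<rho> z < of_rat q" "of_rat q < \<rho> w" using of_rat_dense by blast
        then show False using elim[rule_format, OF that(5), of q] that by force
      next
        case 2
        then obtain q where "\<rho> w < of_rat q" "of_rat q < \<rho> z" using of_rat_dense by blast
        then show False using elim[rule_format, OF that(5), of q] that by force
      qed
    qed
    show ?case
    proof (intro inj_onI complex_eqI)
      fix z w assume zw: "z \<in> {z \<in> G \<omega>. (cmod z)\<^sup>2 \<le> b}" "w \<in> {z \<in> G \<omega>. (cmod z)\<^sup>2 \<le> b}" "(cmod z)\<^sup>2 = (cmod w)\<^sup>2"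
      show "Re z = Re w" using sep[of z w Re] zw by blast
      show "Im z = Im w" using sep[of z w Im] zw by blast
    qed
  qed
qed

section \<open>Independent Gamma points\<close>

lemma (in product_prob_space) integral_PiM_prod:
  fixes f :: "'i \<Rightarrow> 'a \<Rightarrow> 'b::{real_normed_field, banach, second_countable_topology}"
  assumes J: "finite J" "J \<subseteq> I" and f: "\<And>j. j \<in> J \<Longrightarrow> integrable (M j) (f j)"
  shows "integrable (PiM I M) (\<lambda>\<omega>. \<Prod>j\<in>J. f j (\<omega> j))"
    and "(\<integral>\<omega>. (\<Prod>j\<in>J. f j (\<omega> j)) \<partial>PiM I M) = (\<Prod>j\<in>J. integral\<^sup>L (M j) (f j))"
proof -
  have int: "integrable (PiM J M) (\<lambda>\<omega>. \<Prod>j\<in>J. f j (\<omega> j))"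
    by (rule product_integrable_prod[OF J(1) f])
  then have int': "integrable (distr (PiM I M) (PiM J M) (\<lambda>\<omega>. restrict \<omega> J)) (\<lambda>\<omega>. \<Prod>j\<in>J. f j (\<omega> j))"
    by (simp add: distr_PiM_restrict_finite[OF J])
  have restrict: "(\<lambda>\<omega>. restrict \<omega> J) \<in> measurable (PiM I M) (PiM J M)"
    using J by (intro measurable_restrict_subset)
  have meas: "(\<lambda>\<omega>. \<Prod>j\<in>J. f j (\<omega> j)) \<in> borel_measurable (PiM J M)"
    using int by auto
  show "integrable (PiM I M) (\<lambda>\<omega>. \<Prod>j\<in>J. f j (\<omega> j))"
    using int' by (subst (asm) integrable_distr_eq[OF restrict meas]) simp
  have "(\<integral>\<omega>. (\<Prod>j\<in>J. f j (\<omega> j)) \<partial>PiM J M) = (\<integral>\<omega>. (\<Prod>j\<in>J. f j (\<omega> j)) \<partial>distr (PiM I M) (PiM J M) (\<lambda>\<omega>. restrict \<omega> J))"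
    by (simp add: distr_PiM_restrict_finite[OF J])
  also have "\<dots> = (\<integral>\<omega>. (\<Prod>j\<in>J. f j (\<omega> j)) \<partial>PiM I M)"
    by (subst integral_distr[OF restrict meas]) simp
  finally show "(\<integral>\<omega>. (\<Prod>j\<in>J. f j (\<omega> j)) \<partial>PiM I M) = (\<Prod>j\<in>J. integral\<^sup>L (M j) (f j))"
    using product_integral_prod[OF J(1) f] by simp
qed

text \<open>For fixed s \<ge> 0 the values s^n exp(-s) / n! are the Poisson weights of mean
  s.\<close>

lemma erlang_density_sums: "(\<lambda>n. erlang_density n 1 s) sums indicator {0..} s"
proof (cases "s \<ge> 0")
  case True
  have "(\<lambda>n. s ^ n /\<^sub>R fact n * exp (- s)) sums (exp s * exp (- s))"
    by (intro sums_mult2 exp_converges)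
  with True show ?thesis
    by (simp add: erlang_density_def exp_minus_inverse divide_inverse mult_ac)
next
  case False
  then have "(\<lambda>n. erlang_density n 1 s) = (\<lambda>_. 0)" "indicat_real {0..} s = 0"
    by (auto simp: erlang_density_def)
  then show ?thesis by (simp only: sums_zero)
qed

lemma suminf_nn_integral_gamma_law:
  assumes [measurable]: "h \<in> borel_measurable borel"
  shows "(\<Sum>n. \<integral>\<^sup>+s. h s \<partial>gamma_law n) = (\<integral>\<^sup>+s. indicator {0..} s * h s \<partial>lborel)"
proof -
  have "(\<Sum>n. \<integral>\<^sup>+s. h s \<partial>gamma_law n) = (\<Sum>n. \<integral>\<^sup>+s. ennreal (erlang_density n 1 s) * h s \<partial>lborel)"
    unfolding gamma_law_def by (intro suminf_cong nn_integral_density) auto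
  also have "\<dots> = (\<integral>\<^sup>+s. (\<Sum>n. ennreal (erlang_density n 1 s) * h s) \<partial>lborel)"
    by (intro nn_integral_suminf[symmetric]) auto
  also have "\<dots> = (\<integral>\<^sup>+s. indicator {0..} s * h s \<partial>lborel)"
  proof (intro nn_integral_cong)
    fix s
    have "(\<Sum>n. ennreal (erlang_density n 1 s)) = ennreal (indicator {0..} s)"
      by (rule suminf_ennreal_eq[OF _ erlang_density_sums]) simp
    then show "(\<Sum>n. ennreal (erlang_density n 1 s) * h s) = indicator {0..} s * h s"
      by (simp only: ennreal_suminf_multc ennreal_indicator)
  qed
  finally show ?thesis .
qed

text \<open>The expected number of Gamma points in {0..b} is b. Its finiteness feeds Borel-Cantelli,
  and its value bounds the exponential moment.\<close>

lemma measure_gamma_law_sums: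
  assumes b: "b \<ge> 0"
  shows "(\<lambda>n. measure (gamma_law n) {0..b}) sums b"
proof -
  interpret prob_space "gamma_law n" for n by (rule prob_space_gamma_law)
  have "(\<Sum>n. ennreal (measure (gamma_law n) {0..b})) = (\<Sum>n. \<integral>\<^sup>+s. indicator {0..b} s \<partial>gamma_law n)"
    by (simp add: emeasure_eq_measure)
  also have "\<dots> = (\<integral>\<^sup>+s. indicator {0..b} s \<partial>lborel)"
    unfolding suminf_nn_integral_gamma_law[OF borel_measurable_indicator[OF atLeastAtMost_borel]]
    by (intro nn_integral_cong) (auto simp: indicator_def)
  also have "\<dots> = ennreal b" using b by simp
  finally have *: "(\<Sum>n. ennreal (measure (gamma_law n) {0..b})) = ennreal b" .
  then have "summable (\<lambda>n. measure (gamma_law n) {0..b})"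
    by (intro summable_suminf_not_top) auto
  moreover from this have "0 \<le> (\<Sum>n. measure (gamma_law n) {0..b})"
    by (rule suminf_nonneg) simp
  moreover have "ennreal (\<Sum>n. measure (gamma_law n) {0..b}) = ennreal b"
    using * by (subst suminf_ennreal2[symmetric]) (use \<open>summable _\<close> in auto)
  ultimately have "summable (\<lambda>n. measure (gamma_law n) {0..b})" "(\<Sum>n. measure (gamma_law n) {0..b}) = b"
    using b by simp_all
  then show ?thesis by (simp only: sums_iff)
qed

section \<open>The sequence of independent Gamma variables and its counts\<close>

definition gamma_seq :: "(nat \<Rightarrow> real) measure" where
  "gamma_seq = PiM UNIV gamma_law"

text \<open>Counts indices rather than values, so that partial counts are sums of indicators of
  independent coordinates. On the null set where infinitely many coordinates lie in
  \<open>{0..b}\<close>, \<open>card\<close> may return its default 0.\<close>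

definition gamma_count :: "real \<Rightarrow> real set \<Rightarrow> (nat \<Rightarrow> real) \<Rightarrow> nat" where
  "gamma_count b D \<omega> = card {n. \<omega> n \<in> D \<inter> {0..b}}"

definition gamma_points :: "real \<Rightarrow> (nat \<Rightarrow> real) \<Rightarrow> real set" where
  "gamma_points b \<omega> = \<omega> ` {n. \<omega> n \<in> {0..b}}"

interpretation gamma: product_prob_space gamma_law UNIV
  by (intro product_prob_spaceI prob_space_gamma_law)

interpretation gamma_seq: prob_space gamma_seq
  unfolding gamma_seq_def by (rule gamma.P.prob_space_axioms)

lemma measurable_gamma_seq_component [measurable]: "(\<lambda>\<omega>. \<omega> n) \<in> borel_measurable gamma_seq"
  using measurable_component_singleton[of n UNIV gamma_law]
  by (simp add: gamma_seq_def measurable_cong_sets[OF refl sets_gamma_law])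

lemma gamma_seq_AE_finite:
  assumes b: "b \<ge> 0"
  shows "AE \<omega> in gamma_seq. finite {n. \<omega> n \<in> {0..b}}"
proof -
  have eq: "measure gamma_seq {\<omega>\<in>space gamma_seq. \<omega> n \<in> {0..b}} = measure (gamma_law n) {0..b}" for n
  proof -
    have "emeasure gamma_seq {\<omega>\<in>space gamma_seq. \<omega> n \<in> {0..b}} = emeasure (gamma_law n) {0..b}"
      unfolding gamma_seq_def by (rule gamma.emeasure_PiM_Collect_single) auto
    then show ?thesis by (simp add: measure_def)
  qed
  have "AE \<omega> in gamma_seq. eventually (\<lambda>n. \<omega> \<in> space gamma_seq - {\<omega>\<in>space gamma_seq. \<omega> n \<in> {0..b}}) sequentially"
  proof (rule borel_cantelli_AE1)
    show "summable (\<lambda>n. measure gamma_seq {\<omega>\<in>space gamma_seq. \<omega> n \<in> {0..b}})"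
      unfolding eq using measure_gamma_law_sums[OF b] by (rule sums_summable)
  qed (auto simp: less_top[symmetric])
  then show ?thesis
  proof eventually_elim
    case (elim \<omega>)
    then obtain K where K: "\<And>n. n \<ge> K \<Longrightarrow> \<omega> n \<notin> {0..b}"
      by (auto simp: eventually_sequentially)
    have "{n. \<omega> n \<in> {0..b}} \<subseteq> {..<K}"
    proof
      fix n assume "n \<in> {n. \<omega> n \<in> {0..b}}"
      with K[of n] show "n \<in> {..<K}" by (cases "n < K") auto
    qed
    then show ?case by (rule finite_subset) simp
  qed
qed

lemma gamma_law_AE_neq: "AE y in gamma_law n. x \<noteq> y"
  unfolding gamma_law_def
  by (subst AE_density, simp, rule eventually_mono[OF AE_lborel_singleton[of x]], auto)

text \<open>The joint law of two coordinates is a product of laws without atoms, so the diagonal is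
  null; there are countably many pairs.\<close>

lemma gamma_seq_AE_inj: "AE \<omega> in gamma_seq. inj \<omega>"
proof -
  have pair: "AE \<omega> in gamma_seq. \<omega> n \<noteq> \<omega> m" if "n \<noteq> m" for n m
  proof -
    have *: "gamma_law n \<Otimes>\<^sub>M gamma_law m = distr gamma_seq (gamma_law n \<Otimes>\<^sub>M gamma_law m) (\<lambda>\<omega>. (\<omega> n, \<omega> m))"
    proof (rule pair_measure_eqI)
      fix A B assume AB: "A \<in> sets (gamma_law n)" "B \<in> sets (gamma_law m)"
      define F where "F = (\<lambda>i. if i = n then A else B)"
      have "emeasure (distr gamma_seq (gamma_law n \<Otimes>\<^sub>M gamma_law m) (\<lambda>\<omega>. (\<omega> n, \<omega> m))) (A \<times> B)
          = emeasure gamma_seq {\<omega>\<in>space gamma_seq. \<forall>i\<in>{n, m}. \<omega> i \<in> F i}"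
        using AB that by (subst emeasure_distr) (auto simp: F_def intro!: arg_cong2[where f = emeasure])
      also have "\<dots> = (\<Prod>i\<in>{n, m}. emeasure (gamma_law i) (F i))"
        unfolding gamma_seq_def using AB by (intro gamma.emeasure_PiM_Collect) (auto simp: F_def)
      also have "\<dots> = emeasure (gamma_law n) A * emeasure (gamma_law m) B"
        using that by (simp add: F_def)
      finally show "emeasure (gamma_law n) A * emeasure (gamma_law m) B =
        emeasure (distr gamma_seq (gamma_law n \<Otimes>\<^sub>M gamma_law m) (\<lambda>\<omega>. (\<omega> n, \<omega> m))) (A \<times> B)" ..
    qed (auto intro: prob_space_imp_sigma_finite prob_space_gamma_law)
    interpret pair_sigma_finite "gamma_law n" "gamma_law m"
      by (intro pair_sigma_finite.intro prob_space_imp_sigma_finite prob_space_gamma_law)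
    have "AE p in gamma_law n \<Otimes>\<^sub>M gamma_law m. fst p \<noteq> snd p"
    proof (rule AE_pair_measure)
      show "{p \<in> space (gamma_law n \<Otimes>\<^sub>M gamma_law m). fst p \<noteq> snd p} \<in> sets (gamma_law n \<Otimes>\<^sub>M gamma_law m)"
        by measurable
    qed (auto simp: gamma_law_AE_neq)
    then have "AE p in distr gamma_seq (gamma_law n \<Otimes>\<^sub>M gamma_law m) (\<lambda>\<omega>. (\<omega> n, \<omega> m)). fst p \<noteq> snd p"
      by (subst *[symmetric])
    then show ?thesis
      by (rule AE_distrD[rotated, where f = "\<lambda>\<omega>. (\<omega> n, \<omega> m)" and P = "\<lambda>p. fst p \<noteq> snd p", simplified]) simp
  qed
  have "AE \<omega> in gamma_seq. \<forall>n m. n \<noteq> m \<longrightarrow> \<omega> n \<noteq> \<omega> m"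
    unfolding AE_all_countable using pair by auto
  then show ?thesis by eventually_elim (auto simp: inj_def)
qed

text \<open>The same sum as for the determinant, for another reason: a tuple with a repeated index
  vanishes because one point cannot lie in two disjoint sets, and for distinct indices independence
  factorizes the expectation.\<close>

lemma gamma_count_trunc_moments:
  fixes D :: "nat \<Rightarrow> real set"
  assumes D: "\<And>i. i < k \<Longrightarrow> D i \<in> sets borel" and disj: "disjoint_family_on D {..<k}"
  shows "(\<integral>\<omega>. (\<Prod>i<k. \<Sum>n<K. indicator (D i) (\<omega> n)) \<partial>gamma_seq)
    = (\<Sum>n | n \<in> {..<k} \<rightarrow>\<^sub>E {..<K} \<and> inj_on n {..<k}. \<Prod>i<k. measure (gamma_law (n i)) (D i))"
proof -
  let ?E = "{..<k} \<rightarrow>\<^sub>E {..<K}"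
  let ?R = "\<lambda>n \<omega>. \<Prod>i<k. indicat_real (D i) (\<omega> (n i))"
  have int: "integrable gamma_seq (?R n)" if "n \<in> ?E" for n
  proof (rule gamma_seq.integrable_const_bound[where B = 1])
    show "AE \<omega> in gamma_seq. norm (?R n \<omega>) \<le> 1"
      by (intro AE_I2) (auto simp: abs_prod intro!: prod_le_1 simp: indicator_def)
    show "?R n \<in> borel_measurable gamma_seq"
      using D by (intro borel_measurable_prod) auto
  qed
  have val: "(\<integral>\<omega>. ?R n \<omega> \<partial>gamma_seq) = (if inj_on n {..<k} then (\<Prod>i<k. measure (gamma_law (n i)) (D i)) else 0)" for n
  proof (cases "inj_on n {..<k}")
    case True
    define g where "g = inv_into {..<k} n"
    have g: "g (n i) = i" if "i < k" for i
      using True that by (simp add: g_def)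
    have "(\<integral>\<omega>. ?R n \<omega> \<partial>gamma_seq) = (\<integral>\<omega>. (\<Prod>m\<in>n ` {..<k}. indicat_real (D (g m)) (\<omega> m)) \<partial>gamma_seq)"
      using True by (simp add: prod.reindex g)
    also have "\<dots> = (\<Prod>m\<in>n ` {..<k}. integral\<^sup>L (gamma_law m) (indicat_real (D (g m))))"
      unfolding gamma_seq_def
      by (rule gamma.integral_PiM_prod) (auto simp: g D less_top[symmetric])
    also have "\<dots> = (\<Prod>i<k. measure (gamma_law (n i)) (D i))"
      using True by (simp add: prod.reindex g)
    finally show ?thesis using True by simp
  next
    case False
    then obtain i j where ij: "i < k" "j < k" "i \<noteq> j" "n i = n j"
      by (auto simp: inj_on_def)
    have "?R n \<omega> = 0" for \<omega>
    proof -
      have "\<omega> (n i) \<notin> D i \<or> \<omega> (n j) \<notin> D j"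
        using disj ij by (auto simp: disjoint_family_on_def)
      then obtain l where "l < k" "\<omega> (n l) \<notin> D l" using ij by blast
      then show ?thesis by (intro prod_zero bexI[of _ l]) auto
    qed
    then have "(\<integral>\<omega>. ?R n \<omega> \<partial>gamma_seq) = (\<integral>\<omega>. 0 \<partial>gamma_seq)"
      by (rule Bochner_Integration.integral_cong[OF refl])
    also have "\<dots> = 0" by simp
    finally show ?thesis by (simp only: False if_False)
  qed
  have "(\<integral>\<omega>. (\<Prod>i<k. \<Sum>n<K. indicator (D i) (\<omega> n)) \<partial>gamma_seq) = (\<integral>\<omega>. (\<Sum>n\<in>?E. ?R n \<omega>) \<partial>gamma_seq)"
    by (simp add: prod_sum_PiE)
  also have "\<dots> = (\<Sum>n\<in>?E. if inj_on n {..<k} then (\<Prod>i<k. measure (gamma_law (n i)) (D i)) else 0)"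
    using int by (simp add: Bochner_Integration.integral_sum val)
  also have "\<dots> = (\<Sum>n | n \<in> ?E \<and> inj_on n {..<k}. \<Prod>i<k. measure (gamma_law (n i)) (D i))"
    by (intro sum.mono_neutral_cong_right finite_PiE) auto
  finally show ?thesis .
qed

text \<open>All coordinates in {0..b} occur before one index, which serves every \<open>D\<close>
  simultaneously; the moments need k sets at once.\<close>

lemma gamma_count_eventually:
  assumes "finite {n. \<omega> n \<in> {0..b}}"
  shows "eventually (\<lambda>K. \<forall>D. (\<Sum>n<K. indicator (D \<inter> {0..b}) (\<omega> n)) = real (gamma_count b D \<omega>)) sequentially"
proof -
  obtain K where K: "\<And>n. \<omega> n \<in> {0..b} \<Longrightarrow> n < K"
    using assms by (metis (mono_tags) finite_nat_set_iff_bounded mem_Collect_eq)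
  have "(\<Sum>n<L. indicator (D \<inter> {0..b}) (\<omega> n)) = real (gamma_count b D \<omega>)" if "L \<ge> K" for L D
  proof -
    have "(\<Sum>n<L. indicator (D \<inter> {0..b}) (\<omega> n)) = (\<Sum>n\<in>{n. \<omega> n \<in> D \<inter> {0..b}}. 1::real)"
      using K that by (intro sum.mono_neutral_cong_right) (auto simp: indicator_def dest: less_le_trans)
    then show ?thesis by (simp add: gamma_count_def)
  qed
  then show ?thesis by (auto simp: eventually_sequentially)
qed

lemma gamma_count_measurable [measurable]:
  assumes [measurable]: "D \<in> sets borel"
  shows "gamma_count b D \<in> measurable gamma_seq (count_space UNIV)"
  unfolding gamma_count_def
proof (rule measurable_card)
  fix n
  have "{\<omega> \<in> space gamma_seq. \<omega> n \<in> D \<inter> {0..b}} \<in> sets gamma_seq" by measurable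
  then show "{\<omega> \<in> space gamma_seq. n \<in> {n. \<omega> n \<in> D \<inter> {0..b}}} \<in> sets gamma_seq" by simp
qed

text \<open>Each index in {0..b} contributes a factor 3 = 1 + 2. By independence the truncated
  expectation is the product of 1 + 2 p_n, at most exp(2 * sum of p_n) and hence at most exp(2 b),
  where p_n is the mass that \<open>gamma_law n\<close> gives to {0..b}. Fatou's lemma removes the
  truncation.\<close>

lemma gamma_count_exp_integrable:
  assumes b: "b \<ge> 0"
  shows "integrable gamma_seq (\<lambda>\<omega>. 3 ^ gamma_count b UNIV \<omega> :: real)"
proof (rule integrableI_nonneg)
  define u where "u = (\<lambda>K (\<omega> :: nat \<Rightarrow> real). \<Prod>n<K. 1 + 2 * indicat_real {0..b} (\<omega> n))"
  have int1: "integrable (gamma_law n) (\<lambda>s. 1 + 2 * indicat_real {0..b} s)" for n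
    by (intro Bochner_Integration.integrable_add integrable_mult_right integrable_real_indicator) (auto simp: less_top[symmetric])
  have val1: "(\<integral>s. 1 + 2 * indicat_real {0..b} s \<partial>gamma_law n) = 1 + 2 * measure (gamma_law n) {0..b}" for n
    using gamma.M.prob_space[of n] by (subst Bochner_Integration.integral_add) (auto simp: less_top[symmetric])
  have uint: "integrable gamma_seq (u K)" for K
    unfolding u_def gamma_seq_def by (rule gamma.integral_PiM_prod) (auto simp: int1)
  have uval: "integral\<^sup>L gamma_seq (u K) \<le> exp (2 * b)" for K
  proof -
    have "integral\<^sup>L gamma_seq (u K) = (\<Prod>n<K. 1 + 2 * measure (gamma_law n) {0..b})"
      unfolding u_def gamma_seq_def by (subst gamma.integral_PiM_prod(2)) (auto simp: int1 val1)
    also have "\<dots> \<le> (\<Prod>n<K. exp (2 * measure (gamma_law n) {0..b}))"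
      by (intro prod_mono) (auto intro: exp_ge_add_one_self)
    also have "\<dots> = exp (2 * (\<Sum>n<K. measure (gamma_law n) {0..b}))"
      by (simp add: exp_sum sum_distrib_left)
    also have "(\<Sum>n<K. measure (gamma_law n) {0..b}) \<le> b"
      using measure_gamma_law_sums[OF b] by (metis finite_lessThan measure_nonneg sum_le_suminf sums_iff)
    finally show ?thesis by simp
  qed
  have "(\<integral>\<^sup>+\<omega>. ennreal (3 ^ gamma_count b UNIV \<omega>) \<partial>gamma_seq) = (\<integral>\<^sup>+\<omega>. liminf (\<lambda>K. ennreal (u K \<omega>)) \<partial>gamma_seq)"
  proof (rule nn_integral_cong_AE)
    show "AE \<omega> in gamma_seq. ennreal (3 ^ gamma_count b UNIV \<omega>) = liminf (\<lambda>K. ennreal (u K \<omega>))"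
      using gamma_seq_AE_finite[OF b]
    proof eventually_elim
      case (elim \<omega>)
      have "u K \<omega> = 3 ^ card {n\<in>{..<K}. \<omega> n \<in> {0..b}}" for K
      proof -
        have "u K \<omega> = (\<Prod>n<K. if \<omega> n \<in> {0..b} then 3 else 1)"
          unfolding u_def by (intro prod.cong) auto
        also have "\<dots> = 3 ^ card {n\<in>{..<K}. \<omega> n \<in> {0..b}}"
          by (simp add: prod.If_cases Int_def)
        finally show ?thesis .
      qed
      moreover have "(\<Sum>n<K. indicator (UNIV \<inter> {0..b}) (\<omega> n)) = real (card {n\<in>{..<K}. \<omega> n \<in> {0..b}})" for K
        by (simp add: indicator_def sum.If_cases Int_def)
      ultimately have "eventually (\<lambda>K. ennreal (u K \<omega>) = ennreal (3 ^ gamma_count b UNIV \<omega>)) sequentially"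
        using gamma_count_eventually[OF elim] by (auto elim!: eventually_mono dest!: spec[of _ UNIV])
      then show ?case
        by (intro lim_imp_Liminf[symmetric] tendsto_eventually) auto
    qed
  qed
  also have "\<dots> \<le> liminf (\<lambda>K. \<integral>\<^sup>+\<omega>. ennreal (u K \<omega>) \<partial>gamma_seq)"
    using uint by (intro nn_integral_liminf) auto
  also have "\<dots> \<le> liminf (\<lambda>K. ennreal (exp (2 * b)))"
  proof (intro Liminf_mono always_eventually allI)
    fix K
    have "(\<integral>\<^sup>+\<omega>. ennreal (u K \<omega>) \<partial>gamma_seq) = ennreal (integral\<^sup>L gamma_seq (u K))"
      by (intro nn_integral_eq_integral uint) (auto simp: u_def intro!: prod_nonneg)
    then show "(\<integral>\<^sup>+\<omega>. ennreal (u K \<omega>) \<partial>gamma_seq) \<le> ennreal (exp (2 * b))"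
      using uval by (simp add: ennreal_leI)
  qed
  also have "\<dots> < \<infinity>" by (simp add: Liminf_const)
  finally show "(\<integral>\<^sup>+\<omega>. ennreal (3 ^ gamma_count b UNIV \<omega>) \<partial>gamma_seq) < \<infinity>" .
  show "(\<lambda>\<omega>. 3 ^ gamma_count b UNIV \<omega> :: real) \<in> borel_measurable gamma_seq"
    by (rule measurable_compose[OF gamma_count_measurable]) auto
qed simp

lemma prod_card_le_3_power:
  assumes "finite A" "finite J" "disjoint_family_on D J" "\<And>j. j \<in> J \<Longrightarrow> D j \<subseteq> A"
  shows "(\<Prod>j\<in>J. real (card (D j))) \<le> 3 ^ card A"
proof -
  have fin: "finite (D j)" if "j \<in> J" for j
    using assms(4)[OF that] assms(1) by (rule finite_subset)
  have "(\<Prod>j\<in>J. real (card (D j))) \<le> (\<Prod>j\<in>J. 3 ^ card (D j))"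
    using bernoulli_3 by (intro prod_mono) (smt (verit) of_nat_0_le_iff)
  also have "\<dots> = 3 ^ (\<Sum>j\<in>J. card (D j))" by (simp add: power_sum)
  also have "(\<Sum>j\<in>J. card (D j)) = card (\<Union>j\<in>J. D j)"
    using assms fin by (intro card_UN_disjoint[symmetric]) (auto simp: disjoint_family_on_def)
  also have "(3::real) ^ card (\<Union>j\<in>J. D j) \<le> 3 ^ card A"
    using assms by (intro power_increasing card_mono) auto
  finally show ?thesis .
qed

text \<open>Truncated counts over disjoint sets have product at most 3 to the total number of
  points, because n \<le> 3^n, and this majorant is integrable.\<close>

lemma gamma_count_moments:
  fixes D :: "nat \<Rightarrow> real set"
  assumes b: "b \<ge> 0" and D: "\<And>i. i < k \<Longrightarrow> D i \<in> sets borel" and disj: "disjoint_family_on D {..<k}"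
  shows "integrable gamma_seq (\<lambda>\<omega>. \<Prod>i<k. real (gamma_count b (D i) \<omega>))"
    and "(\<lambda>K. \<Sum>n | n \<in> {..<k} \<rightarrow>\<^sub>E {..<K} \<and> inj_on n {..<k}. \<Prod>i<k. measure (gamma_law (n i)) (D i \<inter> {0..b}))
      \<longlonglongrightarrow> (\<integral>\<omega>. (\<Prod>i<k. real (gamma_count b (D i) \<omega>)) \<partial>gamma_seq)"
proof -
  let ?u = "\<lambda>K \<omega>. \<Prod>i<k. \<Sum>n<K. indicat_real (D i \<inter> {0..b}) (\<omega> n)"
  have meas: "?u K \<in> borel_measurable gamma_seq" for K
    using D by (intro borel_measurable_prod borel_measurable_sum) auto
  have meas': "(\<lambda>\<omega>. \<Prod>i<k. real (gamma_count b (D i) \<omega>)) \<in> borel_measurable gamma_seq"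
  proof (intro borel_measurable_prod)
    fix i assume "i \<in> {..<k}"
    then have [measurable]: "D i \<in> sets borel" using D by simp
    show "(\<lambda>\<omega>. real (gamma_count b (D i) \<omega>)) \<in> borel_measurable gamma_seq"
      by (rule measurable_compose[OF gamma_count_measurable]) auto
  qed
  have disj': "disjoint_family_on (\<lambda>i. D i \<inter> {0..b}) {..<k}"
    using disj by (auto simp: disjoint_family_on_def)
  have lim: "AE \<omega> in gamma_seq. (\<lambda>K. ?u K \<omega>) \<longlonglongrightarrow> (\<Prod>i<k. real (gamma_count b (D i) \<omega>))"
    using gamma_seq_AE_finite[OF b]
  proof eventually_elim
    case (elim \<omega>)
    from gamma_count_eventually[OF this] show ?case
      by (intro tendsto_eventually) (auto elim!: eventually_mono)
  qed
  have bound: "AE \<omega> in gamma_seq. norm (?u K \<omega>) \<le> 3 ^ gamma_count b UNIV \<omega>" for K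
    using gamma_seq_AE_finite[OF b]
  proof eventually_elim
    case (elim \<omega>)
    have "?u K \<omega> = (\<Prod>i<k. real (card {n\<in>{..<K}. \<omega> n \<in> D i \<inter> {0..b}}))"
      by (simp add: indicator_def sum.If_cases Int_def)
    also have "\<dots> \<le> 3 ^ card {n. \<omega> n \<in> {0..b}}"
      using disj elim by (intro prod_card_le_3_power) (auto simp: disjoint_family_on_def)
    finally show ?case
      by (simp add: gamma_count_def abs_prod sum_nonneg)
  qed
  show "integrable gamma_seq (\<lambda>\<omega>. \<Prod>i<k. real (gamma_count b (D i) \<omega>))"
    by (rule integrable_dominated_convergence[OF meas' meas gamma_count_exp_integrable[OF b] lim bound])
  have "(\<lambda>K. integral\<^sup>L gamma_seq (?u K)) \<longlonglongrightarrow> (\<integral>\<omega>. (\<Prod>i<k. real (gamma_count b (D i) \<omega>)) \<partial>gamma_seq)"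
    by (rule integral_dominated_convergence[OF meas' meas gamma_count_exp_integrable[OF b] lim bound])
  then show "(\<lambda>K. \<Sum>n | n \<in> {..<k} \<rightarrow>\<^sub>E {..<K} \<and> inj_on n {..<k}. \<Prod>i<k. measure (gamma_law (n i)) (D i \<inter> {0..b}))
      \<longlonglongrightarrow> (\<integral>\<omega>. (\<Prod>i<k. real (gamma_count b (D i) \<omega>)) \<partial>gamma_seq)"
    using gamma_count_trunc_moments[of k "\<lambda>i. D i \<inter> {0..b}", OF _ disj'] D by simp
qed

lemma counted_points_gamma:
  assumes b: "b \<ge> 0"
  shows "counted_points gamma_seq (gamma_count b) (gamma_points b) b"
proof (intro counted_points.intro counted_points_axioms.intro)
  show "prob_space gamma_seq" by (rule gamma_seq.prob_space_axioms)
  show "gamma_count b D \<in> measurable gamma_seq (count_space UNIV)" if "D \<in> sets borel" for D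
    using that by (rule gamma_count_measurable)
  show "integrable gamma_seq (\<lambda>\<omega>. \<Prod>i<k. real (gamma_count b (D i) \<omega>))"
    if "\<And>i. i < k \<Longrightarrow> D i \<in> sets borel" "disjoint_family_on D {..<k}" for k and D :: "nat \<Rightarrow> real set"
    using that by (rule gamma_count_moments(1)[OF b])
  show "AE \<omega> in gamma_seq. finite (gamma_points b \<omega>) \<and> gamma_points b \<omega> \<subseteq> {0..b} \<and>
      (\<forall>D\<in>sets borel. gamma_count b D \<omega> = card (gamma_points b \<omega> \<inter> D))"
    using gamma_seq_AE_finite[OF b] gamma_seq_AE_inj
  proof eventually_elim
    case (elim \<omega>)
    have "gamma_count b D \<omega> = card (gamma_points b \<omega> \<inter> D)" for D
    proof -
      have "gamma_points b \<omega> \<inter> D = \<omega> ` {n. \<omega> n \<in> D \<inter> {0..b}}"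
        by (auto simp: gamma_points_def)
      then show ?thesis
        using elim(2) by (simp add: gamma_count_def card_image inj_on_subset)
    qed
    with elim show ?case by (auto simp: gamma_points_def)
  qed
qed

section \<open>The radial part of the Ginibre ensemble\<close>

definition radial_points :: "('w \<Rightarrow> complex set) \<Rightarrow> real \<Rightarrow> 'w \<Rightarrow> complex set" where
  "radial_points G b \<omega> = {z\<in>G \<omega>. (cmod z)\<^sup>2 \<le> b}"

lemma radial_points_eq: "radial_points G b \<omega> = G \<omega> \<inter> {z. (cmod z)\<^sup>2 \<in> {..b}}"
  by (auto simp: radial_points_def)

lemma simple_point_process_finite:
  assumes "simple_point_process M X" "precompact_borel D" "\<omega> \<in> space M"
  shows "finite (X \<omega> \<inter> D)"
proof (rule finite_subset)
  show "X \<omega> \<inter> D \<subseteq> X \<omega> \<inter> closure D" using closure_subset by blast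
  show "finite (X \<omega> \<inter> closure D)"
    using assms by (auto simp: simple_point_process_def precompact_borel_def)
qed

lemma ginibre_simple_point_process: "ginibre_ensemble M G \<Longrightarrow> simple_point_process M G"
  by (simp add: ginibre_ensemble_def determinantal_process_def)

lemma finite_radial_points:
  assumes "ginibre_ensemble M G" "\<omega> \<in> space M"
  shows "finite (radial_points G b \<omega>)"
  unfolding radial_points_eq
  by (rule simple_point_process_finite[OF ginibre_simple_point_process[OF assms(1)] precompact_radial assms(2), of _ b]) auto

lemma ginibre_card_measurable:
  assumes "ginibre_ensemble M G" "D \<in> sets borel" "D \<subseteq> {..b}"
  shows "(\<lambda>\<omega>. card (G \<omega> \<inter> {z. (cmod z)\<^sup>2 \<in> D})) \<in> measurable M (count_space UNIV)"
  using ginibre_simple_point_process[OF assms(1)] precompact_radial[OF assms(2,3)]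
  by (simp add: simple_point_process_def)

text \<open>The counts are taken in the plane, where measurability and moments are known; they count
  radii only where no two points share a modulus.\<close>

lemma counted_points_ginibre:
  assumes G: "ginibre_ensemble M G" and b: "b \<ge> 0"
  shows "counted_points M (\<lambda>D \<omega>. card (G \<omega> \<inter> {z. (cmod z)\<^sup>2 \<in> D \<inter> {0..b}}))
           (\<lambda>\<omega>. (\<lambda>z. (cmod z)\<^sup>2) ` radial_points G b \<omega>) b"
proof (intro counted_points.intro counted_points_axioms.intro)
  show "prob_space M"
    using ginibre_simple_point_process[OF G] by (simp add: simple_point_process_def)
  show "(\<lambda>\<omega>. card (G \<omega> \<inter> {z. (cmod z)\<^sup>2 \<in> D \<inter> {0..b}})) \<in> measurable M (count_space UNIV)" if "D \<in> sets borel" for D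
    using that by (intro ginibre_card_measurable[OF G, of _ b]) auto
  show "integrable M (\<lambda>\<omega>. \<Prod>i<k. real (card (G \<omega> \<inter> {z. (cmod z)\<^sup>2 \<in> D i \<inter> {0..b}})))"
    if "1 \<le> k" "\<And>i. i < k \<Longrightarrow> D i \<in> sets borel" "disjoint_family_on D {..<k}" for k and D :: "nat \<Rightarrow> real set"
    using that by (intro ginibre_radial_moments(1)[OF G, of k "\<lambda>i. D i \<inter> {0..b}" b]) (auto simp: disjoint_family_on_def)
  show "AE \<omega> in M. finite ((\<lambda>z. (cmod z)\<^sup>2) ` radial_points G b \<omega>) \<and> (\<lambda>z. (cmod z)\<^sup>2) ` radial_points G b \<omega> \<subseteq> {0..b} \<and>
      (\<forall>D\<in>sets borel. card (G \<omega> \<inter> {z. (cmod z)\<^sup>2 \<in> D \<inter> {0..b}}) = card ((\<lambda>z. (cmod z)\<^sup>2) ` radial_points G b \<omega> \<inter> D))"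
    using ginibre_AE_inj_on_modulus[OF G b] AE_space
  proof eventually_elim
    case (elim \<omega>)
    have "card (G \<omega> \<inter> {z. (cmod z)\<^sup>2 \<in> D \<inter> {0..b}}) = card ((\<lambda>z. (cmod z)\<^sup>2) ` radial_points G b \<omega> \<inter> D)" for D
    proof -
      have "(\<lambda>z. (cmod z)\<^sup>2) ` radial_points G b \<omega> \<inter> D = (\<lambda>z. (cmod z)\<^sup>2) ` (G \<omega> \<inter> {z. (cmod z)\<^sup>2 \<in> D \<inter> {0..b}})"
        by (auto simp: radial_points_def)
      moreover have "inj_on (\<lambda>z. (cmod z)\<^sup>2) (G \<omega> \<inter> {z. (cmod z)\<^sup>2 \<in> D \<inter> {0..b}})"
        by (rule inj_on_subset[OF elim(1)]) auto
      ultimately show ?thesis by (simp add: card_image)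
    qed
    with finite_radial_points[OF G elim(2)] show ?case
      by (auto simp: radial_points_def)
  qed
qed

text \<open>A point process supplies measurable counts only. The sum is a limit of sums over the
  levels of h rounded to mesh 1 / (m + 1), each of which is a finite combination of counts.\<close>

lemma ginibre_sum_measurable:
  fixes h :: "real \<Rightarrow> real"
  assumes G: "ginibre_ensemble M G" and h [measurable]: "h \<in> borel_measurable borel" and B: "\<And>x. \<bar>h x\<bar> \<le> B"
  shows "(\<lambda>\<omega>. \<Sum>z\<in>radial_points G b \<omega>. h ((cmod z)\<^sup>2)) \<in> borel_measurable M"
proof -
  let ?J = "\<lambda>m. {\<lfloor>real (Suc m) * - B\<rfloor>..\<lfloor>real (Suc m) * B\<rfloor>}"
  let ?C = "\<lambda>m j. {s. \<lfloor>real (Suc m) * h s\<rfloor> = j \<and> s \<le> b}"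
  let ?S = "\<lambda>m \<omega>. \<Sum>j\<in>?J m. real_of_int j / real (Suc m) * real (card (G \<omega> \<inter> {z. (cmod z)\<^sup>2 \<in> ?C m j}))"
  have S: "?S m \<in> borel_measurable M" for m
  proof (intro borel_measurable_sum borel_measurable_times borel_measurable_const)
    fix j
    have "(\<lambda>\<omega>. card (G \<omega> \<inter> {z. (cmod z)\<^sup>2 \<in> ?C m j})) \<in> measurable M (count_space UNIV)"
      by (rule ginibre_card_measurable[OF G, of _ b]) auto
    then show "(\<lambda>\<omega>. real (card (G \<omega> \<inter> {z. (cmod z)\<^sup>2 \<in> ?C m j}))) \<in> borel_measurable M"
      by (rule measurable_compose) auto
  qed
  have lim: "(\<lambda>m. ?S m \<omega>) \<longlonglongrightarrow> (\<Sum>z\<in>radial_points G b \<omega>. h ((cmod z)\<^sup>2))"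
    if \<omega>: "\<omega> \<in> space M" for \<omega>
  proof -
    have "?S m \<omega> = (\<Sum>z\<in>radial_points G b \<omega>. real_of_int \<lfloor>real (Suc m) * h ((cmod z)\<^sup>2)\<rfloor> / real (Suc m))" for m
    proof -
      have "(\<Sum>z\<in>radial_points G b \<omega>. real_of_int \<lfloor>real (Suc m) * h ((cmod z)\<^sup>2)\<rfloor> / real (Suc m))
          = (\<Sum>j\<in>?J m. \<Sum>z\<in>{z\<in>radial_points G b \<omega>. \<lfloor>real (Suc m) * h ((cmod z)\<^sup>2)\<rfloor> = j}.
                real_of_int \<lfloor>real (Suc m) * h ((cmod z)\<^sup>2)\<rfloor> / real (Suc m))"
      proof (rule sum.group[symmetric])
        show "(\<lambda>z. \<lfloor>real (Suc m) * h ((cmod z)\<^sup>2)\<rfloor>) ` radial_points G b \<omega> \<subseteq> ?J m"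
        proof (rule image_subsetI, unfold atLeastAtMost_iff, intro conjI floor_mono mult_left_mono)
          show "- B \<le> h ((cmod z)\<^sup>2)" "h ((cmod z)\<^sup>2) \<le> B" for z using B[of "(cmod z)\<^sup>2"] by auto
        qed auto
      qed (auto simp: finite_radial_points[OF G \<omega>])
      also have "\<dots> = ?S m \<omega>"
      proof (intro sum.cong refl)
        fix j
        have eq: "{z\<in>radial_points G b \<omega>. \<lfloor>real (Suc m) * h ((cmod z)\<^sup>2)\<rfloor> = j} = G \<omega> \<inter> {z. (cmod z)\<^sup>2 \<in> ?C m j}"
          by (auto simp: radial_points_def)
        have "(\<Sum>z\<in>{z\<in>radial_points G b \<omega>. \<lfloor>real (Suc m) * h ((cmod z)\<^sup>2)\<rfloor> = j}.
                real_of_int \<lfloor>real (Suc m) * h ((cmod z)\<^sup>2)\<rfloor> / real (Suc m))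
            = (\<Sum>z\<in>{z\<in>radial_points G b \<omega>. \<lfloor>real (Suc m) * h ((cmod z)\<^sup>2)\<rfloor> = j}. real_of_int j / real (Suc m))"
          by (intro sum.cong refl) auto
        also have "\<dots> = real_of_int j / real (Suc m) * real (card (G \<omega> \<inter> {z. (cmod z)\<^sup>2 \<in> ?C m j}))"
          unfolding eq by (simp del: of_nat_Suc)
        finally show "(\<Sum>z\<in>{z\<in>radial_points G b \<omega>. \<lfloor>real (Suc m) * h ((cmod z)\<^sup>2)\<rfloor> = j}.
                real_of_int \<lfloor>real (Suc m) * h ((cmod z)\<^sup>2)\<rfloor> / real (Suc m))
            = real_of_int j / real (Suc m) * real (card (G \<omega> \<inter> {z. (cmod z)\<^sup>2 \<in> ?C m j}))" .
      qed
      finally show ?thesis by simp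
    qed
    then show ?thesis
      by (simp only:) (intro tendsto_sum floor_grid_tendsto)
  qed
  show ?thesis
    by (rule borel_measurable_LIMSEQ_real[OF lim S])
qed

lemma gamma_points_sum_eventually:
  assumes "finite {n. \<omega> n \<in> {0..b}}" "inj \<omega>" "\<And>x. x \<notin> {0..b} \<Longrightarrow> h x = 0"
  shows "eventually (\<lambda>K. (\<Sum>n<K. h (\<omega> n)) = (\<Sum>x\<in>gamma_points b \<omega>. h x :: real)) sequentially"
proof -
  obtain K where K: "\<And>n. \<omega> n \<in> {0..b} \<Longrightarrow> n < K"
    using assms(1) by (metis (mono_tags) finite_nat_set_iff_bounded mem_Collect_eq)
  have "(\<Sum>n<L. h (\<omega> n)) = (\<Sum>x\<in>gamma_points b \<omega>. h x)" if "L \<ge> K" for L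
  proof -
    have "(\<Sum>x\<in>gamma_points b \<omega>. h x) = (\<Sum>n\<in>{n. \<omega> n \<in> {0..b}}. h (\<omega> n))"
      unfolding gamma_points_def using assms(2) by (subst sum.reindex) (auto intro: inj_on_subset)
    also have "\<dots> = (\<Sum>n<L. h (\<omega> n))"
      using K that assms(3) by (intro sum.mono_neutral_left) (auto dest: less_le_trans)
    finally show ?thesis ..
  qed
  then show ?thesis by (auto simp: eventually_sequentially)
qed

text \<open>This is Kostlan's theorem that the squared moduli are distributed as independent Gamma
  variables.\<close>

theorem ginibre_radial_char:
  fixes h :: "real \<Rightarrow> real"
  assumes G: "ginibre_ensemble M G" and b: "b \<ge> 0"
    and h [measurable]: "h \<in> borel_measurable borel" and B: "\<And>x. \<bar>h x\<bar> \<le> B"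
    and supp: "\<And>x. x \<notin> {0..b} \<Longrightarrow> h x = 0"
  shows "(\<lambda>K. \<Prod>n<K. \<integral>s. iexp (t * h s) \<partial>gamma_law n)
     \<longlonglongrightarrow> char (distr M borel (\<lambda>\<omega>. \<Sum>z\<in>radial_points G b \<omega>. h ((cmod z)\<^sup>2))) t"
proof -
  define S where "S = (\<lambda>\<omega>. \<Sum>z\<in>radial_points G b \<omega>. h ((cmod z)\<^sup>2))"
  \<comment> \<open>As a limit of measurable partial sums this is measurable everywhere; the sum
    over \<open>gamma_points\<close> is recovered almost surely, because the partial sums are
    eventually constant there.\<close>
  define S' where "S' = (\<lambda>\<omega>. lim (\<lambda>K. \<Sum>n<K. h (\<omega> n)))"
  have S'_meas [measurable]: "S' \<in> borel_measurable gamma_seq"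
    unfolding S'_def by (intro borel_measurable_lim_metric borel_measurable_sum measurable_compose[OF measurable_gamma_seq_component h])
  have ev: "AE \<omega> in gamma_seq. eventually (\<lambda>K. (\<Sum>n<K. h (\<omega> n)) = (\<Sum>x\<in>gamma_points b \<omega>. h x)) sequentially"
    using gamma_seq_AE_finite[OF b] gamma_seq_AE_inj
    by eventually_elim (rule gamma_points_sum_eventually[OF _ _ supp])
  then have S': "AE \<omega> in gamma_seq. S' \<omega> = (\<Sum>x\<in>gamma_points b \<omega>. h x)"
    by eventually_elim (auto simp: S'_def intro!: limI tendsto_eventually)
  have S_meas: "S \<in> borel_measurable M"
    unfolding S_def by (rule ginibre_sum_measurable[OF G h B])
  have S: "AE \<omega> in M. S \<omega> = (\<Sum>x\<in>(\<lambda>z. (cmod z)\<^sup>2) ` radial_points G b \<omega>. h x)"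
    using ginibre_AE_inj_on_modulus[OF G b]
    by eventually_elim (simp add: S_def sum.reindex radial_points_def)
  have "char (distr M borel S) t = char (distr gamma_seq borel S') t"
  proof (rule counted_points_char_eq[OF counted_points_ginibre[OF G b] counted_points_gamma[OF b]
        _ gamma_count_exp_integrable[OF b] h B S_meas S S'_meas S'])
    fix k and D :: "nat \<Rightarrow> real set"
    assume D: "1 \<le> k" "\<And>i. i < k \<Longrightarrow> D i \<in> sets borel" "disjoint_family_on D {..<k}"
    have "(\<lambda>K. \<Sum>n | n \<in> {..<k} \<rightarrow>\<^sub>E {..<K} \<and> inj_on n {..<k}. \<Prod>i<k. measure (gamma_law (n i)) (D i \<inter> {0..b}))
      \<longlonglongrightarrow> (\<integral>\<omega>. (\<Prod>i<k. real (card (G \<omega> \<inter> {z. (cmod z)\<^sup>2 \<in> D i \<inter> {0..b}}))) \<partial>M)"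
      using D by (intro ginibre_radial_moments(2)[OF G, where b = b]) (auto simp: disjoint_family_on_def)
    moreover note gamma_count_moments(2)[OF b D(2,3)]
    ultimately show "(\<integral>\<omega>. (\<Prod>i<k. real (card (G \<omega> \<inter> {z. (cmod z)\<^sup>2 \<in> D i \<inter> {0..b}}))) \<partial>M)
        = (\<integral>\<omega>. (\<Prod>i<k. real (gamma_count b (D i) \<omega>)) \<partial>gamma_seq)"
      by (rule LIMSEQ_unique)
  qed
  moreover have "(\<lambda>K. \<integral>\<omega>. iexp (t * (\<Sum>n<K. h (\<omega> n))) \<partial>gamma_seq) \<longlonglongrightarrow> (\<integral>\<omega>. iexp (t * S' \<omega>) \<partial>gamma_seq)"
  proof (rule integral_dominated_convergence[where w = "\<lambda>_. 1"])
    show "AE \<omega> in gamma_seq. (\<lambda>K. iexp (t * (\<Sum>n<K. h (\<omega> n)))) \<longlonglongrightarrow> iexp (t * S' \<omega>)"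
      using ev S'
    proof eventually_elim
      case (elim \<omega>)
      then show ?case
        by (intro tendsto_intros tendsto_eventually) simp
    qed
    show "(\<lambda>\<omega>. iexp (t * (\<Sum>n<K. h (\<omega> n)))) \<in> borel_measurable gamma_seq" for K
    proof -
      have [measurable]: "(\<lambda>\<omega>. h (\<omega> n)) \<in> borel_measurable gamma_seq" for n
        by (rule measurable_compose[OF measurable_gamma_seq_component h])
      show ?thesis by (rule measurable_compose[of "\<lambda>\<omega>. \<Sum>n<K. h (\<omega> n)" _ borel]) auto
    qed
  qed auto
  moreover have "(\<integral>\<omega>. iexp (t * (\<Sum>n<K. h (\<omega> n))) \<partial>gamma_seq) = (\<Prod>n<K. \<integral>s. iexp (t * h s) \<partial>gamma_law n)" for K
  proof -
    have int: "integrable (gamma_law n) (\<lambda>s. iexp (t * h s))" for n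
      by (rule gamma.M.integrable_const_bound[where B = 1], simp, subst measurable_cong_sets[OF sets_gamma_law refl], measurable)
    have "(\<integral>\<omega>. iexp (t * (\<Sum>n<K. h (\<omega> n))) \<partial>gamma_seq) = (\<integral>\<omega>. (\<Prod>n<K. iexp (t * h (\<omega> n))) \<partial>gamma_seq)"
      by (simp add: exp_sum[symmetric] sum_distrib_left)
    also have "\<dots> = (\<Prod>n<K. \<integral>s. iexp (t * h s) \<partial>gamma_law n)"
      unfolding gamma_seq_def by (rule gamma.integral_PiM_prod(2)[OF _ _ int]) auto
    finally show ?thesis .
  qed
  ultimately show ?thesis
    by (simp add: char_def integral_distr S_def[symmetric])
qed

section \<open>Characteristic functions of radial statistics\<close>

text \<open>The left side is the integral of the concave function ln y + 1 over [x - t, x + t],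
  which is at most the interval length times the value at the midpoint.\<close>

lemma x_ln_x_increment_le:
  fixes x t :: real
  assumes "0 \<le> t" "t < x"
  shows "(x + t) * ln (x + t) - (x - t) * ln (x - t) \<le> 2 * t * (ln x + 1)"
proof -
  define \<phi> where "\<phi> = (\<lambda>y. (x + y) * ln (x + y) - (x - y) * ln (x - y) - 2 * y * (ln x + 1))"
  have "\<phi> t \<le> \<phi> 0"
  proof (rule DERIV_nonpos_imp_nonincreasing[OF assms(1)])
    fix y assume y: "0 \<le> y" "y \<le> t"
    then have pos: "x + y > 0" "x - y > 0" "x > 0" using assms by auto
    have "DERIV \<phi> y :> (ln (x + y) + 1) + (ln (x - y) + 1) - 2 * (ln x + 1)"
    proof -
      have 1: "((\<lambda>y. (x + y) * ln (x + y)) has_real_derivative ln (x + y) + 1) (at y)"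
        using pos by (auto intro!: derivative_eq_intros)
      have 2: "((\<lambda>y. (x - y) * ln (x - y)) has_real_derivative - (ln (x - y) + 1)) (at y)"
        using pos by (auto intro!: derivative_eq_intros)
      show ?thesis
        unfolding \<phi>_def by (rule derivative_eq_intros 1 2 refl | simp)+
    qed
    moreover have "ln (x + y) + ln (x - y) \<le> ln x + ln x"
    proof -
      have "ln ((x + y) * (x - y)) \<le> ln (x * x)"
        using pos mult_pos_pos[OF pos(1,2)] by (subst ln_le_cancel_iff) (auto simp: algebra_simps)
      then show ?thesis using pos by (simp add: ln_mult)
    qed
    ultimately show "\<exists>d. DERIV \<phi> y :> d \<and> d \<le> 0" by force
  qed
  then show ?thesis by (simp add: \<phi>_def)
qed

text \<open>A Stirling bound from the midpoint rule: ln k is at least the integral of ln over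
  [k - 1/2, k + 1/2]. Centring at n + 1/2 matches the exponent of s in sqrt s * s^n.\<close>

lemma ln_fact_ge: "(real n + 1/2) * ln (real n + 1/2) - (real n + 1/2) \<le> ln (fact n)"
proof (induction n)
  case 0
  have "ln (1/2 :: real) \<le> 1" by (rule order_trans[of _ 0]) auto
  then show ?case by simp
next
  case (Suc n)
  have "(real n + 1 + 1/2) * ln (real n + 1 + 1/2) - (real n + 1 - 1/2) * ln (real n + 1 - 1/2)
      \<le> 2 * (1/2) * (ln (real n + 1) + 1)"
    by (rule x_ln_x_increment_le) auto
  moreover have "ln (fact (Suc n)) = ln (real n + 1) + ln (fact n)"
    by (simp add: ln_mult add.commute)
  ultimately show ?case using Suc by (simp add: algebra_simps)
qed

text \<open>For fixed \<open>n\<close> the function \<open>s \<mapsto> sqrt s * s ^ n * exp (- s)\<close> is maximal at \<open>s = n + 1/2\<close>.\<close>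

lemma erlang_density_le:
  assumes s: "s > 0"
  shows "erlang_density n 1 s \<le> 1 / sqrt s"
proof -
  define \<alpha> where "\<alpha> = real n + 1/2"
  have \<alpha>: "\<alpha> > 0" by (simp add: \<alpha>_def)
  \<comment> \<open>The tangent of ln at 1, which encodes that \<alpha> ln s - s is maximal at s =
    \<alpha>.\<close>
  have "ln (s / \<alpha>) \<le> s / \<alpha> - 1"
    using s \<alpha> by (intro ln_le_minus_one) auto
  then have "\<alpha> * ln (s / \<alpha>) \<le> \<alpha> * (s / \<alpha> - 1)"
    using \<alpha> by (intro mult_left_mono) auto
  then have "\<alpha> * ln s - s \<le> \<alpha> * ln \<alpha> - \<alpha>"
    using s \<alpha> by (simp add: ln_div algebra_simps)
  also have "\<dots> \<le> ln (fact n)"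
    unfolding \<alpha>_def by (rule ln_fact_ge)
  finally have "real n * ln s + ln (sqrt s) - s - ln (fact n) \<le> 0"
    using s by (simp add: \<alpha>_def ln_sqrt algebra_simps)
  moreover have "ln (erlang_density n 1 s * sqrt s) = real n * ln s + ln (sqrt s) - s - ln (fact n)"
    using s by (simp add: erlang_density_def ln_mult ln_div ln_realpow)
  moreover have pos: "erlang_density n 1 s * sqrt s > 0"
    using s by (simp add: erlang_density_def)
  ultimately have "ln (erlang_density n 1 s * sqrt s) \<le> 0"
    by linarith
  then have "erlang_density n 1 s * sqrt s \<le> 1"
    unfolding ln_le_zero_iff[OF pos] .
  then show ?thesis using s by (simp add: field_simps)
qed

section \<open>Integrals against the Gamma laws\<close>

lemma gamma_law_integral:
  assumes [measurable]: "h \<in> borel_measurable borel"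
  shows "integral\<^sup>L (gamma_law n) h = (\<integral>s. erlang_density n 1 s * h s \<partial>lborel)"
  unfolding gamma_law_def by (subst integral_density) auto

lemma gamma_law_integrable_bounded:
  fixes h :: "real \<Rightarrow> real"
  assumes h [measurable]: "h \<in> borel_measurable borel" and B: "\<And>s. \<bar>h s\<bar> \<le> B"
  shows "integrable (gamma_law n) h"
  using B by (intro gamma.M.integrable_const_bound[where B = B]) (auto simp: measurable_cong_sets[OF sets_gamma_law refl])

lemma lborel_integrable_bounded_support:
  fixes h :: "real \<Rightarrow> real"
  assumes h [measurable]: "h \<in> borel_measurable borel" and B: "\<And>s. \<bar>h s\<bar> \<le> B" and supp: "\<And>s. s \<notin> {u..v} \<Longrightarrow> h s = 0"
  shows "integrable lborel h"
proof (rule Bochner_Integration.integrable_bound)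
  show "integrable lborel (\<lambda>s. B * indicator {u..v} s)"
    by (intro integrable_mult_right integrable_real_indicator) (auto simp: emeasure_lborel_Icc_eq)
  have "0 \<le> B" using B[of 0] by linarith
  then show "AE s in lborel. norm (h s) \<le> norm (B * indicator {u..v} s)"
    using B supp by (intro AE_I2) (force simp: indicator_def)
qed simp

text \<open>On {u..v} every Gamma density is at most 1 / sqrt u, whatever n is. For the annuli v - u
  is of order R / a_R and sqrt u of order R.\<close>

lemma gamma_law_integral_le:
  fixes h :: "real \<Rightarrow> real"
  assumes uv: "0 < u" "u \<le> v"
    and h [measurable]: "h \<in> borel_measurable borel" and B: "\<And>s. \<bar>h s\<bar> \<le> B"
    and supp: "\<And>s. s \<notin> {u..v} \<Longrightarrow> h s = 0"
  shows "\<bar>integral\<^sup>L (gamma_law n) h\<bar> \<le> B * (v - u) / sqrt u"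
proof -
  have B0: "0 \<le> B" using B[of 0] by linarith
  have "\<bar>integral\<^sup>L (gamma_law n) h\<bar> \<le> (\<integral>s. \<bar>h s\<bar> \<partial>gamma_law n)"
    by (rule integral_abs_bound)
  also have "\<dots> = (\<integral>s. erlang_density n 1 s * \<bar>h s\<bar> \<partial>lborel)"
    by (rule gamma_law_integral) simp
  also have "\<dots> \<le> (\<integral>s. B / sqrt u * indicator {u..v} s \<partial>lborel)"
  proof (rule integral_mono')
    fix s
    show "erlang_density n 1 s * \<bar>h s\<bar> \<le> B / sqrt u * indicator {u..v} s"
    proof (cases "s \<in> {u..v}")
      case True
      then have "erlang_density n 1 s \<le> 1 / sqrt s" using uv by (intro erlang_density_le) auto
      also have "\<dots> \<le> 1 / sqrt u" using True uv by (intro divide_left_mono) auto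
      finally have "erlang_density n 1 s * \<bar>h s\<bar> \<le> 1 / sqrt u * B"
        using B uv by (intro mult_mono) auto
      with True show ?thesis by simp
    qed (simp add: supp)
  qed (use B0 uv in auto)
  also have "\<dots> = B * (v - u) / sqrt u"
    using uv by simp
  finally show ?thesis .
qed

text \<open>Sum and integral may be exchanged because the absolute integrals are at most B times the
  masses of {0..v}, which have a finite sum.\<close>

lemma gamma_law_integral_sums:
  fixes h :: "real \<Rightarrow> real"
  assumes uv: "0 \<le> u" "u \<le> v"
    and h [measurable]: "h \<in> borel_measurable borel" and B: "\<And>s. \<bar>h s\<bar> \<le> B"
    and supp: "\<And>s. s \<notin> {u..v} \<Longrightarrow> h s = 0"
  shows "(\<lambda>n. integral\<^sup>L (gamma_law n) h) sums integral\<^sup>L lborel h"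
proof -
  let ?f = "\<lambda>n s. erlang_density n 1 s * h s"
  have B0: "0 \<le> B" using B[of 0] by linarith
  have norm_f: "norm (?f n s) = erlang_density n 1 s * \<bar>h s\<bar>" for n s
    by (simp add: abs_mult)
  have int: "integrable lborel (?f n)" for n
    using gamma_law_integrable_bounded[OF h B, of n] unfolding gamma_law_def
    by (subst (asm) integrable_density) auto
  have "(\<lambda>n. integral\<^sup>L lborel (?f n)) sums (\<integral>s. (\<Sum>n. ?f n s) \<partial>lborel)"
  proof (rule sums_integral[OF int])
    show "AE s in lborel. summable (\<lambda>n. norm (?f n s))"
      unfolding norm_f by (intro AE_I2 summable_mult2 sums_summable[OF erlang_density_sums])
    show "summable (\<lambda>n. \<integral>s. norm (?f n s) \<partial>lborel)"
    proof (rule summable_comparison_test')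
      show "summable (\<lambda>n. B * measure (gamma_law n) {0..v})"
        using measure_gamma_law_sums[of v] uv by (intro summable_mult sums_summable) auto
      fix n
      have "norm (\<integral>s. norm (?f n s) \<partial>lborel) = (\<integral>s. \<bar>h s\<bar> \<partial>gamma_law n)"
        unfolding norm_f by (subst gamma_law_integral) (auto intro!: integral_nonneg_AE)
      also have "\<dots> \<le> (\<integral>s. B * indicator {0..v} s \<partial>gamma_law n)"
        using B supp uv B0
        by (intro integral_mono' integrable_mult_right integrable_real_indicator)
           (force simp: indicator_def less_top[symmetric])+
      also have "\<dots> = B * measure (gamma_law n) {0..v}"
        by simp
      finally show "norm (\<integral>s. norm (?f n s) \<partial>lborel) \<le> B * measure (gamma_law n) {0..v}" .
    qed
  qed
  also have "(\<lambda>s. \<Sum>n. ?f n s) = h"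
  proof
    fix s
    have "(\<lambda>n. ?f n s) sums (indicator {0..} s * h s)"
      by (intro sums_mult2 erlang_density_sums)
    moreover have "indicator {0..} s * h s = h s"
      using supp[of s] uv by (auto simp: indicator_def)
    ultimately show "(\<Sum>n. ?f n s) = h s" by (simp add: sums_iff)
  qed
  finally show ?thesis by (simp add: gamma_law_integral)
qed

section \<open>Second order expansion of characteristic functions\<close>

lemma exp_minus_approx:
  fixes x :: real
  assumes "0 \<le> x"
  shows "\<bar>exp (- x) - (1 - x)\<bar> \<le> x\<^sup>2 / 2"
proof -
  define \<phi> where "\<phi> = (\<lambda>y::real. exp (- y) - (1 - y) - y\<^sup>2 / 2)"
  have "\<phi> x \<le> \<phi> 0"
  proof (rule DERIV_nonpos_imp_nonincreasing[OF assms])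
    fix y :: real
    have "DERIV \<phi> y :> - exp (- y) + 1 - y"
      unfolding \<phi>_def by (auto intro!: derivative_eq_intros)
    moreover have "1 - y \<le> exp (- y)" using exp_ge_add_one_self[of "- y"] by simp
    ultimately show "\<exists>d. DERIV \<phi> y :> d \<and> d \<le> 0" by force
  qed
  moreover have "1 - x \<le> exp (- x)" using exp_ge_add_one_self[of "- x"] by simp
  ultimately show ?thesis by (simp add: \<phi>_def)
qed

text \<open>Both terms are compared with 1 - t^2 W / 2. The centered variable is at most 2 B, so its
  third absolute moment is at most 2 B W; the Gaussian error is quadratic in W. Keeping W as a
  factor of the bound makes the errors of all summands add up to a multiple of the total
  variance.\<close>

lemma (in prob_space) char_centered_bound:
  fixes X :: "'a \<Rightarrow> real"
  assumes [measurable]: "X \<in> borel_measurable M" and B: "\<And>x. \<bar>X x\<bar> \<le> B"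
    and W: "W = expectation (\<lambda>x. (X x)\<^sup>2) - (expectation X)\<^sup>2"
  shows "cmod (expectation (\<lambda>x. iexp (t * (X x - expectation X))) - of_real (exp (- (t\<^sup>2 * W / 2))))
      \<le> (\<bar>t\<bar> ^ 3 * B + t ^ 4 * B\<^sup>2) * W"
    and "0 \<le> W"
proof -
  define m where "m = expectation X"
  define Y where "Y = (\<lambda>x. X x - m)"
  have B0: "0 \<le> B" using B[of undefined] by linarith
  have intX: "integrable M X"
    using B by (intro integrable_const_bound[where B = B]) auto
  have X2: "(X x)\<^sup>2 \<le> B\<^sup>2" for x
    using B[of x] by (simp add: abs_le_square_iff[symmetric])
  have intX2: "integrable M (\<lambda>x. (X x)\<^sup>2)"
    using X2 by (intro integrable_const_bound[where B = "B\<^sup>2"]) auto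
  have m: "\<bar>m\<bar> \<le> B"
  proof -
    have "\<bar>m\<bar> \<le> expectation (\<lambda>x. \<bar>X x\<bar>)" unfolding m_def by (rule integral_abs_bound)
    also have "\<dots> \<le> expectation (\<lambda>_. B)" using B B0 intX by (intro integral_mono) auto
    finally show ?thesis by (simp add: prob_space)
  qed
  have Y: "\<bar>Y x\<bar> \<le> 2 * B" for x
    using B[of x] m unfolding Y_def by linarith
  have [measurable]: "Y \<in> borel_measurable M" unfolding Y_def by simp
  have intY: "integrable M Y" unfolding Y_def using intX by simp
  have Y2: "(Y x)\<^sup>2 = (X x)\<^sup>2 - 2 * m * X x + m\<^sup>2" for x
    by (simp add: Y_def power2_diff)
  have intY2: "integrable M (\<lambda>x. (Y x)\<^sup>2)"
    unfolding Y2 using intX intX2 by simp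
  have EY: "expectation Y = 0"
    unfolding Y_def using intX by (simp add: m_def prob_space)
  have EY2: "expectation (\<lambda>x. (Y x)\<^sup>2) = W"
    unfolding Y2 W using intX intX2 by (simp add: m_def[symmetric] prob_space power2_eq_square)
  have "0 \<le> expectation (\<lambda>x. (Y x)\<^sup>2)" by (rule integral_nonneg_AE) simp
  with EY2 show W0: "0 \<le> W" by simp
  have "cmod (char (distr M borel Y) t - of_real (1 - t\<^sup>2 * W / 2)) \<le> (t\<^sup>2 / 6) * expectation (\<lambda>x. min (6 * (Y x)\<^sup>2) (\<bar>t\<bar> * \<bar>Y x\<bar> ^ 3))"
    by (rule char_approx3') (auto simp: intY intY2 EY EY2)
  also have "\<dots> \<le> (t\<^sup>2 / 6) * expectation (\<lambda>x. \<bar>t\<bar> * (2 * B) * (Y x)\<^sup>2)"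
  proof (intro mult_left_mono integral_mono')
    fix x
    have "\<bar>Y x\<bar> ^ 3 = \<bar>Y x\<bar> * (Y x)\<^sup>2" by (simp add: power3_eq_cube power2_eq_square)
    also have "\<dots> \<le> 2 * B * (Y x)\<^sup>2" using Y by (intro mult_right_mono) auto
    finally have "\<bar>t\<bar> * \<bar>Y x\<bar> ^ 3 \<le> \<bar>t\<bar> * (2 * B * (Y x)\<^sup>2)" by (intro mult_left_mono) auto
    then show "min (6 * (Y x)\<^sup>2) (\<bar>t\<bar> * \<bar>Y x\<bar> ^ 3) \<le> \<bar>t\<bar> * (2 * B) * (Y x)\<^sup>2"
      by (simp add: mult.assoc)
  qed (use intY2 B0 in auto)
  also have "\<dots> = (t\<^sup>2 / 6) * (\<bar>t\<bar> * (2 * B) * W)"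
    by (simp add: EY2)
  also have "\<dots> = \<bar>t\<bar> ^ 3 * B * W / 3"
    by (cases "t \<ge> 0") (simp_all add: power2_eq_square power3_eq_cube)
  also have "\<dots> \<le> \<bar>t\<bar> ^ 3 * B * W"
    using B0 W0 by simp
  finally have 1: "cmod (char (distr M borel Y) t - of_real (1 - t\<^sup>2 * W / 2)) \<le> \<bar>t\<bar> ^ 3 * B * W" .
  \<comment> \<open>Turns the quadratic error in W into B^2 times W.\<close>
  have WB: "W \<le> B\<^sup>2"
  proof -
    have "W \<le> expectation (\<lambda>x. (X x)\<^sup>2)" unfolding W by simp
    also have "\<dots> \<le> expectation (\<lambda>_. B\<^sup>2)" using X2 intX2 by (intro integral_mono) auto
    finally show ?thesis by (simp add: prob_space)
  qed
  have "\<bar>exp (- (t\<^sup>2 * W / 2)) - (1 - t\<^sup>2 * W / 2)\<bar> \<le> (t\<^sup>2 * W / 2)\<^sup>2 / 2"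
    using W0 by (intro exp_minus_approx) auto
  also have "\<dots> = t ^ 4 * (W * W) / 8"
    by (simp add: power2_eq_square power4_eq_xxxx)
  also have "\<dots> \<le> t ^ 4 * (B\<^sup>2 * W)"
  proof -
    have "t ^ 4 * (W * W) \<le> t ^ 4 * (B\<^sup>2 * W)"
      using WB W0 by (intro mult_left_mono mult_right_mono) auto
    moreover have "0 \<le> t ^ 4 * (W * W)" by simp
    ultimately show ?thesis by linarith
  qed
  finally have 2: "\<bar>exp (- (t\<^sup>2 * W / 2)) - (1 - t\<^sup>2 * W / 2)\<bar> \<le> t ^ 4 * B\<^sup>2 * W"
    by (simp add: mult.assoc)
  have ch: "char (distr M borel Y) t = expectation (\<lambda>x. iexp (t * (X x - expectation X)))"
    by (simp add: char_def integral_distr Y_def m_def)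
  have "cmod (char (distr M borel Y) t - of_real (exp (- (t\<^sup>2 * W / 2))))
      = cmod ((char (distr M borel Y) t - of_real (1 - t\<^sup>2 * W / 2)) - of_real (exp (- (t\<^sup>2 * W / 2)) - (1 - t\<^sup>2 * W / 2)))"
  proof -
    have "c - e = (c - d) - (e - d)" for c d e :: complex by simp
    then show ?thesis unfolding of_real_diff[of "exp _"] by metis
  qed
  also have "\<dots> \<le> cmod (char (distr M borel Y) t - of_real (1 - t\<^sup>2 * W / 2)) + \<bar>exp (- (t\<^sup>2 * W / 2)) - (1 - t\<^sup>2 * W / 2)\<bar>"
    by (rule order_trans[OF norm_triangle_ineq4]) (simp only: norm_of_real order_refl)
  finally show "cmod (expectation (\<lambda>x. iexp (t * (X x - expectation X))) - of_real (exp (- (t\<^sup>2 * W / 2))))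
      \<le> (\<bar>t\<bar> ^ 3 * B + t ^ 4 * B\<^sup>2) * W"
    using 1 2 unfolding ch by (simp add: distrib_right)
qed

text \<open>\<open>Q\<close> is the sum of the squared means, by which the variance falls short of the second moment.\<close>

theorem ginibre_char_bound:
  fixes h :: "real \<Rightarrow> real"
  assumes G: "ginibre_ensemble M G" and uv: "0 < u" "u \<le> v"
    and h [measurable]: "h \<in> borel_measurable borel" and B: "\<And>x. \<bar>h x\<bar> \<le> B"
    and supp: "\<And>x. x \<notin> {u..v} \<Longrightarrow> h x = 0"
  obtains Q where "0 \<le> Q" "Q \<le> (B * (v - u))\<^sup>2 / sqrt u"
    and "\<And>t. cmod (char (distr M borel (\<lambda>\<omega>. \<Sum>z\<in>radial_points G v \<omega>. h ((cmod z)\<^sup>2))) t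
            - iexp (t * integral\<^sup>L lborel h) * of_real (exp (- (t\<^sup>2 * ((\<integral>s. (h s)\<^sup>2 \<partial>lborel) - Q) / 2))))
          \<le> (\<bar>t\<bar> ^ 3 * B + t ^ 4 * B\<^sup>2) * (\<integral>s. (h s)\<^sup>2 \<partial>lborel)"
proof -
  define m where "m = (\<lambda>n. integral\<^sup>L (gamma_law n) h)"
  define v2 where "v2 = (\<lambda>n. \<integral>s. (h s)\<^sup>2 \<partial>gamma_law n)"
  define V where "V = (\<integral>s. (h s)\<^sup>2 \<partial>lborel)"
  have B0: "0 \<le> B" using B[of 0] by linarith
  have h2: "\<bar>(h s)\<^sup>2\<bar> \<le> B\<^sup>2" for s
    using B[of s] by (simp add: abs_le_square_iff[symmetric])
  have msum: "m sums integral\<^sup>L lborel h"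
    unfolding m_def using uv by (intro gamma_law_integral_sums[OF _ _ h B supp]) auto
  have vsum: "v2 sums V"
    unfolding v2_def V_def using uv supp
    by (intro gamma_law_integral_sums[OF _ _ _ h2, of u v]) auto
  have abssum: "(\<lambda>n. \<integral>s. \<bar>h s\<bar> \<partial>gamma_law n) sums (\<integral>s. \<bar>h s\<bar> \<partial>lborel)"
    using uv supp B by (intro gamma_law_integral_sums[of u v _ B]) auto
  have L1: "(\<integral>s. \<bar>h s\<bar> \<partial>lborel) \<le> B * (v - u)"
  proof -
    have "(\<integral>s. \<bar>h s\<bar> \<partial>lborel) \<le> (\<integral>s. B * indicator {u..v} s \<partial>lborel)"
    proof (rule integral_mono')
      show "integrable lborel (\<lambda>s. B * indicat_real {u..v} s)"
        by (intro integrable_mult_right integrable_real_indicator) (auto simp: emeasure_lborel_Icc_eq)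
      show "\<bar>h s\<bar> \<le> B * indicator {u..v} s" for s
        using B[of s] supp[of s] by (cases "s \<in> {u..v}") auto
    qed (use B0 in auto)
    then show ?thesis using uv by simp
  qed
  \<comment> \<open>A common bound for all means. One factor of each squared mean is bounded by
    \<open>C\<close>, the other by the first absolute moment, and those moments sum to the L1 norm
    of h.\<close>
  define C where "C = B * (v - u) / sqrt u"
  have mC: "(m n)\<^sup>2 \<le> C * (\<integral>s. \<bar>h s\<bar> \<partial>gamma_law n)" for n
  proof -
    have "\<bar>m n\<bar> \<le> C" unfolding m_def C_def by (rule gamma_law_integral_le[OF uv h B supp])
    moreover have "\<bar>m n\<bar> \<le> (\<integral>s. \<bar>h s\<bar> \<partial>gamma_law n)" unfolding m_def by (rule integral_abs_bound)
    ultimately have "\<bar>m n\<bar> * \<bar>m n\<bar> \<le> C * (\<integral>s. \<bar>h s\<bar> \<partial>gamma_law n)"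
      by (intro mult_mono) auto
    then show ?thesis by (simp add: power2_eq_square)
  qed
  have Csum: "(\<lambda>n. C * (\<integral>s. \<bar>h s\<bar> \<partial>gamma_law n)) sums (C * (\<integral>s. \<bar>h s\<bar> \<partial>lborel))"
    by (intro sums_mult abssum)
  define Q where "Q = (\<Sum>n. (m n)\<^sup>2)"
  have m2summable: "summable (\<lambda>n. (m n)\<^sup>2)"
    by (rule summable_comparison_test'[OF sums_summable[OF Csum]]) (use mC in auto)
  then have Qsum: "(\<lambda>n. (m n)\<^sup>2) sums Q" unfolding Q_def by (rule summable_sums)
  have Q0: "0 \<le> Q" unfolding Q_def by (intro suminf_nonneg m2summable) auto
  have "Q \<le> C * (\<integral>s. \<bar>h s\<bar> \<partial>lborel)"
    by (rule sums_le[OF mC Qsum Csum])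
  also have "\<dots> \<le> C * (B * (v - u))"
    using L1 uv B0 by (intro mult_left_mono) (auto simp: C_def)
  also have "\<dots> = (B * (v - u))\<^sup>2 / sqrt u"
    by (simp add: C_def power2_eq_square)
  finally have Q1: "Q \<le> (B * (v - u))\<^sup>2 / sqrt u" .
  define \<sigma> where "\<sigma> = (\<lambda>n. v2 n - (m n)\<^sup>2)"
  have \<sigma>sum: "\<sigma> sums (V - Q)" unfolding \<sigma>_def by (intro sums_diff vsum Qsum)
  have bound: "cmod (char (distr M borel (\<lambda>\<omega>. \<Sum>z\<in>radial_points G v \<omega>. h ((cmod z)\<^sup>2))) t
            - iexp (t * integral\<^sup>L lborel h) * of_real (exp (- (t\<^sup>2 * (V - Q) / 2))))
          \<le> (\<bar>t\<bar> ^ 3 * B + t ^ 4 * B\<^sup>2) * V" for t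
  proof -
    define D where "D = \<bar>t\<bar> ^ 3 * B + t ^ 4 * B\<^sup>2"
    have D0: "0 \<le> D" using B0 by (simp add: D_def)
    \<comment> \<open>Centering each summand removes the linear term from its expansion; the means
      are restored at the end as a phase.\<close>
    define z where "z = (\<lambda>n. \<integral>s. iexp (t * (h s - m n)) \<partial>gamma_law n)"
    have hm: "h \<in> borel_measurable (gamma_law n)" for n
      by (simp add: measurable_cong_sets[OF sets_gamma_law refl])
    have zb: "cmod (z n - of_real (exp (- (t\<^sup>2 * \<sigma> n / 2)))) \<le> D * \<sigma> n" and \<sigma>0: "0 \<le> \<sigma> n" for n
      using gamma.M.char_centered_bound(1)[OF hm[of n] B, where W = "\<sigma> n" and t = t]
        gamma.M.char_centered_bound(2)[OF hm[of n] B, where W = "\<sigma> n"]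
      by (auto simp: z_def m_def \<sigma>_def v2_def D_def)
    have z1: "cmod (z n) \<le> 1" for n
    proof -
      have "cmod (z n) \<le> (\<integral>s. cmod (iexp (t * (h s - m n))) \<partial>gamma_law n)"
        unfolding z_def by (rule integral_norm_bound)
      then show ?thesis using gamma.M.prob_space[of n] by simp
    qed
    have "cmod ((\<Prod>n<K. z n) - (\<Prod>n<K. of_real (exp (- (t\<^sup>2 * \<sigma> n / 2))))) \<le> D * V" for K
    proof -
      have "cmod ((\<Prod>n<K. z n) - (\<Prod>n<K. of_real (exp (- (t\<^sup>2 * \<sigma> n / 2)))))
          \<le> (\<Sum>n<K. cmod (z n - of_real (exp (- (t\<^sup>2 * \<sigma> n / 2)))))"
        using \<sigma>0 by (intro norm_prod_diff z1) auto
      also have "\<dots> \<le> (\<Sum>n<K. D * \<sigma> n)" by (intro sum_mono zb)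
      also have "\<dots> = D * (\<Sum>n<K. \<sigma> n)" by (simp add: sum_distrib_left)
      also have "\<dots> \<le> D * (V - Q)"
        using sum_le_suminf[of \<sigma> "{..<K}"] \<sigma>sum \<sigma>0 D0
        by (intro mult_left_mono) (auto simp: sums_iff)
      also have "\<dots> \<le> D * V" using Q0 D0 by (intro mult_left_mono) auto
      finally show ?thesis .
    qed
    moreover have "(\<lambda>K. (\<Prod>n<K. z n) - (\<Prod>n<K. of_real (exp (- (t\<^sup>2 * \<sigma> n / 2)))))
      \<longlonglongrightarrow> char (distr M borel (\<lambda>\<omega>. \<Sum>z\<in>radial_points G v \<omega>. h ((cmod z)\<^sup>2))) t * iexp (- (t * integral\<^sup>L lborel h))
         - of_real (exp (- (t\<^sup>2 * (V - Q) / 2)))"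
    proof (intro tendsto_diff)
      have "z n = (\<integral>s. iexp (t * h s) \<partial>gamma_law n) * iexp (- (t * m n))" for n
      proof -
        have "z n = (\<integral>s. iexp (t * h s) * iexp (- (t * m n)) \<partial>gamma_law n)"
          unfolding z_def by (simp add: exp_add[symmetric] algebra_simps)
        then show ?thesis by (simp only: Bochner_Integration.integral_mult_left_zero)
      qed
      then have "(\<Prod>n<K. z n) = (\<Prod>n<K. \<integral>s. iexp (t * h s) \<partial>gamma_law n) * iexp (- (t * (\<Sum>n<K. m n)))" for K
        by (simp add: prod.distrib exp_sum[symmetric] sum_distrib_left sum_negf)
      moreover have "(\<lambda>K. (\<Prod>n<K. \<integral>s. iexp (t * h s) \<partial>gamma_law n) * iexp (- (t * (\<Sum>n<K. m n))))
        \<longlonglongrightarrow> char (distr M borel (\<lambda>\<omega>. \<Sum>z\<in>radial_points G v \<omega>. h ((cmod z)\<^sup>2))) t * iexp (- (t * integral\<^sup>L lborel h))"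
        using msum uv supp unfolding sums_def
        by (intro tendsto_intros ginibre_radial_char[OF G _ h B]) auto
      ultimately show "(\<lambda>K. \<Prod>n<K. z n) \<longlonglongrightarrow> char (distr M borel (\<lambda>\<omega>. \<Sum>z\<in>radial_points G v \<omega>. h ((cmod z)\<^sup>2))) t * iexp (- (t * integral\<^sup>L lborel h))"
        by simp
      have "(\<Prod>n<K. complex_of_real (exp (- (t\<^sup>2 * \<sigma> n / 2)))) = of_real (exp (- (t\<^sup>2 * (\<Sum>n<K. \<sigma> n) / 2)))" for K
        unfolding of_real_prod[symmetric]
        by (simp only: exp_sum[symmetric] finite_lessThan sum_negf sum_divide_distrib[symmetric] sum_distrib_left[symmetric])
      then show "(\<lambda>K. \<Prod>n<K. complex_of_real (exp (- (t\<^sup>2 * \<sigma> n / 2)))) \<longlonglongrightarrow> of_real (exp (- (t\<^sup>2 * (V - Q) / 2)))"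
        using \<sigma>sum unfolding sums_def by (simp only:) (intro tendsto_intros; simp)
    qed
    ultimately have "cmod (char (distr M borel (\<lambda>\<omega>. \<Sum>z\<in>radial_points G v \<omega>. h ((cmod z)\<^sup>2))) t * iexp (- (t * integral\<^sup>L lborel h))
         - of_real (exp (- (t\<^sup>2 * (V - Q) / 2)))) \<le> D * V" (is "cmod (?c * _ - ?e) \<le> _")
      by (intro LIMSEQ_le_const2[OF tendsto_norm]) auto
    \<comment> \<open>A phase has modulus 1, so multiplying by it moves the bound from the centered
      to the uncentered statistic.\<close>
    moreover have "?c - iexp (t * integral\<^sup>L lborel h) * ?e
        = iexp (t * integral\<^sup>L lborel h) * (?c * iexp (- (t * integral\<^sup>L lborel h)) - ?e)"
    proof -
      have "iexp (t * integral\<^sup>L lborel h) * iexp (- (t * integral\<^sup>L lborel h)) = 1"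
        by (simp add: exp_add[symmetric])
      then show ?thesis by (simp add: right_diff_distrib mult.left_commute mult.assoc[symmetric])
    qed
    ultimately show ?thesis
      unfolding D_def by (simp only: norm_mult norm_exp_i_times mult_1_left)
  qed
  show ?thesis
    by (rule that[OF Q0 Q1]) (use bound in \<open>simp only: V_def\<close>)
qed

section \<open>The central limit theorem\<close>

lemma gaussian_law_real_distribution: "0 \<le> V \<Longrightarrow> real_distribution (gaussian_law V)"
  by (auto simp: gaussian_law_def real_distribution_def real_distribution_axioms_def
      intro!: prob_space_return prob_space_normal_density)

text \<open>One formula covers the Dirac mass as well, so a test function that vanishes almost
  everywhere requires no separate limit argument.\<close>

lemma char_gaussian_law:
  assumes "0 \<le> V"
  shows "char (gaussian_law V) t = of_real (exp (- (t\<^sup>2 * V / 2)))"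
proof (cases "V = 0")
  case True
  then show ?thesis by (simp add: gaussian_law_def char_def integral_return)
next
  case False
  define \<sigma> where "\<sigma> = sqrt V"
  have \<sigma>: "\<sigma> > 0" "\<sigma>\<^sup>2 = V" using assms False by (simp_all add: \<sigma>_def)
  let ?N = "density lborel (\<lambda>x. ennreal (std_normal_density x))"
  interpret N: prob_space ?N by (rule prob_space_normal_density) simp
  have "distributed ?N lborel (\<lambda>x. x) (\<lambda>x. ennreal (normal_density 0 1 x))"
    by (auto simp: distributed_def distr_id2)
  then have "distributed ?N lborel (\<lambda>x. 0 + \<sigma> * x) (\<lambda>x. ennreal (normal_density (0 + \<sigma> * 0) (\<bar>\<sigma>\<bar> * 1) x))"
    using \<sigma> by (intro N.normal_density_affine) auto
  then have "gaussian_law V = distr ?N lborel (\<lambda>x. \<sigma> * x)"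
    using False \<sigma> by (simp add: gaussian_law_def distributed_def \<sigma>_def)
  then have "char (gaussian_law V) t = (\<integral>x. iexp (t * (\<sigma> * x)) \<partial>?N)"
    by (simp add: char_def integral_distr)
  also have "\<dots> = char std_normal_distribution (t * \<sigma>)"
    by (simp add: char_def mult.assoc)
  also have "\<dots> = of_real (exp (- (t\<^sup>2 * V / 2)))"
    by (simp add: char_std_normal_distribution power_mult_distrib \<sigma>)
  finally show ?thesis .
qed

section \<open>Change of variables on the annulus\<close>

lemma annulus_support:
  fixes F :: "real \<Rightarrow> real"
  assumes R: "0 < a" "0 < L" "L / a < R" and supp: "\<And>x. x \<notin> {- L..L} \<Longrightarrow> F x = 0"
    and s: "s \<notin> {(R - L / a)\<^sup>2..(R + L / a)\<^sup>2}"
  shows "F (a * (sqrt s - R)) = 0"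
proof (rule supp, rule notI)
  assume "a * (sqrt s - R) \<in> {- L..L}"
  then have "\<bar>a * (sqrt s - R)\<bar> \<le> L" by auto
  then have "\<bar>sqrt s - R\<bar> \<le> L / a"
    using R by (simp add: abs_mult pos_le_divide_eq mult.commute)
  then have 1: "R - L / a \<le> sqrt s" "sqrt s \<le> R + L / a" by auto
  \<comment> \<open>The total \<open>sqrt\<close> is negative at negative arguments; positivity of
    the inner radius excludes such s.\<close>
  then have "0 < sqrt s" using R by linarith
  then have "0 \<le> s" by simp
  then have "s = (sqrt s)\<^sup>2" by simp
  with 1 R \<open>0 \<le> s\<close> have "s \<in> {(R - L / a)\<^sup>2..(R + L / a)\<^sup>2}"
    using power_mono[OF 1(1), of 2] power_mono[OF 1(2), of 2] by auto
  with s show False ..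
qed

text \<open>Substitute s = (R + x / a)^2. The Jacobian 2 (R + x / a) / a is affine in x, hence the
  identity is exact with just two terms, the second of which is a correction of lower order.\<close>

lemma annulus_integral:
  fixes F :: "real \<Rightarrow> real"
  assumes R: "0 < a" "0 < L" "L / a < R" and supp: "\<And>x. x \<notin> {- L..L} \<Longrightarrow> F x = 0"
    and F [measurable]: "F \<in> borel_measurable borel" and B: "\<And>x. \<bar>F x\<bar> \<le> B"
  shows "(\<integral>s. F (a * (sqrt s - R)) \<partial>lborel)
      = 2 * R / a * (\<integral>x. F x \<partial>lborel) + 2 / a\<^sup>2 * (\<integral>x. x * F x \<partial>lborel)"
proof -
  define g where "g = (\<lambda>x. (R + x / a)\<^sup>2)"
  define k where "k = (\<lambda>s. F (a * (sqrt s - R)))"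
  have ends: "g (- L) = (R - L / a)\<^sup>2" "g L = (R + L / a)\<^sup>2" by (simp_all add: g_def)
  have k_supp: "k s = 0" if "s \<notin> {g (- L)..g L}" for s
    unfolding k_def by (rule annulus_support[OF R supp]) (use that ends in auto)
  have [measurable]: "k \<in> borel_measurable borel" unfolding k_def by measurable
  have k_int: "integrable lborel k"
    by (rule lborel_integrable_bounded_support[of k B, OF _ _ k_supp]) (auto simp: k_def B)
  have B0: "0 \<le> B" using B[of 0] by linarith
  have F_int: "integrable lborel F"
    by (rule lborel_integrable_bounded_support[OF F B supp])
  have xF_int: "integrable lborel (\<lambda>x. x * F x)"
  proof (rule lborel_integrable_bounded_support[where B = "L * B"])
    show "\<bar>x * F x\<bar> \<le> L * B" for x
    proof (cases "x \<in> {- L..L}")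
      case True
      then show ?thesis using B[of x] R unfolding abs_mult by (intro mult_mono) auto
    next
      case False
      then show ?thesis using supp[of x] R B0 by simp
    qed
    show "x * F x = 0" if "x \<notin> {- L..L}" for x using supp[OF that] by simp
  qed simp
  have nn: "0 \<le> R + x / a" if "x \<in> {- L..L}" for x
  proof -
    have "- L / a \<le> x / a" using that R by (intro divide_right_mono) auto
    then show ?thesis using R by simp
  qed
  have "(\<integral>s. k s \<partial>lborel) = (\<integral>s. k s * indicator {g (- L)..g L} s \<partial>lborel)"
    by (intro Bochner_Integration.integral_cong refl) (use k_supp in \<open>auto simp: indicator_def\<close>)
  also have "\<dots> = (\<integral>x. k (g x) * (2 * (R + x / a) / a) * indicator {- L..L} x \<partial>lborel)"
  proof (rule integral_substitution)
    show "set_integrable lborel {g (- L)..g L} k"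
      unfolding set_integrable_def using k_int by (intro integrable_mult_indicator) auto
    show "(g has_real_derivative 2 * (R + x / a) / a) (at x)" for x
      unfolding g_def using R by (auto intro!: derivative_eq_intros simp: field_simps power2_eq_square power4_eq_xxxx)
    show "continuous_on {- L..L} (\<lambda>x. 2 * (R + x / a) / a)"
      using R by (intro continuous_intros) auto
    show "0 \<le> 2 * (R + x / a) / a" if "x \<in> {- L..L}" for x
      using nn[OF that] R by simp
  qed (use R in auto)
  also have "\<dots> = (\<integral>x. 2 * R / a * F x + 2 / a\<^sup>2 * (x * F x) \<partial>lborel)"
  proof (intro Bochner_Integration.integral_cong refl)
    fix x
    show "k (g x) * (2 * (R + x / a) / a) * indicator {- L..L} x = 2 * R / a * F x + 2 / a\<^sup>2 * (x * F x)"
    proof (cases "x \<in> {- L..L}")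
      case True
      have "k (g x) = F x"
      proof -
        have "sqrt (g x) = R + x / a" unfolding g_def using nn[OF True] by simp
        moreover have "a * (R + x / a - R) = x" using R by simp
        ultimately show ?thesis unfolding k_def by simp
      qed
      with True R show ?thesis by (simp add: field_simps power2_eq_square)
    next
      case False
      then show ?thesis using supp[OF False] by simp
    qed
  qed
  also have "\<dots> = 2 * R / a * (\<integral>x. F x \<partial>lborel) + 2 / a\<^sup>2 * (\<integral>x. x * F x \<partial>lborel)"
    using F_int xF_int by simp
  finally show ?thesis by (simp add: k_def)
qed

text \<open>Terms outside the annulus vanish, which reduces the infinite sum to a finite one;
  \<open>sqrt ((cmod z)\<^sup>2)\<close> displays the summand as a function of the squared
  modulus.\<close>

lemma infsum_annulus:
  fixes F :: "real \<Rightarrow> real"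
  assumes R: "0 < a" "0 < L" "L / a < R" and supp: "\<And>x. x \<notin> {- L..L} \<Longrightarrow> F x = 0"
    and fin: "finite (radial_points G ((R + L / a)\<^sup>2) \<omega>)"
  shows "(\<Sum>\<^sub>\<infinity>z\<in>G \<omega>. F (a * (cmod z - R)))
       = (\<Sum>z\<in>radial_points G ((R + L / a)\<^sup>2) \<omega>. F (a * (sqrt ((cmod z)\<^sup>2) - R)))"
proof -
  have "(\<Sum>\<^sub>\<infinity>z\<in>G \<omega>. F (a * (cmod z - R)))
      = (\<Sum>\<^sub>\<infinity>z\<in>radial_points G ((R + L / a)\<^sup>2) \<omega>. F (a * (sqrt ((cmod z)\<^sup>2) - R)))"
  proof (rule infsum_cong_neutral)
    fix z assume "z \<in> G \<omega> - radial_points G ((R + L / a)\<^sup>2) \<omega>"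
    then have "(cmod z)\<^sup>2 \<notin> {(R - L / a)\<^sup>2..(R + L / a)\<^sup>2}" by (auto simp: radial_points_def)
    from annulus_support[OF R supp this] show "F (a * (cmod z - R)) = 0" by simp
  qed (auto simp: radial_points_def)
  with fin show ?thesis by simp
qed

theorem theorem1p4:
  fixes M :: "'w measure" and G :: "'w \<Rightarrow> complex set"
    and a :: "real \<Rightarrow> real" and f :: "real \<Rightarrow> real"
  assumes "ginibre_ensemble M G"
    and "\<forall>R>0. a R > 0"
    and "filterlim a at_top at_top"
    and "((\<lambda>R. a R / R) \<longlongrightarrow> 0) at_top"
    and "f \<in> borel_measurable borel"
    and "bounded (range f)"
    and "compact (closure {x. f x \<noteq> 0})"
  shows "converges_in_law M
           (\<lambda>R \<omega>. sqrt (a R / R) * (\<Sum>\<^sub>\<infinity>z\<in>G \<omega>. f (a R * (cmod z - R)))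
                   - 2 * sqrt (R / a R) * (\<integral>x. f x \<partial>lborel))
           (gaussian_law (2 * (\<integral>x. (f x)\<^sup>2 \<partial>lborel)))
           at_top"
proof -
  note G = assms(1) and a_pos = assms(2) and a_lim = assms(3) and aR_lim = assms(4)
  note f [measurable] = assms(5)
  interpret prob_space M
    using ginibre_simple_point_process[OF G] by (simp add: simple_point_process_def)
  obtain B where B: "\<And>x. \<bar>f x\<bar> \<le> B"
    using assms(6) by (auto simp: bounded_iff)
  have B0: "0 \<le> B" using B[of 0] by linarith
  obtain L where L: "0 < L" "\<And>x. x \<notin> {- L..L} \<Longrightarrow> f x = 0"
  proof -
    have "bounded {x. f x \<noteq> 0}"
      using assms(7) by (meson bounded_subset closure_subset compact_imp_bounded)
    then obtain L where "0 < L" "\<And>x. f x \<noteq> 0 \<Longrightarrow> \<bar>x\<bar> \<le> L"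
      by (auto simp: bounded_pos)
    then show ?thesis by (intro that[of L]) force+
  qed
  define V where "V = 2 * (\<integral>x. (f x)\<^sup>2 \<partial>lborel)"
  have V0: "0 \<le> V" by (simp add: V_def)
  define c where "c = (\<lambda>R. sqrt (a R / R))"
  define d where "d = (\<lambda>R. 2 * sqrt (R / a R) * (\<integral>x. f x \<partial>lborel))"
  define Y where "Y = (\<lambda>R \<omega>. c R * (\<Sum>\<^sub>\<infinity>z\<in>G \<omega>. f (a R * (cmod z - R))) - d R)"
  \<comment> \<open>The rescaling is put into the test function, so its sup norm is at most
    \<open>c R * B\<close> and tends to 0.\<close>
  define h where "h = (\<lambda>R s. c R * f (a R * (sqrt s - R)))"
  define u where "u = (\<lambda>R. (R - L / a R)\<^sup>2)"
  define v where "v = (\<lambda>R. (R + L / a R)\<^sup>2)"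
  \<comment> \<open>The margin R / 2 instead of R keeps sqrt(u R) above R / 2, as the bound on Q
    requires.\<close>
  define good where "good = (\<lambda>R. 0 < R \<and> 0 < a R \<and> L / a R < R / 2)"
  define S where "S = (\<lambda>R \<omega>. \<Sum>z\<in>radial_points G (v R) \<omega>. h R ((cmod z)\<^sup>2))"
  have La_lim: "((\<lambda>R. L / a R) \<longlongrightarrow> 0) at_top"
    by (rule real_tendsto_divide_at_top[OF tendsto_const a_lim])
  have good: "eventually good at_top"
  proof -
    have "eventually (\<lambda>R. L / a R < 1) at_top"
      using La_lim by (rule order_tendstoD) simp
    moreover have "eventually (\<lambda>R::real. R > 2) at_top" by (rule eventually_gt_at_top)
    ultimately show ?thesis
    proof eventually_elim
      case (elim R)
      then have "L / a R < R / 2" by linarith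
      with elim a_pos show ?case unfolding good_def by (intro conjI) auto
    qed
  qed
  have goodD: "0 < R" "0 < a R" "L / a R < R" "0 < u R" "u R \<le> v R" "0 < c R" "R / 2 \<le> sqrt (u R)" if "good R" for R
  proof -
    have 0: "0 < R \<and> 0 < a R \<and> L / a R < R / 2" using that unfolding good_def .
    then show 1: "0 < R" "0 < a R" "L / a R < R" by linarith+
    have La: "0 < L / a R" using L 1 by simp
    show "0 < u R" using 1 by (simp add: u_def)
    show "u R \<le> v R" unfolding u_def v_def using 1 La by (intro power_mono) auto
    show "0 < c R" using 1 by (simp add: c_def)
    have "sqrt (u R) = R - L / a R" unfolding u_def using 1 by simp
    then show "R / 2 \<le> sqrt (u R)" using 0 by linarith
  qed
  have h_meas [measurable]: "h R \<in> borel_measurable borel" for R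
    unfolding h_def by measurable
  have hB: "\<bar>h R s\<bar> \<le> c R * B" if "good R" for R s
    using goodD(6)[OF that] B unfolding h_def abs_mult by (intro mult_mono) auto
  have h_supp: "h R s = 0" if "good R" "s \<notin> {u R..v R}" for R s
    unfolding h_def using annulus_support[where F = f and s = s, OF goodD(2)[OF that(1)] L(1) goodD(3)[OF that(1)] L(2)] that(2)
    by (simp add: u_def v_def)
  have S_meas: "S R \<in> borel_measurable M" if "good R" for R
    unfolding S_def by (rule ginibre_sum_measurable[OF G h_meas hB[OF that]])
  have Y_eq: "Y R \<omega> = S R \<omega> - d R" if "good R" "\<omega> \<in> space M" for R \<omega>
    using infsum_annulus[where F = f, OF goodD(2)[OF that(1)] L(1) goodD(3)[OF that(1)] L(2) finite_radial_points[OF G that(2)]]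
    by (simp add: Y_def S_def h_def v_def sum_distrib_left)
  have Y_meas: "Y R \<in> borel_measurable M" if "good R" for R
    using S_meas[OF that] by (subst measurable_cong[OF Y_eq[OF that]]) auto
  \<comment> \<open>The implication is inside the existential, so that choice yields a total
    function of R, arbitrary where R is not good.\<close>
  have "\<exists>Q. good R \<longrightarrow> 0 \<le> Q \<and> Q \<le> (c R * B * (v R - u R))\<^sup>2 / sqrt (u R) \<and>
      (\<forall>t. cmod (char (distr M borel (S R)) t
            - iexp (t * integral\<^sup>L lborel (h R)) * of_real (exp (- (t\<^sup>2 * ((\<integral>s. (h R s)\<^sup>2 \<partial>lborel) - Q) / 2))))
          \<le> (\<bar>t\<bar> ^ 3 * (c R * B) + t ^ 4 * (c R * B)\<^sup>2) * (\<integral>s. (h R s)\<^sup>2 \<partial>lborel))" for R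
    unfolding S_def
    by (cases "good R")
       (metis ginibre_char_bound[OF G goodD(4,5) h_meas hB h_supp], blast)
  then obtain Q where Q: "\<And>R. good R \<Longrightarrow> 0 \<le> Q R" "\<And>R. good R \<Longrightarrow> Q R \<le> (c R * B * (v R - u R))\<^sup>2 / sqrt (u R)"
      "\<And>R t. good R \<Longrightarrow> cmod (char (distr M borel (S R)) t
            - iexp (t * integral\<^sup>L lborel (h R)) * of_real (exp (- (t\<^sup>2 * ((\<integral>s. (h R s)\<^sup>2 \<partial>lborel) - Q R) / 2))))
          \<le> (\<bar>t\<bar> ^ 3 * (c R * B) + t ^ 4 * (c R * B)\<^sup>2) * (\<integral>s. (h R s)\<^sup>2 \<partial>lborel)"
    by metis
  have c_lim: "(c \<longlongrightarrow> 0) at_top"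
    using tendsto_real_sqrt[OF aR_lim] by (simp add: c_def)
  have inv_lim: "((\<lambda>R. 1 / a R) \<longlongrightarrow> 0) at_top"
    by (rule real_tendsto_divide_at_top[OF tendsto_const a_lim])
  have I1_lim: "((\<lambda>R. integral\<^sup>L lborel (h R) - d R) \<longlongrightarrow> 0) at_top"
  proof (rule Lim_transform_eventually)
    \<comment> \<open>The leading term of \<open>annulus_integral\<close> is exactly the centering
      \<open>d R\<close>; only its correction term remains.\<close>
    show "((\<lambda>R. c R * (2 * (1 / a R)\<^sup>2 * (\<integral>x. x * f x \<partial>lborel))) \<longlongrightarrow> 0) at_top"
      by (rule tendsto_eq_intros c_lim inv_lim refl | simp)+
    show "eventually (\<lambda>R. c R * (2 * (1 / a R)\<^sup>2 * (\<integral>x. x * f x \<partial>lborel)) = integral\<^sup>L lborel (h R) - d R) at_top"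
      using good
    proof eventually_elim
      case (elim R)
      note R = goodD[OF elim]
      have "integral\<^sup>L lborel (h R) = c R * (2 * R / a R * (\<integral>x. f x \<partial>lborel) + 2 / (a R)\<^sup>2 * (\<integral>x. x * f x \<partial>lborel))"
        unfolding h_def using annulus_integral[where F = f, OF R(2) L(1) R(3) L(2) f B] by simp
      also have "\<dots> = c R * (2 * R / a R) * (\<integral>x. f x \<partial>lborel) + c R * (2 / (a R)\<^sup>2 * (\<integral>x. x * f x \<partial>lborel))"
        by (simp only: distrib_left mult.assoc)
      also have "c R * (2 * R / a R) = 2 * sqrt (R / a R)"
      proof -
        have "c R * (R / a R) = sqrt (a R / R * (R / a R)\<^sup>2)"
          using R unfolding c_def real_sqrt_mult by simp
        also have "a R / R * (R / a R)\<^sup>2 = R / a R" using R by (simp add: power2_eq_square field_simps)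
        finally have 1: "c R * (R / a R) = sqrt (R / a R)" .
        have "c R * (2 * R / a R) = 2 * (c R * (R / a R))" by simp
        then show ?thesis by (simp only: 1)
      qed
      finally show ?case by (simp add: d_def power_divide)
    qed
  qed
  have I2_lim: "((\<lambda>R. \<integral>s. (h R s)\<^sup>2 \<partial>lborel) \<longlongrightarrow> V) at_top"
  proof (rule Lim_transform_eventually)
    \<comment> \<open>The prefactor a_R / R cancels R / a_R in the Jacobian, which leaves the 2 in
      \<open>V\<close>; the rest is the correction term.\<close>
    show "((\<lambda>R. V + 2 * (1 / R) * (1 / a R) * (\<integral>x. x * (f x)\<^sup>2 \<partial>lborel)) \<longlongrightarrow> V) at_top"
      by (rule tendsto_eq_intros inv_lim real_tendsto_divide_at_top[OF tendsto_const filterlim_ident] refl | simp)+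
    show "eventually (\<lambda>R. V + 2 * (1 / R) * (1 / a R) * (\<integral>x. x * (f x)\<^sup>2 \<partial>lborel) = (\<integral>s. (h R s)\<^sup>2 \<partial>lborel)) at_top"
      using good
    proof eventually_elim
      case (elim R)
      note R = goodD[OF elim]
      have f2: "\<bar>(f x)\<^sup>2\<bar> \<le> B\<^sup>2" for x
        using B[of x] by (simp add: abs_le_square_iff[symmetric])
      have "(\<integral>s. (f (a R * (sqrt s - R)))\<^sup>2 \<partial>lborel)
          = 2 * R / a R * (\<integral>x. (f x)\<^sup>2 \<partial>lborel) + 2 / (a R)\<^sup>2 * (\<integral>x. x * (f x)\<^sup>2 \<partial>lborel)"
        using L(2) by (intro annulus_integral[where F = "\<lambda>x. (f x)\<^sup>2", OF R(2) L(1) R(3) _ _ f2]) auto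
      then have "(\<integral>s. (h R s)\<^sup>2 \<partial>lborel) = a R / R * (2 * R / a R * (\<integral>x. (f x)\<^sup>2 \<partial>lborel) + 2 / (a R)\<^sup>2 * (\<integral>x. x * (f x)\<^sup>2 \<partial>lborel))"
        using R unfolding h_def power_mult_distrib by (simp add: c_def)
      also have "\<dots> = V + 2 * (1 / R) * (1 / a R) * (\<integral>x. x * (f x)\<^sup>2 \<partial>lborel)"
        using R unfolding V_def by (simp add: field_simps power2_eq_square)
      finally show ?case ..
    qed
  qed
  have Q_lim: "(Q \<longlongrightarrow> 0) at_top"
  proof (rule tendsto_sandwich)
    show "eventually (\<lambda>R. 0 \<le> Q R) at_top" using good by eventually_elim (rule Q)
    \<comment> \<open>Here v - u = 4 R L / a_R: its square gives 16, and division by sqrt u \<ge> R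
      / 2 gives the other factor 2.\<close>
    show "((\<lambda>R. 32 * B\<^sup>2 * L\<^sup>2 * (1 / a R)) \<longlongrightarrow> 0) at_top"
      by (rule tendsto_eq_intros inv_lim refl | simp)+
    show "eventually (\<lambda>R. Q R \<le> 32 * B\<^sup>2 * L\<^sup>2 * (1 / a R)) at_top"
      using good
    proof eventually_elim
      case (elim R)
      note R = goodD[OF elim]
      have vu: "v R - u R = 4 * R * L / a R"
        by (simp add: v_def u_def power2_eq_square algebra_simps)
      have "Q R \<le> (c R * B * (v R - u R))\<^sup>2 / sqrt (u R)" by (rule Q(2)[OF elim])
      also have "\<dots> \<le> (c R * B * (v R - u R))\<^sup>2 / (R / 2)"
        using R by (intro divide_left_mono) auto
      also have "(c R * B * (v R - u R))\<^sup>2 = (c R)\<^sup>2 * B\<^sup>2 * (4 * R * L / a R)\<^sup>2"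
        unfolding vu by (simp only: power_mult_distrib[of "c R * B"] power_mult_distrib[of "c R"])
      also have "(c R)\<^sup>2 = a R / R"
        using R by (simp add: c_def)
      also have "a R / R * B\<^sup>2 * (4 * R * L / a R)\<^sup>2 / (R / 2) = 32 * B\<^sup>2 * L\<^sup>2 * (1 / a R)"
        using R by (simp add: field_simps power2_eq_square)
      finally show ?case .
    qed
  qed simp
  have char_lim: "((\<lambda>R. char (distr M borel (Y R)) t) \<longlongrightarrow> char (gaussian_law V) t) at_top" for t
  proof -
    define m where "m = (\<lambda>R. iexp (t * (integral\<^sup>L lborel (h R) - d R)) * complex_of_real (exp (- (t\<^sup>2 * ((\<integral>s. (h R s)\<^sup>2 \<partial>lborel) - Q R) / 2))))"
    have "(m \<longlongrightarrow> iexp (t * 0) * of_real (exp (- (t\<^sup>2 * (V - 0) / 2)))) at_top"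
      unfolding m_def by (intro tendsto_intros I1_lim I2_lim Q_lim) auto
    then have m_lim: "(m \<longlongrightarrow> char (gaussian_law V) t) at_top"
      by (simp add: char_gaussian_law[OF V0])
    have "((\<lambda>R. char (distr M borel (Y R)) t - m R) \<longlongrightarrow> 0) at_top"
    proof (rule Lim_null_comparison)
      have "((\<lambda>R. (\<bar>t\<bar> ^ 3 * (c R * B) + t ^ 4 * (c R * B)\<^sup>2) * (\<integral>s. (h R s)\<^sup>2 \<partial>lborel)) \<longlongrightarrow>
          (\<bar>t\<bar> ^ 3 * (0 * B) + t ^ 4 * (0 * B)\<^sup>2) * V) at_top"
        by (intro tendsto_intros c_lim I2_lim)
      then show "((\<lambda>R. (\<bar>t\<bar> ^ 3 * (c R * B) + t ^ 4 * (c R * B)\<^sup>2) * (\<integral>s. (h R s)\<^sup>2 \<partial>lborel)) \<longlongrightarrow> 0) at_top"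
        by simp
      show "eventually (\<lambda>R. norm (char (distr M borel (Y R)) t - m R) \<le> (\<bar>t\<bar> ^ 3 * (c R * B) + t ^ 4 * (c R * B)\<^sup>2) * (\<integral>s. (h R s)\<^sup>2 \<partial>lborel)) at_top"
        using good
      proof eventually_elim
        case (elim R)
        have "char (distr M borel (Y R)) t = (\<integral>\<omega>. iexp (t * Y R \<omega>) \<partial>M)"
          using Y_meas[OF elim] by (simp add: char_def integral_distr)
        also have "\<dots> = (\<integral>\<omega>. iexp (- (t * d R)) * iexp (t * S R \<omega>) \<partial>M)"
        proof (intro Bochner_Integration.integral_cong refl)
          fix \<omega> assume "\<omega> \<in> space M"
          then show "iexp (t * Y R \<omega>) = iexp (- (t * d R)) * iexp (t * S R \<omega>)"
            by (simp add: Y_eq[OF elim] exp_add[symmetric] algebra_simps)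
        qed
        also have "\<dots> = iexp (- (t * d R)) * (\<integral>\<omega>. iexp (t * S R \<omega>) \<partial>M)"
          by (rule Bochner_Integration.integral_mult_right_zero)
        also have "(\<integral>\<omega>. iexp (t * S R \<omega>) \<partial>M) = char (distr M borel (S R)) t"
          using S_meas[OF elim] by (simp add: char_def integral_distr)
        finally have "char (distr M borel (Y R)) t - m R = iexp (- (t * d R)) * (char (distr M borel (S R)) t
            - iexp (t * integral\<^sup>L lborel (h R)) * of_real (exp (- (t\<^sup>2 * ((\<integral>s. (h R s)\<^sup>2 \<partial>lborel) - Q R) / 2))))"
        proof -
          assume ch: "char (distr M borel (Y R)) t = iexp (- (t * d R)) * char (distr M borel (S R)) t"
          have "iexp (t * (integral\<^sup>L lborel (h R) - d R)) = iexp (- (t * d R)) * iexp (t * integral\<^sup>L lborel (h R))"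
            by (simp add: exp_add[symmetric] algebra_simps)
          then show ?thesis
            unfolding m_def ch right_diff_distrib by (simp only: mult.assoc)
        qed
        then show ?case
          using Q(3)[OF elim, of t] by (simp only: norm_mult norm_exp_i_times mult_1_left)
      qed
    qed
    from tendsto_add[OF this m_lim] show ?thesis by simp
  qed
  obtain R0 where R0: "good R0" using good by (auto dest: eventually_happens)
  have "((\<lambda>R. cdf (distr M borel (Y R)) x) \<longlongrightarrow> cdf (gaussian_law V) x) at_top"
    if x: "isCont (cdf (gaussian_law V)) x" for x
  proof (rule tendsto_at_topI_sequentially)
    fix X :: "nat \<Rightarrow> real" assume X: "filterlim X at_top sequentially"
    \<comment> \<open>The continuity theorem concerns sequences and wants a probability law on the
      line at every index, hence the bad terms are replaced by a fixed good radius. Only finitely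
      many terms change.\<close>
    define X' where "X' = (\<lambda>n. if good (X n) then X n else R0)"
    have X'_good: "good (X' n)" for n using R0 by (simp add: X'_def)
    have ev: "eventually (\<lambda>n. X' n = X n) sequentially"
      using eventually_compose_filterlim[OF good X] by eventually_elim (simp add: X'_def)
    have X': "filterlim X' at_top sequentially"
      using X ev by (simp add: filterlim_cong[OF refl refl ev])
    have "weak_conv_m (\<lambda>n. distr M borel (Y (X' n))) (gaussian_law V)"
    proof (rule levy_continuity)
      show "real_distribution (distr M borel (Y (X' n)))" for n
        by (rule real_distribution_distr[OF Y_meas[OF X'_good]])
      show "real_distribution (gaussian_law V)" by (rule gaussian_law_real_distribution[OF V0])
      show "(\<lambda>n. char (distr M borel (Y (X' n))) t) \<longlonglongrightarrow> char (gaussian_law V) t" for t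
        by (rule filterlim_compose[OF char_lim X'])
    qed
    then have "(\<lambda>n. cdf (distr M borel (Y (X' n))) x) \<longlonglongrightarrow> cdf (gaussian_law V) x"
      using x by (simp add: weak_conv_m_def weak_conv_def)
    then show "(\<lambda>n. cdf (distr M borel (Y (X n))) x) \<longlonglongrightarrow> cdf (gaussian_law V) x"
      by (rule Lim_transform_eventually) (use ev in \<open>auto elim!: eventually_mono\<close>)
  qed
  moreover have "eventually (\<lambda>R. Y R \<in> borel_measurable M) at_top"
    using good by eventually_elim (rule Y_meas)
  ultimately have "converges_in_law M Y (gaussian_law V) at_top"
    unfolding converges_in_law_def by blast
  then show ?thesis unfolding Y_def c_def d_def V_def .
qed

end
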